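(* Let $d\ge 2$, let $\mu$ be a probability measure on $\mathcal{P}$, and let $(X_n)_{n\ge 0}$ be the random walk in i.i.d. random environment determined by $\mu$, with annealed law $P$. Fix $\ell\in\mathbb{R}^d\setminus\{o\}$ and let $A_+$ and $A_-$ denote the events that $X_n\cdot\ell\to+\infty$ and $X_n\cdot\ell\to-\infty$ (as $n\to\infty$) respectively. Then there exist deterministic $v_+(\ell),v_-(\ell)\in\mathbb{R}$ such that $$\lim_{n\to\infty}\frac{X_n\cdot\ell}{n}=v_+(\ell)\,\mathbf{1}_{A_+}+v_-(\ell)\,\mathbf{1}_{A_-},\qquad P\text{-almost surely.}$$
   Context: $\mathcal{E}=\{\pm e_i: i=1,\dots,d\}$ is the set of unit vectors in $\mathbb{Z}^d$ and $o$ is the origin. $\mathcal{P}$ is the set of probability measures on $\mathcal{E}$, and $\mu$ is a probability measure on $\mathcal{P}$. $\Omega=\mathcal{P}^{\mathbb{Z}^d}$ carries the product measure $\nu=\mu^{\otimes\mathbb{Z}^d}$; an environment is $\omega=(\omega_x)_{x\in\mathbb{Z}^d}\in\Omega$ (so the $\omega_x$ are i.i.d. with law $\mu$ under $\nu$), and $\omega_x(e)$ means $\omega_x(\{e\})$. Given $\omega$, $\mathbb{P}_\omega$ is the law of the time-homogeneous Markov chain $(X_n)_{n\ge0}$ on $\mathbb{Z}^d$ with $X_0=o$ and transition probability $\omega_x(e)$ from $x$ to $x+e$, $e\in\mathcal{E}$. The annealed law is $P(\cdot)=\int \mathbb{P}_\omega(\cdot)\,d\nu(\omega)$. No ellipticity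 is assumed: $\omega_x(e)$ may vanish. *)

theory Defs
  imports "HOL-Probability.Probability"
begin

type_synonym 'd site = "int ^ 'd"
type_synonym 'd environment = "'d site \<Rightarrow> 'd site measure"

definition unit_steps :: "('d::finite) site set" where
  "unit_steps = (\<Union>i. {axis i 1, - axis i 1})"

text \<open>
  The measurable space of probability measures on the unit steps. The sigma-algebra of the
  Giry monad is generated by the evaluations \<open>p \<mapsto> p A\<close>; as there are finitely many unit steps,
  it is the Borel sigma-algebra of the simplex.
\<close>

definition step_laws :: "('d::finite) site measure measure" where
  "step_laws = prob_algebra (count_space unit_steps)"

definition environment_law :: "('d::finite) site measure measure \<Rightarrow> 'd environment measure" where
  "environment_law \<mu> = (\<Pi>\<^sub>M x\<in>UNIV. \<mu>)"

abbreviation path_space :: "(nat \<Rightarrow> ('d::finite) site) measure" where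
  "path_space \<equiv> (\<Pi>\<^sub>M n\<in>UNIV. count_space UNIV)"

text \<open>
  \<open>walk_kernel \<omega> n X\<close> is the conditional law of the position at time \<open>n\<close> given the positions
  \<open>X 0, \<dots>, X (n - 1)\<close>. The quenched law is the measure on paths that the Ionescu-Tulcea
  theorem constructs from these kernels.
\<close>

definition walk_kernel :: "('d::finite) environment \<Rightarrow> nat \<Rightarrow> (nat \<Rightarrow> 'd site) \<Rightarrow> 'd site measure" where
  "walk_kernel \<omega> n X =
    (case n of
      0 \<Rightarrow> return (count_space UNIV) 0
    | Suc m \<Rightarrow> distr (\<omega> (X m)) (count_space UNIV) (\<lambda>e. X m + e))"

definition quenched_law :: "('d::finite) environment \<Rightarrow> (nat \<Rightarrow> 'd site) measure" where
  "quenched_law \<omega> =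
    projective_family.lim UNIV (Ionescu_Tulcea.CI (walk_kernel \<omega>) (\<lambda>_. count_space UNIV))
      (\<lambda>_. count_space UNIV)"

definition annealed_law :: "('d::finite) site measure measure \<Rightarrow> (nat \<Rightarrow> 'd site) measure" where
  "annealed_law \<mu> = environment_law \<mu> \<bind> quenched_law"

definition proj :: "real ^ ('d::finite) \<Rightarrow> 'd site \<Rightarrow> real" where
  "proj l x = (\<chi> i. real_of_int (x $ i)) \<bullet> l"

definition A_plus :: "real ^ ('d::finite) \<Rightarrow> (nat \<Rightarrow> 'd site) set" where
  "A_plus l = {X. filterlim (\<lambda>n. proj l (X n)) at_top sequentially}"

definition A_minus :: "real ^ ('d::finite) \<Rightarrow> (nat \<Rightarrow> 'd site) set" where
  "A_minus l = {X. filterlim (\<lambda>n. proj l (X n)) at_bot sequentially}"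

text \<open>
  The following facts show that the kernels are measurable, so that the constructions above
  yield the intended measures.
\<close>

lemma finite_unit_steps: "finite (unit_steps :: ('d::finite) site set)"
  by (simp add: unit_steps_def)

lemma walk_kernel_prob_algebra:
  fixes \<omega> :: "('d::finite) environment"
  assumes "\<And>x. \<omega> x \<in> space step_laws"
  shows "walk_kernel \<omega> n X \<in> space (prob_algebra (count_space UNIV))"
proof (cases n)
  case 0
  then show ?thesis
    by (simp add: walk_kernel_def space_prob_algebra prob_space_return)
next
  case (Suc m)
  have 1: "sets (\<omega> (X m)) = sets (count_space unit_steps)" and 2: "prob_space (\<omega> (X m))"
    using assms[of "X m"] by (auto simp: step_laws_def space_prob_algebra)
  have "(\<lambda>e. X m + e) \<in> measurable (\<omega> (X m)) (count_space UNIV)"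
    by (simp add: measurable_cong_sets[OF 1 refl])
  then show ?thesis
    using Suc 2 by (simp add: walk_kernel_def space_prob_algebra prob_space.prob_space_distr)
qed

lemma Ionescu_Tulcea_walk_kernel:
  fixes \<omega> :: "('d::finite) environment"
  assumes \<omega>: "\<And>x. \<omega> x \<in> space step_laws"
  shows "Ionescu_Tulcea (walk_kernel \<omega>) (\<lambda>_. count_space UNIV)"
proof (rule Ionescu_Tulcea.intro)
  fix i
  show "walk_kernel \<omega> i \<in> measurable (PiM {0..<i} (\<lambda>_. count_space UNIV)) (subprob_algebra (count_space UNIV))"
  proof (cases i)
    case 0
    have "walk_kernel \<omega> i \<in> measurable (PiM {0..<i} (\<lambda>_. count_space UNIV)) (prob_algebra (count_space UNIV))"
      using walk_kernel_prob_algebra[of \<omega> 0, OF \<omega>] unfolding 0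
      by (simp add: walk_kernel_def[abs_def])
    then show ?thesis by (rule measurable_prob_algebraD)
  next
    case (Suc m)
    define g where "g x = walk_kernel \<omega> i (\<lambda>_. x)" for x
    have g: "g \<in> measurable (count_space UNIV) (prob_algebra (count_space UNIV))"
      using walk_kernel_prob_algebra[of \<omega> i, OF \<omega>] by (auto simp: g_def)
    have "(\<lambda>X. g (X m)) \<in> measurable (PiM {0..<i} (\<lambda>_. count_space UNIV)) (prob_algebra (count_space UNIV))"
      by (rule measurable_compose[OF _ g], rule measurable_component_singleton) (simp add: Suc)
    moreover have "(\<lambda>X. g (X m)) = walk_kernel \<omega> i"
      by (auto simp: g_def Suc walk_kernel_def)
    ultimately show ?thesis by (metis measurable_prob_algebraD)
  qed
next
  show "prob_space (walk_kernel \<omega> i x)" for i x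
    using walk_kernel_prob_algebra[of \<omega> i x, OF \<omega>] by (simp add: space_prob_algebra)
qed

lemma emeasure_walk_kernel_Suc:
  fixes \<omega> :: "('d::finite) environment"
  assumes \<omega>: "\<And>x. \<omega> x \<in> space step_laws"
  shows "emeasure (walk_kernel \<omega> (Suc m) X) {y} = emeasure (\<omega> (X m)) {y - X m}"
proof -
  have 1: "sets (\<omega> (X m)) = sets (count_space unit_steps)"
    using \<omega>[of "X m"] by (auto simp: step_laws_def space_prob_algebra)
  then have 2: "space (\<omega> (X m)) = unit_steps"
    by (metis sets_eq_imp_space_eq space_count_space)
  have "(\<lambda>e. X m + e) \<in> measurable (\<omega> (X m)) (count_space UNIV)"
    by (simp add: measurable_cong_sets[OF 1 refl])
  then have "emeasure (walk_kernel \<omega> (Suc m) X) {y}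
      = emeasure (\<omega> (X m)) ((\<lambda>e. X m + e) -` {y} \<inter> unit_steps)"
    by (simp add: walk_kernel_def emeasure_distr 2)
  also have "(\<lambda>e. X m + e) -` {y} \<inter> unit_steps = {y - X m} \<inter> unit_steps"
    by auto
  also have "emeasure (\<omega> (X m)) \<dots> = emeasure (\<omega> (X m)) {y - X m}"
    by (cases "y - X m \<in> unit_steps") (auto simp: emeasure_notin_sets 1)
  finally show ?thesis .
qed

lemma sets_singleton_PiM_count_space:
  fixes X :: "nat \<Rightarrow> ('d::finite) site"
  assumes "finite J" "X \<in> extensional J"
  shows "{X} \<in> sets (PiM J (\<lambda>_. count_space UNIV))"
proof -
  have "Pi\<^sub>E J (\<lambda>i. {X i}) \<in> sets (PiM J (\<lambda>_. count_space UNIV))"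
    using assms(1) by (intro sets_PiM_I_finite) auto
  moreover have "Pi\<^sub>E J (\<lambda>i. {X i}) = {X}"
    using assms(2) by (auto simp: PiE_iff intro: extensionalityI[of _ J] extensional_arb)
  ultimately show ?thesis by simp
qed

lemma emeasure_walk_singleton:
  fixes \<omega> :: "('d::finite) environment"
  assumes \<omega>: "\<And>x. \<omega> x \<in> space step_laws"
  shows "emeasure (Ionescu_Tulcea.C (walk_kernel \<omega>) (\<lambda>_. count_space UNIV) 0 n (\<lambda>_. undefined))
      {restrict X {0..<n}} = (\<Prod>i<n. emeasure (walk_kernel \<omega> i X) {X i})"
proof -
  interpret IT: Ionescu_Tulcea "walk_kernel \<omega>" "\<lambda>_. count_space UNIV"
    by (rule Ionescu_Tulcea_walk_kernel[OF \<omega>])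
  show ?thesis
  proof (induction n)
    case 0
    have "restrict X {0..<0} = (\<lambda>_. undefined)" by auto
    then show ?case
      using sets_singleton_PiM_count_space[of "{}" "\<lambda>_. undefined :: 'd site"] by simp
  next
    case (Suc n)
    let ?C = "IT.C 0 n (\<lambda>_. undefined)" and ?M = "\<lambda>n. PiM {0..<n} (\<lambda>_. count_space (UNIV :: 'd site set))"
    let ?X = "\<lambda>n. restrict X {0..<n}"
    have u: "(\<lambda>_. undefined) \<in> space (?M 0)" by (simp add: space_PiM PiE_iff extensional_def)
    have sC: "sets ?C = sets (?M n)" using IT.sets_C[OF u, of n] by simp
    have spC: "space ?C = space (?M n)" using IT.space_C[OF u, of n] by simp
    have ne: "space ?C \<noteq> {}" using IT.prob_space_C[OF u] prob_space.not_empty by blast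
    have S: "{?X n} \<in> sets (?M n)" for n by (rule sets_singleton_PiM_count_space) auto
    have "emeasure (IT.C 0 (Suc n) (\<lambda>_. undefined)) {?X (Suc n)}
        = (\<integral>\<^sup>+y. emeasure (IT.eP n y) {?X (Suc n)} \<partial>?C)"
      using IT.measurable_eP[of n] S[of "Suc n"]
      by (simp add: emeasure_bind[OF ne, where N="?M (Suc n)"] measurable_cong_sets[OF sC refl])
    also have "\<dots> = (\<integral>\<^sup>+y. emeasure (walk_kernel \<omega> n X) {X n} * indicator {?X n} y \<partial>?C)"
    proof (rule nn_integral_cong)
      fix y assume "y \<in> space ?C"
      then have y: "y \<in> space (?M n)" by (simp add: spC)
      have ext: "y i = undefined" if "\<not> i < n" for i
        using y that by (auto simp: space_PiM PiE_iff extensional_def)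
      have eq: "(y(n := z) = ?X (Suc n)) \<longleftrightarrow> y = ?X n \<and> z = X n" for z
      proof
        assume "y(n := z) = ?X (Suc n)"
        then have *: "(y(n := z)) i = ?X (Suc n) i" for i by simp
        have "y i = ?X n i" for i
          using *[of i] ext[of i] by (cases "i < n") (auto split: if_splits)
        then show "y = ?X n \<and> z = X n" using *[of n] by (auto simp: fun_eq_iff)
      next
        assume "y = ?X n \<and> z = X n"
        then show "y(n := z) = ?X (Suc n)" by (auto simp: fun_eq_iff)
      qed
      have k: "walk_kernel \<omega> n (?X n) = walk_kernel \<omega> n X"
        by (auto simp: walk_kernel_def split: nat.split)
      have "emeasure (IT.eP n y) {?X (Suc n)}
          = emeasure (walk_kernel \<omega> n y) ((\<lambda>z. y(n := z)) -` {?X (Suc n)})"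
        by (subst IT.emeasure_eP[OF y S]) simp
      also have "(\<lambda>z. y(n := z)) -` {?X (Suc n)} = (if y = ?X n then {X n} else {})"
        by (simp add: set_eq_iff vimage_def eq)
      also have "emeasure (walk_kernel \<omega> n y) \<dots>
          = emeasure (walk_kernel \<omega> n X) {X n} * indicator {?X n} y"
        using k by (auto simp: indicator_def)
      finally show "emeasure (IT.eP n y) {?X (Suc n)}
          = emeasure (walk_kernel \<omega> n X) {X n} * indicator {?X n} y" .
    qed
    also have "\<dots> = emeasure (walk_kernel \<omega> n X) {X n} * emeasure ?C {?X n}"
      using S by (subst nn_integral_cmult_indicator) (auto simp: sC)
    finally show ?case unfolding Suc.IH prod.lessThan_Suc by (simp only: mult.commute)
  qed
qed

lemma
  fixes \<omega> :: "('d::finite) environment"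
  assumes \<omega>: "\<And>x. \<omega> x \<in> space step_laws"
  shows prob_space_quenched_law: "prob_space (quenched_law \<omega>)"
    and sets_quenched_law: "sets (quenched_law \<omega>) = sets path_space"
    and emeasure_quenched_law_emb:
      "\<And>n B. B \<in> sets (PiM {0..<n} (\<lambda>_. count_space UNIV)) \<Longrightarrow>
        emeasure (quenched_law \<omega>) (prod_emb UNIV (\<lambda>_. count_space UNIV) {0..<n} B) =
        emeasure (Ionescu_Tulcea.C (walk_kernel \<omega>) (\<lambda>_. count_space UNIV) 0 n (\<lambda>_. undefined)) B"
proof -
  interpret IT: Ionescu_Tulcea "walk_kernel \<omega>" "\<lambda>_. count_space UNIV"
    by (rule Ionescu_Tulcea_walk_kernel[OF \<omega>])
  have q: "quenched_law \<omega> = IT.PF.lim" by (simp add: quenched_law_def)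
  show "sets (quenched_law \<omega>) = sets path_space" by (simp add: q)
  show e: "emeasure (quenched_law \<omega>) (prod_emb UNIV (\<lambda>_. count_space UNIV) {0..<n} B) =
      emeasure (IT.C 0 n (\<lambda>_. undefined)) B"
    if "B \<in> sets (PiM {0..<n} (\<lambda>_. count_space UNIV))" for n B
  proof -
    have "prod_emb {0..<n} (\<lambda>_. count_space UNIV) {0..<n} B = B"
      using sets.sets_into_space[OF that] by (simp add: prod_emb_id space_PiM)
    then show ?thesis
      unfolding q using IT.lim[OF _ that] IT.emeasure_CI[OF _ that, of n] by simp
  qed
  have u: "(\<lambda>_. undefined) \<in> space (PiM {0..<0} (\<lambda>_. count_space (UNIV :: 'd site set)))"
    by (simp add: space_PiM PiE_iff extensional_def)
  have sp: "space (IT.C 0 0 (\<lambda>_. undefined)) = space (PiM {0..<0} (\<lambda>_. count_space UNIV))"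
    using IT.space_C[OF u, of 0] by simp
  have "prod_emb UNIV (\<lambda>_. count_space UNIV) {0..<0::nat} (space (PiM {0..<0} (\<lambda>_. count_space (UNIV :: 'd site set)))) = UNIV"
    by (auto simp: prod_emb_def space_PiM)
  moreover have "space (quenched_law \<omega>) = UNIV"
    by (simp add: q space_PiM)
  ultimately show "prob_space (quenched_law \<omega>)"
    using e[OF sets.top, of 0] prob_space.emeasure_space_1[OF IT.prob_space_C[OF u, of 0]] sp
    by (intro prob_spaceI) metis
qed

text \<open>The Markov property of the quenched law in terms of its finite-dimensional distributions.\<close>

lemma emeasure_quenched_law_cylinder:
  fixes \<omega> :: "('d::finite) environment"
  assumes \<omega>: "\<And>x. \<omega> x \<in> space step_laws"
  shows "emeasure (quenched_law \<omega>) {X. \<forall>i\<le>n. X i = x i} =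
    indicator {0} (x 0) * (\<Prod>i<n. emeasure (\<omega> (x i)) {x (Suc i) - x i})"
proof -
  let ?x = "restrict x {0..<Suc n}"
  have "{X. \<forall>i\<le>n. X i = x i} = prod_emb UNIV (\<lambda>_. count_space UNIV) {0..<Suc n} {?x}"
    by (auto simp: prod_emb_def space_PiM restrict_def fun_eq_iff less_Suc_eq_le) metis
  moreover have "{?x} \<in> sets (PiM {0..<Suc n} (\<lambda>_. count_space UNIV))"
    by (rule sets_singleton_PiM_count_space) auto
  ultimately have "emeasure (quenched_law \<omega>) {X. \<forall>i\<le>n. X i = x i} =
      (\<Prod>i<Suc n. emeasure (walk_kernel \<omega> i x) {x i})"
    by (simp only: emeasure_quenched_law_emb[OF \<omega>] emeasure_walk_singleton[OF \<omega>])
  also have "\<dots> = emeasure (walk_kernel \<omega> 0 x) {x 0} * (\<Prod>i<n. emeasure (walk_kernel \<omega> (Suc i) x) {x (Suc i)})"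
    by (rule prod.lessThan_Suc_shift)
  also have "emeasure (walk_kernel \<omega> 0 x) {x 0} = indicator {0} (x 0)"
    by (auto simp: walk_kernel_def indicator_def)
  finally show ?thesis by (simp add: emeasure_walk_kernel_Suc[OF \<omega>])
qed

lemma measurable_quenched_law:
  "quenched_law \<in> measurable (PiM UNIV (\<lambda>_. step_laws)) (prob_algebra (path_space :: (nat \<Rightarrow> ('d::finite) site) measure))"
proof (rule measurable_prob_algebra_generated[OF sets_PiM Int_stable_prod_algebra prod_algebra_sets_into_space])
  let ?N = "PiM UNIV (\<lambda>_. step_laws) :: 'd environment measure"
  let ?M = "\<lambda>_::nat. count_space (UNIV :: 'd site set)"
  have \<omega>: "\<omega> x \<in> space step_laws" if "\<omega> \<in> space ?N" for \<omega> x
    using that by (auto simp: space_PiM)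
  show "prob_space (quenched_law \<omega>)" if "\<omega> \<in> space ?N" for \<omega>
    using prob_space_quenched_law \<omega>[OF that] .
  show "sets (quenched_law \<omega>) = sets path_space" if "\<omega> \<in> space ?N" for \<omega> :: "'d environment"
    using sets_quenched_law \<omega>[OF that] .
  fix A assume "A \<in> prod_algebra UNIV ?M"
  then obtain J E where A: "A = prod_emb UNIV ?M J (Pi\<^sub>E J E)" and J: "finite J"
    by (auto elim!: prod_algebraE)
  from J obtain n where n: "J \<subseteq> {0..<n}"
    by (metis atLeast0LessThan finite_nat_iff_bounded)
  define B where "B = prod_emb {0..<n} ?M J (Pi\<^sub>E J E)"
  have B: "B \<in> sets (PiM {0..<n} ?M)"
    unfolding B_def using J n by (intro measurable_prod_emb) (auto intro!: sets_PiM_I_finite)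
  have AB: "A = prod_emb UNIV ?M {0..<n} B"
    unfolding A B_def using n by (intro prod_emb_trans[symmetric]) auto
  have sub: "B \<subseteq> Pi\<^sub>E {0..<n} (\<lambda>_. UNIV)"
    using sets.sets_into_space[OF B] by (simp add: space_PiM)
  then have cB: "countable B"
    by (rule countable_subset) (intro countable_PiE, auto)
  have ext: "restrict X {0..<n} = X" if "X \<in> B" for X
    using that sub by (auto simp: PiE_iff extensional_restrict)
  have "emeasure (quenched_law \<omega>) A =
      (\<integral>\<^sup>+X. (\<Prod>i<n. emeasure (walk_kernel \<omega> i X) {X i}) \<partial>count_space B)"
    if "\<omega> \<in> space ?N" for \<omega>
  proof -
    note w = \<omega>[OF that]
    interpret IT: Ionescu_Tulcea "walk_kernel \<omega>" ?M
      by (rule Ionescu_Tulcea_walk_kernel[OF w])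
    let ?C = "IT.C 0 n (\<lambda>_. undefined)"
    have s: "{X} \<in> sets ?C" if "X \<in> B" for X
    proof -
      have "{restrict X {0..<n}} \<in> sets (PiM {0..<n} ?M)"
        by (rule sets_singleton_PiM_count_space) auto
      then show ?thesis
        using IT.sets_C[of "\<lambda>_. undefined" 0 n] that by (simp add: space_PiM ext)
    qed
    have "emeasure (quenched_law \<omega>) A = emeasure ?C B"
      unfolding AB by (rule emeasure_quenched_law_emb[OF w B])
    also have "\<dots> = (\<integral>\<^sup>+X. emeasure ?C {X} \<partial>count_space B)"
      using emeasure_UN_countable[of B "\<lambda>X. {X}" ?C] s cB by (auto simp: disjoint_family_on_def)
    also have "\<dots> = (\<integral>\<^sup>+X. (\<Prod>i<n. emeasure (walk_kernel \<omega> i X) {X i}) \<partial>count_space B)"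
    proof (rule nn_integral_cong)
      fix X assume "X \<in> space (count_space B)"
      then show "emeasure ?C {X} = (\<Prod>i<n. emeasure (walk_kernel \<omega> i X) {X i})"
        using emeasure_walk_singleton[OF w, where n=n and X=X] ext[of X] by simp
    qed
    finally show ?thesis .
  qed
  moreover have "(\<lambda>\<omega>. \<integral>\<^sup>+X. (\<Prod>i<n. emeasure (walk_kernel \<omega> i X) {X i}) \<partial>count_space B)
      \<in> borel_measurable ?N"
  proof -
    have k: "(\<lambda>\<omega>. emeasure (walk_kernel \<omega> i X) {X i}) \<in> borel_measurable ?N" for i X
    proof (cases i)
      case 0
      then show ?thesis by (simp add: walk_kernel_def)
    next
      case (Suc m)
      have "(\<lambda>p. emeasure p {X i - X m}) \<in> borel_measurable (step_laws :: 'd site measure measure)"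
      proof (cases "X i - X m \<in> unit_steps")
        case True
        then have "(\<lambda>p. emeasure p {X i - X m}) \<in> borel_measurable (subprob_algebra (count_space unit_steps))"
          by (intro measurable_emeasure_subprob_algebra) auto
        then show ?thesis
          unfolding step_laws_def prob_algebra_def by (rule measurable_restrict_space1)
      next
        case False
        then have "emeasure p {X i - X m} = 0" if "p \<in> space step_laws" for p
          using that by (intro emeasure_notin_sets) (auto simp: step_laws_def space_prob_algebra)
        then show ?thesis by (simp cong: measurable_cong)
      qed
      then have "(\<lambda>\<omega>. emeasure (\<omega> (X m)) {X i - X m}) \<in> borel_measurable ?N"
        by (rule measurable_compose[OF measurable_component_singleton[OF UNIV_I]])
      moreover have "emeasure (walk_kernel \<omega> (Suc m) X) {X (Suc m)} = emeasure (\<omega> (X m)) {X (Suc m) - X m}"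
        if "\<omega> \<in> space ?N" for \<omega>
        using emeasure_walk_kernel_Suc \<omega>[OF that] .
      ultimately show ?thesis by (simp add: Suc cong: measurable_cong)
    qed
    interpret sigma_finite_measure "count_space B"
      by (rule sigma_finite_measure_count_space_countable[OF cB])
    have "(\<lambda>(X, \<omega>). \<Prod>i<n. emeasure (walk_kernel \<omega> i X) {X i})
        \<in> borel_measurable (count_space B \<Otimes>\<^sub>M ?N)"
      using k by (intro measurable_pair_measure_countable1 cB) simp
    then show ?thesis
      by (intro borel_measurable_nn_integral) (simp add: measurable_split_conv measurable_pair_swap_iff[of _ ?N])
  qed
  ultimately show "(\<lambda>\<omega>. emeasure (quenched_law \<omega>) A) \<in> borel_measurable ?N"
    by (subst measurable_cong)
qed

lemma annealed_law:
  fixes \<mu> :: "('d::finite) site measure measure"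
  assumes "prob_space \<mu>" and \<mu>: "sets \<mu> = sets step_laws"
  shows "prob_space (annealed_law \<mu>)"
    and "sets (annealed_law \<mu>) = sets path_space"
    and "A \<in> sets path_space \<Longrightarrow>
      emeasure (annealed_law \<mu>) A = (\<integral>\<^sup>+\<omega>. emeasure (quenched_law \<omega>) A \<partial>environment_law \<mu>)"
proof -
  have s: "sets (environment_law \<mu>) = sets (PiM UNIV (\<lambda>_. step_laws))"
    unfolding environment_law_def by (intro sets_PiM_cong refl \<mu>)
  have "prob_space (environment_law \<mu>)"
    unfolding environment_law_def by (intro prob_space_PiM assms)
  then have e: "environment_law \<mu> \<in> space (prob_algebra (PiM UNIV (\<lambda>_. step_laws)))"
    by (simp add: space_prob_algebra s)
  show "prob_space (annealed_law \<mu>)" "sets (annealed_law \<mu>) = sets path_space"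
    unfolding annealed_law_def
    by (rule prob_space_bind'[OF e measurable_quenched_law] sets_bind'[OF e measurable_quenched_law])+
  show "emeasure (annealed_law \<mu>) A = (\<integral>\<^sup>+\<omega>. emeasure (quenched_law \<omega>) A \<partial>environment_law \<mu>)"
    if "A \<in> sets path_space"
    unfolding annealed_law_def by (rule emeasure_bind_prob_algebra[OF e measurable_quenched_law that])
qed

end

(*
  Realise the walk as a deterministic function of a stack of steps at every site, read from the
  top at each visit. Under the annealed law the stacks are independent over the sites, and each
  stack is a stationary sequence (a mixture of i.i.d. ones). So unvisited sites carry fresh stacks,
  and removing a fixed number of entries does not change the law of a stack.

  Let h be a multiple of the direction l with |h| <= 1 on unit steps, and let escape be the event
  that h stays nonnegative and is unbounded above. If it is null, a walk that reaches a new level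
  typically visits the slab above that level many times before it has advanced by a constant M:
  each of its excursions returns, soon enough that only finitely many paths are possible, and the
  stacks that remain are as good as new. These events behave independently over levels M apart, so
  h(X n) > n / K happens finitely often.

  If escape has positive probability, a walk with h unbounded above regenerates infinitely often.
  The shift to the next regeneration preserves the law conditioned on escape and is independent of
  the block that it removes, which gives a law of large numbers for the durations and heights of
  the blocks. The mean height is finite because levels are regeneration levels with positive
  density; the mean duration may be infinite, and then the speed is 0.

  Applying this to l and to -l gives the theorem.
*)
theory Submission
  imports Defs
begin

text \<open>The directions \<open>l\<close> and \<open>-l\<close> are not treated as complementary
  cases. The claim for one direction is: almost surely the speed exists and is constant on
  \<open>A_plus l\<close>, and off \<open>A_plus l\<close> the upper speed is at most 0. Used for
  \<open>l\<close> and \<open>-l\<close>, this also gives speed 0 to a walk that tends to neither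
  infinity, so no zero-one law enters.

  Since transition probabilities may vanish, the walk cannot be forced along a chosen path, and a
  visited site may stay atypical for ever. Every estimate therefore treats the stacks outside a
  half-space as arbitrary and takes its randomness from stacks in the half-space that are fresh, or
  fresh up to a shift by fixed amounts.

  Heights are real and need not form a lattice. Regenerations are allowed at all heights; integer
  levels serve to find them and to measure their density, with overshoot below 1 because |h| <= 1 on
  unit steps.\<close>

section \<open>Partial sums along a measure-preserving map with independent blocks\<close>

text \<open>The hypothesis says, atom by atom, that the law of \<open>V\<close> under
  \<open>M\<close> restricted to \<open>A\<close> is \<open>prob A\<close> times its law under
  \<open>M\<close>. Equality of these two measures carries over to integrals of any
  \<open>g\<close>.\<close>

lemma (in prob_space) integral_indep_countable:
  fixes V :: "'a \<Rightarrow> 'v::countable" and g :: "'v \<Rightarrow> real"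
  assumes V: "V \<in> M \<rightarrow>\<^sub>M count_space UNIV" and A: "A \<in> sets M"
    and ind: "\<And>v. prob ({x\<in>space M. V x = v} \<inter> A) = prob {x\<in>space M. V x = v} * prob A"
  shows "(\<integral>x. indicator A x * g (V x) \<partial>M) = prob A * (\<integral>x. g (V x) \<partial>M)"
proof -
  let ?C = "count_space (UNIV :: 'v set)"
  let ?d = "density M (\<lambda>x. ennreal (indicator A x))"
  have Vd: "V \<in> measurable ?d ?C" using V by simp
  have eq: "distr ?d ?C V = density (distr M ?C V) (\<lambda>_. ennreal (prob A))"
  proof (rule measure_eqI_countable)
    fix v :: 'v
    have m: "{x\<in>space M. V x = v} \<in> sets M" using V by simp
    have vi: "V -` {v} \<inter> space M = {x\<in>space M. V x = v}" by auto
    have "emeasure (distr ?d ?C V) {v} = emeasure M ({x\<in>space M. V x = v} \<inter> A)"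
      using m A by (subst emeasure_distr[OF Vd])
        (simp_all add: vi emeasure_density indicator_inter_arith[symmetric] ennreal_indicator
          mult.commute[of "indicator A _"], simp add: Int_commute)
    also have "\<dots> = ennreal (prob A) * emeasure (distr M ?C V) {v}"
      by (subst emeasure_distr[OF V])
        (simp_all add: vi emeasure_eq_measure ind ennreal_mult' mult.commute)
    also have "\<dots> = emeasure (density (distr M ?C V) (\<lambda>_. ennreal (prob A))) {v}"
      by (simp add: emeasure_density_const)
    finally show "emeasure (distr ?d ?C V) {v} = \<dots>" .
  qed auto
  have "(\<integral>x. indicator A x * g (V x) \<partial>M) = (\<integral>x. g (V x) \<partial>?d)"
    using A V by (subst integral_density) auto
  also have "\<dots> = (\<integral>v. g v \<partial>distr ?d ?C V)"
    by (rule integral_distr[symmetric, OF Vd]) simp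
  also have "\<dots> = (\<integral>v. prob A * g v \<partial>distr M ?C V)"
    unfolding eq by (subst integral_density) auto
  also have "\<dots> = prob A * (\<integral>x. g (V x) \<partial>M)"
    by (subst integral_distr[OF V]) auto
  finally show ?thesis .
qed

text \<open>Together the assumptions make the sequence \<open>V ((T ^^ i) x)\<close> i.i.d. In the
  application \<open>T\<close> cuts off the path before the next regeneration and \<open>V\<close>
  records the duration and displacement of the removed block.\<close>

locale independent_blocks = prob_space M
  for M :: "'a measure" and T :: "'a \<Rightarrow> 'a" and V :: "'a \<Rightarrow> 'v::countable" +
  assumes measurable_T: "T \<in> M \<rightarrow>\<^sub>M M" and distr_T: "distr M M T = M"
    and measurable_V: "V \<in> M \<rightarrow>\<^sub>M count_space UNIV"
    and indep: "\<And>v J. J \<in> sets M \<Longrightarrow>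
      prob {x\<in>space M. V x = v \<and> T x \<in> J} = prob {x\<in>space M. V x = v} * prob J"
begin

text \<open>
  The maxima \<open>m n\<close> of the partial sums satisfy \<open>m (n + 1) - m n \<circ> T = max (- m n \<circ> T) Y\<close>.
  On the invariant event that they are unbounded the integral of the left side is nonnegative
  and the right side tends to \<open>Y\<close>, whose integral there is negative by independence.
\<close>

lemma AE_bounded_sums:
  fixes g :: "'v \<Rightarrow> real"
  assumes int: "integrable M (\<lambda>x. g (V x))" and neg: "expectation (\<lambda>x. g (V x)) < 0"
  shows "AE x in M. \<exists>K. \<forall>n. (\<Sum>i<n. g (V ((T ^^ i) x))) \<le> K"
proof -
  define Y where "Y x = g (V x)" for x
  \<comment> \<open>The recursion splits off the first summand rather than the last; this is what
    brings in \<open>T\<close>. The 0 stands for the empty sum.\<close>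
  define m where "m = rec_nat (\<lambda>_. 0) (\<lambda>_ f x. max 0 (Y x + f (T x)))"
  have m0: "m 0 x = 0" and mS: "m (Suc n) x = max 0 (Y x + m n (T x))" for n x
    by (simp_all add: m_def)
  have Y [measurable]: "Y \<in> borel_measurable M"
    unfolding Y_def using measurable_V by (rule measurable_compose) simp
  note T = measurable_T and V = measurable_V
  note T [measurable]
  have mm [measurable]: "m n \<in> borel_measurable M" for n
  proof (induction n)
    case 0
    have "m 0 = (\<lambda>_. 0)" by (auto simp: m0)
    then show ?case by simp
  next
    case (Suc n)
    note Suc [measurable]
    have "m (Suc n) = (\<lambda>x. max 0 (Y x + m n (T x)))" by (auto simp: mS)
    then show ?case by simp
  qed
  have intT: "(\<integral>x. f (T x) \<partial>M) = (\<integral>x. f x \<partial>M)" if "f \<in> borel_measurable M" for f :: "'a \<Rightarrow> real"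
    using integral_distr[OF T that] by (simp add: distr_T)
  have intgT: "integrable M (\<lambda>x. f (T x)) \<longleftrightarrow> integrable M f" if "f \<in> borel_measurable M" for f :: "'a \<Rightarrow> real"
    using integrable_distr_eq[OF T that] by (simp add: distr_T)
  have Yi: "integrable M Y" using int by (simp add: Y_def[abs_def])
  have mi: "integrable M (m n)" for n
  proof (induction n)
    case 0
    have "m 0 = (\<lambda>_. 0)" by (auto simp: m0)
    then show ?case by simp
  next
    case (Suc n)
    have "m (Suc n) = (\<lambda>x. max 0 (Y x + m n (T x)))" by (auto simp: mS)
    then show ?case using Suc Yi by (auto simp: intgT intro!: integrable_max)
  qed
  have mnn: "0 \<le> m n x" for n x by (cases n) (auto simp: m0 mS)
  have minc: "m n x \<le> m (Suc n) x" for n x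
  proof (induction n arbitrary: x)
    case (Suc n)
    from Suc[of "T x"] show ?case by (subst (1 2) mS) auto
  qed (simp add: mnn m0)
  have inc: "incseq (\<lambda>n. m n x)" for x by (rule incseq_SucI) (rule minc)
  have Sm: "(\<Sum>i<n. Y ((T ^^ i) x)) \<le> m n x" for n x
  proof (induction n arbitrary: x)
    case (Suc n)
    have "(\<Sum>i<Suc n. Y ((T ^^ i) x)) = Y x + (\<Sum>i<n. Y ((T ^^ i) (T x)))"
      by (subst sum.lessThan_Suc_shift) (simp add: funpow_swap1)
    also have "\<dots> \<le> m (Suc n) x" using Suc[of "T x"] by (auto simp: mS)
    finally show ?case .
  qed (simp add: m0)
  define J where "J = {x\<in>space M. \<forall>K::nat. \<exists>n. m n x > real K}"
  have J [measurable]: "J \<in> sets M" unfolding J_def by measurable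
  have TS: "T x \<in> space M" if "x \<in> space M" for x using T that by (rule measurable_space)
  have JT: "T x \<in> J \<longleftrightarrow> x \<in> J" if x: "x \<in> space M" for x
  proof
    assume a: "T x \<in> J"
    show "x \<in> J" unfolding J_def
    proof (safe intro!: x)
      fix K :: nat
      obtain n where "m n (T x) > real (nat \<lceil>real K + \<bar>Y x\<bar>\<rceil>)" using a unfolding J_def by blast
      then have "m n (T x) > real K + \<bar>Y x\<bar>" by linarith
      then have "m (Suc n) x > real K" by (auto simp: mS)
      then show "\<exists>n. m n x > real K" ..
    qed
  next
    assume a: "x \<in> J"
    show "T x \<in> J" unfolding J_def
    proof (safe intro!: TS x)
      fix K :: nat
      obtain n where "m n x > real (nat \<lceil>real K + \<bar>Y x\<bar>\<rceil>)" using a unfolding J_def by blast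
      then have "m n x > real K + \<bar>Y x\<bar>" by linarith
      with minc[of n x] have "m (Suc n) x > real K + \<bar>Y x\<bar>" by linarith
      then have "m n (T x) > real K" by (auto simp: mS max_def split: if_splits)
      then show "\<exists>n. m n (T x) > real K" ..
    qed
  qed
  have indJ: "indicator J (T x) = (indicator J x :: real)" if "x \<in> space M" for x
    using JT[OF that] by (auto simp: indicator_def)
  let ?f = "\<lambda>n x. indicator J x * max (- m n (T x)) (Y x)"
  have feq: "?f n x = indicator J x * m (Suc n) x - indicator J x * m n (T x)" for n x
    by (auto simp: indicator_def mS max_def)
  have mTi: "integrable M (\<lambda>x. m n (T x))" for n using mi by (simp add: intgT)
  have intJ: "integrable M (\<lambda>x. indicator J x * f x)" if "integrable M f" for f :: "'a \<Rightarrow> real"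
    using integrable_mult_indicator[OF J that] by simp
  have nonneg: "0 \<le> (\<integral>x. ?f n x \<partial>M)" for n
  proof -
    have 1: "(\<integral>x. ?f n x \<partial>M) =
        (\<integral>x. indicator J x * m (Suc n) x \<partial>M) - (\<integral>x. indicator J x * m n (T x) \<partial>M)"
      unfolding feq using mi mTi
      by (intro Bochner_Integration.integral_diff intJ)
    have "(\<integral>x. indicator J x * m n (T x) \<partial>M) = (\<integral>x. indicator J (T x) * m n (T x) \<partial>M)"
      by (rule Bochner_Integration.integral_cong) (auto simp: indJ)
    also have "\<dots> = (\<integral>x. indicator J x * m n x \<partial>M)"
      by (rule intT) measurable
    also have "\<dots> \<le> (\<integral>x. indicator J x * m (Suc n) x \<partial>M)"
      using mi minc by (intro integral_mono intJ) (auto simp: indicator_def)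
    finally show ?thesis using 1 by simp
  qed
  have "(\<lambda>n. \<integral>x. ?f n x \<partial>M) \<longlonglongrightarrow> (\<integral>x. indicator J x * Y x \<partial>M)"
  proof (rule integral_dominated_convergence[where w="\<lambda>x. \<bar>Y x\<bar>"])
    show "AE x in M. (\<lambda>n. ?f n x) \<longlonglongrightarrow> indicator J x * Y x"
    proof (rule AE_I2)
      fix x assume x: "x \<in> space M"
      show "(\<lambda>n. ?f n x) \<longlonglongrightarrow> indicator J x * Y x"
      proof (cases "x \<in> J")
        case True
        then have "T x \<in> J" using JT[OF x] by simp
        then obtain N where N: "m N (T x) > real (nat \<lceil>\<bar>Y x\<bar>\<rceil>)" unfolding J_def by blast
        have "?f n x = Y x" if "n \<ge> N" for n
          using incseqD[OF inc that, of "T x"] N True by (simp add: max_def) linarith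
        then have "eventually (\<lambda>n. ?f n x = Y x) sequentially" by (auto simp: eventually_sequentially)
        then show ?thesis using True by (simp add: tendsto_eventually)
      qed simp
    qed
    show "AE x in M. norm (?f n x) \<le> \<bar>Y x\<bar>" for n
    proof (rule AE_I2)
      fix x
      show "norm (?f n x) \<le> \<bar>Y x\<bar>"
        using mnn[of n "T x"] by (auto simp: indicator_def max_def abs_if)
    qed
  qed (use Yi in auto)
  then have "0 \<le> (\<integral>x. indicator J x * Y x \<partial>M)"
    by (rule LIMSEQ_le_const) (use nonneg in auto)
  also have "\<dots> = prob J * expectation Y"
    unfolding Y_def
  proof (rule integral_indep_countable[OF V J])
    fix v
    \<comment> \<open>Since \<open>J\<close> is invariant, it may be replaced by the event that
      \<open>T x\<close> lies in \<open>J\<close>, which is what \<open>indep\<close>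
      controls.\<close>
    have "{x\<in>space M. V x = v} \<inter> J = {x\<in>space M. V x = v \<and> T x \<in> J}" using JT by auto
    then show "prob ({x\<in>space M. V x = v} \<inter> J) = prob {x\<in>space M. V x = v} * prob J"
      using indep[OF J] by simp
  qed
  finally have "prob J = 0"
    using neg by (simp add: Y_def[abs_def] zero_le_mult_iff) (smt (verit) measure_nonneg)
  then have "AE x in M. x \<notin> J" by (subst AE_iff_measurable[OF J]) (auto simp: emeasure_eq_measure J_def)
  then show ?thesis
  proof (rule AE_mp, intro AE_I2 impI)
    fix x assume "x \<in> space M" "x \<notin> J"
    then obtain K where "\<And>n. m n x \<le> real K" by (auto simp: J_def not_less)
    with Sm[of x] show "\<exists>K. \<forall>n. (\<Sum>i<n. g (V ((T ^^ i) x))) \<le> K"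
      unfolding Y_def by (meson order_trans)
  qed
qed

text \<open>Recentring suffices: \<open>g v - c\<close> respectively \<open>c - g v\<close> has
  negative mean, so its partial sums are bounded above.\<close>

lemma AE_sums_bounds:
  fixes g :: "'v \<Rightarrow> real"
  assumes int: "integrable M (\<lambda>x. g (V x))"
  shows "expectation (\<lambda>x. g (V x)) < c \<Longrightarrow>
      AE x in M. \<exists>K. \<forall>n. (\<Sum>i<n. g (V ((T ^^ i) x))) \<le> c * real n + K"
    and "c < expectation (\<lambda>x. g (V x)) \<Longrightarrow>
      AE x in M. \<exists>K. \<forall>n. (\<Sum>i<n. g (V ((T ^^ i) x))) \<ge> c * real n - K"
proof -
  assume c: "expectation (\<lambda>x. g (V x)) < c"
  have "AE x in M. \<exists>K. \<forall>n. (\<Sum>i<n. g (V ((T ^^ i) x)) - c) \<le> K"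
    by (rule AE_bounded_sums[where g="\<lambda>v. g v - c"]) (use int c in \<open>auto simp: prob_space\<close>)
  then show "AE x in M. \<exists>K. \<forall>n. (\<Sum>i<n. g (V ((T ^^ i) x))) \<le> c * real n + K"
    by (rule AE_mp) (intro AE_I2 impI, auto simp: sum_subtractf algebra_simps)
next
  assume c: "c < expectation (\<lambda>x. g (V x))"
  have "AE x in M. \<exists>K. \<forall>n. (\<Sum>i<n. c - g (V ((T ^^ i) x))) \<le> K"
    by (rule AE_bounded_sums[where g="\<lambda>v. c - g v"]) (use int c in \<open>auto simp: prob_space\<close>)
  then show "AE x in M. \<exists>K. \<forall>n. (\<Sum>i<n. g (V ((T ^^ i) x))) \<ge> c * real n - K"
    by (rule AE_mp) (intro AE_I2 impI, auto simp: sum_subtractf algebra_simps)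
qed

text \<open>Truncate \<open>g\<close> at \<open>N\<close>. By monotone convergence the truncated
  means exceed every \<open>c\<close>, since otherwise \<open>g\<close> would be integrable; the
  truncated sums lie below the full ones.\<close>

lemma AE_sums_lower_bound:
  fixes g :: "'v \<Rightarrow> real"
  assumes g: "\<And>v. 0 \<le> g v" and not_int: "\<not> integrable M (\<lambda>x. g (V x))"
  shows "AE x in M. \<exists>K. \<forall>n. (\<Sum>i<n. g (V ((T ^^ i) x))) \<ge> c * real n - K"
proof -
  have gV [measurable]: "(\<lambda>x. g (V x)) \<in> borel_measurable M"
    using measurable_V by (rule measurable_compose) simp
  let ?e = "\<lambda>N. expectation (\<lambda>x. min (g (V x)) (real N))"
  have mi: "integrable M (\<lambda>x. min (g (V x)) (real N))" for N
    by (rule integrable_const_bound[where B="real N"]) (use g in \<open>auto simp: abs_of_nonneg\<close>)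
  have "\<exists>N. c < ?e N"
  proof (rule ccontr)
    assume "\<not> (\<exists>N. c < ?e N)"
    then have le: "?e N \<le> c" for N by (simp add: not_less)
    have "(\<integral>\<^sup>+x. ennreal (g (V x)) \<partial>M) = (\<integral>\<^sup>+x. (SUP N. ennreal (min (g (V x)) (real N))) \<partial>M)"
    proof (rule nn_integral_cong)
      fix x
      obtain N where N: "g (V x) \<le> real N" using real_arch_simple by blast
      show "ennreal (g (V x)) = (SUP N. ennreal (min (g (V x)) (real N)))"
      proof (rule antisym)
        show "ennreal (g (V x)) \<le> (SUP N. ennreal (min (g (V x)) (real N)))"
          by (rule SUP_upper2[of N]) (use N in auto)
        show "(SUP N. ennreal (min (g (V x)) (real N))) \<le> ennreal (g (V x))"
          by (rule SUP_least) (auto intro!: ennreal_leI)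
      qed
    qed
    also have "\<dots> = (SUP N. \<integral>\<^sup>+x. ennreal (min (g (V x)) (real N)) \<partial>M)"
      by (rule nn_integral_monotone_convergence_SUP)
         (auto simp: incseq_def le_fun_def intro!: ennreal_leI)
    also have "\<dots> \<le> ennreal c"
    proof (rule SUP_least)
      fix N
      have "(\<integral>\<^sup>+x. ennreal (min (g (V x)) (real N)) \<partial>M) = ennreal (?e N)"
        by (rule nn_integral_eq_integral[OF mi]) (use g in auto)
      then show "(\<integral>\<^sup>+x. ennreal (min (g (V x)) (real N)) \<partial>M) \<le> ennreal c"
        using le[of N] by (simp add: ennreal_leI)
    qed
    finally have "(\<integral>\<^sup>+x. ennreal (g (V x)) \<partial>M) < \<infinity>"
      by (rule le_less_trans) simp
    then have "integrable M (\<lambda>x. g (V x))"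
      by (intro integrableI_nonneg) (use g in auto)
    with not_int show False by simp
  qed
  then obtain N where N: "c < ?e N" ..
  have "AE x in M. \<exists>K. \<forall>n. (\<Sum>i<n. min (g (V ((T ^^ i) x))) (real N)) \<ge> c * real n - K"
    by (rule AE_sums_bounds(2)[where g="\<lambda>v. min (g v) (real N)"]) (use mi N in auto)
  moreover have "(\<Sum>i<n. min (g (V ((T ^^ i) x))) (real N)) \<le> (\<Sum>i<n. g (V ((T ^^ i) x)))" for n x
    by (rule sum_mono) simp
  ultimately show ?thesis
    by (elim AE_mp, intro AE_I2 impI) (meson order_trans)
qed

lemma AE_sums_average:
  fixes g :: "'v \<Rightarrow> real"
  assumes int: "integrable M (\<lambda>x. g (V x))"
  shows "AE x in M. (\<lambda>n. (\<Sum>i<n. g (V ((T ^^ i) x))) / real n) \<longlonglongrightarrow> expectation (\<lambda>x. g (V x))"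
proof -
  let ?e = "expectation (\<lambda>x. g (V x))"
  have "AE x in M. \<forall>k::nat. (\<exists>K. \<forall>n. (\<Sum>i<n. g (V ((T ^^ i) x))) \<le> (?e + 1 / Suc k) * real n + K) \<and>
      (\<exists>K. \<forall>n. (\<Sum>i<n. g (V ((T ^^ i) x))) \<ge> (?e - 1 / Suc k) * real n - K)"
    unfolding AE_all_countable
    by (intro allI AE_conjI AE_sums_bounds[OF int]) auto
  then show ?thesis
  proof (rule AE_mp, intro AE_I2 impI LIMSEQ_I)
    fix x and r :: real
    assume *: "\<forall>k::nat. (\<exists>K. \<forall>n. (\<Sum>i<n. g (V ((T ^^ i) x))) \<le> (?e + 1 / Suc k) * real n + K) \<and>
      (\<exists>K. \<forall>n. (\<Sum>i<n. g (V ((T ^^ i) x))) \<ge> (?e - 1 / Suc k) * real n - K)"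
    assume "0 < r"
    then obtain k where "1 / Suc k < r / 2"
      using reals_Archimedean[of "r / 2"] by (auto simp: inverse_eq_divide)
    define d where "d = 1 / real (Suc k)"
    have k: "d < r / 2" unfolding d_def by fact
    let ?S = "\<lambda>n. \<Sum>i<n. g (V ((T ^^ i) x))"
    from * obtain K K' where K: "\<And>n. ?S n \<le> (?e + d) * real n + K"
      and K': "\<And>n. ?S n \<ge> (?e - d) * real n - K'"
      unfolding d_def by meson
    \<comment> \<open>For \<open>n > 2 * L / r\<close> the additive constants cost less than
      \<open>r / 2\<close> per summand; the other half of \<open>r\<close> absorbs
      \<open>d\<close>.\<close>
    define L where "L = 1 + \<bar>K\<bar> + \<bar>K'\<bar>"
    show "\<exists>N. \<forall>n\<ge>N. norm (?S n / real n - ?e) < r"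
    proof (intro exI allI impI)
      fix n assume n: "nat \<lceil>2 * L / r\<rceil> + 1 \<le> n"
      then have "2 * L / r < real n" by linarith
      then have L: "L < r / 2 * real n" using \<open>0 < r\<close> by (simp add: field_simps)
      have n0: "0 < real n" using n by simp
      have k': "d * real n \<le> r / 2 * real n" using k n0 by (intro mult_right_mono) auto
      have "?S n - ?e * real n \<le> d * real n + K" using K[of n] by (simp add: distrib_right)
      then have 1: "?S n - ?e * real n < r * real n" using k' L by (simp add: L_def)
      have "?S n - ?e * real n \<ge> - (d * real n) - K'" using K'[of n] by (simp add: left_diff_distrib)
      then have 2: "?S n - ?e * real n > - (r * real n)" using k' L by (simp add: L_def)
      have "?S n / real n - ?e = (?S n - ?e * real n) / real n" using n0 by (simp add: field_simps)
      then show "norm (?S n / real n - ?e) < r"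
        using 1 2 n0 by (simp add: abs_less_iff field_simps)
    qed
  qed
qed

end

section \<open>Walks driven by stacks\<close>

type_synonym 'd stacks = "'d site \<Rightarrow> nat \<Rightarrow> 'd site"

text \<open>An entry that is not a unit step is read as some fixed unit step.\<close>

definition unit_step :: "('d::finite) site \<Rightarrow> 'd site" where
  "unit_step e = (if e \<in> unit_steps then e else axis undefined 1)"

text \<open>The entry that is read is removed, so the future of the walk is again a walk, started
  from the current site with the remaining stacks.\<close>

definition advance :: "('d::finite) site \<times> 'd stacks \<Rightarrow> 'd site \<times> 'd stacks" where
  "advance = (\<lambda>(x, \<xi>). (x + unit_step (\<xi> x 0), \<xi>(x := \<lambda>k. \<xi> x (Suc k))))"

definition walk :: "('d::finite) site \<Rightarrow> 'd stacks \<Rightarrow> nat \<Rightarrow> 'd site" where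
  "walk x \<xi> n = fst ((advance ^^ n) (x, \<xi>))"

definition rest :: "('d::finite) site \<Rightarrow> 'd stacks \<Rightarrow> nat \<Rightarrow> 'd stacks" where
  "rest x \<xi> n = snd ((advance ^^ n) (x, \<xi>))"

text \<open>Freezes the stacks outside \<open>H\<close> at \<open>\<eta>\<close> and leaves those in
  \<open>H\<close> random. This expresses conditioning on the stacks outside \<open>H\<close> by
  Fubini, without conditional expectations.\<close>

definition mix :: "('d::finite) site set \<Rightarrow> 'd stacks \<Rightarrow> 'd stacks \<Rightarrow> 'd stacks" where
  "mix H \<eta> \<xi> = (\<lambda>y. if y \<in> H then \<xi> y else \<eta> y)"

definition shift_stacks :: "(('d::finite) site \<Rightarrow> nat) \<Rightarrow> 'd stacks \<Rightarrow> 'd stacks" where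
  "shift_stacks c \<xi> = (\<lambda>y k. \<xi> y (k + c y))"

lemma unit_step_in: "unit_step e \<in> unit_steps"
  by (auto simp: unit_step_def unit_steps_def)

lemma unit_step_id: "e \<in> unit_steps \<Longrightarrow> unit_step e = e"
  by (simp add: unit_step_def)

lemma walk_0 [simp]: "walk x \<xi> 0 = x" and rest_0 [simp]: "rest x \<xi> 0 = \<xi>"
  by (simp_all add: walk_def rest_def)

lemma walk_Suc: "walk x \<xi> (Suc n) = walk x \<xi> n + unit_step (rest x \<xi> n (walk x \<xi> n) 0)"
  and rest_Suc: "rest x \<xi> (Suc n) = (rest x \<xi> n)(walk x \<xi> n := \<lambda>k. rest x \<xi> n (walk x \<xi> n) (Suc k))"
  by (simp_all add: walk_def rest_def advance_def split_beta)

lemma walk_add: "walk x \<xi> (m + n) = walk (walk x \<xi> m) (rest x \<xi> m) n"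
proof -
  have "(advance ^^ (m + n)) s = (advance ^^ n) ((advance ^^ m) s)" for s :: "'a site \<times> 'a stacks"
    by (subst add.commute) (simp add: funpow_add)
  then show ?thesis by (simp add: walk_def rest_def)
qed

lemma rest_eq: "rest x \<xi> n y = (\<lambda>k. \<xi> y (k + card {i. i < n \<and> walk x \<xi> i = y}))"
proof (induction n)
  case (Suc n)
  show ?case
  proof (cases "walk x \<xi> n = y")
    case True
    then have "{i. i < Suc n \<and> walk x \<xi> i = y} = insert n {i. i < n \<and> walk x \<xi> i = y}"
      by (auto simp: less_Suc_eq)
    then show ?thesis using True Suc by (simp add: rest_Suc)
  next
    case False
    then have "{i. i < Suc n \<and> walk x \<xi> i = y} = {i. i < n \<and> walk x \<xi> i = y}"
      by (auto simp: less_Suc_eq)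
    then show ?thesis using False Suc by (simp add: rest_Suc)
  qed
qed simp

text \<open>The position at time \<open>n\<close> depends only on stacks of sites occupied strictly
  before \<open>n\<close>. Hence the site reached at time \<open>n\<close> itself may lie outside
  \<open>H\<close>.\<close>

lemma walk_agree:
  assumes "\<And>y. y \<in> H \<Longrightarrow> \<xi> y = \<xi>' y" "\<And>i. i < n \<Longrightarrow> walk x \<xi> i \<in> H"
  shows "walk x \<xi>' n = walk x \<xi> n" and "y \<in> H \<Longrightarrow> rest x \<xi>' n y = rest x \<xi> n y"
proof -
  have "walk x \<xi>' n = walk x \<xi> n \<and> (\<forall>y\<in>H. rest x \<xi>' n y = rest x \<xi> n y)"
    using assms(2)
  proof (induction n)
    case 0
    then show ?case using assms(1) by auto
  next
    case (Suc n)
    then have "walk x \<xi>' n = walk x \<xi> n" "\<forall>y\<in>H. rest x \<xi>' n y = rest x \<xi> n y" "walk x \<xi> n \<in> H"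
      by auto
    then show ?case by (auto simp: walk_Suc rest_Suc)
  qed
  then show "walk x \<xi>' n = walk x \<xi> n" "y \<in> H \<Longrightarrow> rest x \<xi>' n y = rest x \<xi> n y" by auto
qed

lemma walk_translate: "walk (a + x) \<xi> n = a + walk x (\<lambda>y. \<xi> (a + y)) n"
proof -
  have "walk (a + x) \<xi> n = a + walk x (\<lambda>y. \<xi> (a + y)) n \<and>
    (\<forall>y. rest (a + x) \<xi> n (a + y) = rest x (\<lambda>y. \<xi> (a + y)) n y)"
    by (induction n) (auto simp: walk_Suc rest_Suc add.assoc)
  then show ?thesis ..
qed

lemma mix_apply [simp]:
  "y \<in> H \<Longrightarrow> mix H \<eta> \<xi> y = \<xi> y" "y \<notin> H \<Longrightarrow> mix H \<eta> \<xi> y = \<eta> y"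
  by (simp_all add: mix_def)

lemma walk_mix_outside:
  assumes "\<And>i. i < n \<Longrightarrow> walk x \<eta> i \<notin> H"
  shows "walk x (mix H \<eta> \<xi>) n = walk x \<eta> n" "rest x (mix H \<eta> \<xi>) n = mix H (rest x \<eta> n) \<xi>"
proof -
  have "walk x (mix H \<eta> \<xi>) n = walk x \<eta> n \<and> rest x (mix H \<eta> \<xi>) n = mix H (rest x \<eta> n) \<xi>"
    using assms
  proof (induction n)
    case (Suc n)
    then have "walk x (mix H \<eta> \<xi>) n = walk x \<eta> n" "rest x (mix H \<eta> \<xi>) n = mix H (rest x \<eta> n) \<xi>"
      "walk x \<eta> n \<notin> H"
      by auto
    then show ?case by (auto simp: walk_Suc rest_Suc fun_eq_iff) (auto simp: mix_def)
  qed simp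
  then show "walk x (mix H \<eta> \<xi>) n = walk x \<eta> n" "rest x (mix H \<eta> \<xi>) n = mix H (rest x \<eta> n) \<xi>"
    by auto
qed

text \<open>Before it enters \<open>H\<close> the walk reads only \<open>\<eta>\<close>. So whether,
  when and where it enters does not depend on \<open>\<xi>\<close>, and at the entry
  \<open>\<xi>\<close> is still unread; \<open>\<eta>'\<close> is what is left of
  \<open>\<eta>\<close>.\<close>

lemma walk_mix_entry:
  obtains (never) "\<And>\<xi> i. walk z (mix H \<eta> \<xi>) i \<notin> H"
  | (entry) t \<eta>' where "walk z \<eta> t \<in> H" "\<And>i. i < t \<Longrightarrow> walk z \<eta> i \<notin> H"
      "\<And>\<xi> i. i \<le> t \<Longrightarrow> walk z (mix H \<eta> \<xi>) i = walk z \<eta> i"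
      "\<And>\<xi> i. walk z (mix H \<eta> \<xi>) (t + i) = walk (walk z \<eta> t) (mix H \<eta>' \<xi>) i"
proof (cases "\<exists>t. walk z \<eta> t \<in> H")
  case True
  define t where "t = (LEAST t. walk z \<eta> t \<in> H)"
  have t: "walk z \<eta> t \<in> H" unfolding t_def using True by (rule LeastI_ex)
  have lt: "walk z \<eta> i \<notin> H" if "i < t" for i using that unfolding t_def by (rule not_less_Least)
  have eq: "walk z (mix H \<eta> \<xi>) i = walk z \<eta> i" if "i \<le> t" for i \<xi>
    by (rule walk_mix_outside) (use lt that in auto)
  have "walk z (mix H \<eta> \<xi>) (t + i) = walk (walk z \<eta> t) (mix H (rest z \<eta> t) \<xi>) i" for i \<xi>
    by (simp add: walk_add eq walk_mix_outside(2)[OF lt])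
  then show ?thesis using entry t lt eq by blast
next
  case False
  then have "walk z (mix H \<eta> \<xi>) i \<notin> H" for \<xi> i
    using walk_mix_outside(1)[of i z \<eta> H \<xi>] by auto
  then show ?thesis by (rule never)
qed

text \<open>Inside \<open>H\<close> only \<open>\<xi>\<close> is consumed, by one entry per visit.
  Once the path is prescribed, the visit counts are constants, so the remaining stacks are a
  deterministic shift of \<open>\<xi>\<close>.\<close>

lemma rest_mix_inside:
  assumes "\<And>i. i < n \<Longrightarrow> walk x (mix H \<eta> \<xi>) i \<in> H"
  shows "rest x (mix H \<eta> \<xi>) n
    = mix H \<eta> (shift_stacks (\<lambda>y. card {i. i < n \<and> walk x (mix H \<eta> \<xi>) i = y}) \<xi>)"
proof
  fix y
  show "rest x (mix H \<eta> \<xi>) n y =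
    mix H \<eta> (shift_stacks (\<lambda>y. card {i. i < n \<and> walk x (mix H \<eta> \<xi>) i = y}) \<xi>) y"
  proof (cases "y \<in> H")
    case False
    then have "{i. i < n \<and> walk x (mix H \<eta> \<xi>) i = y} = {}" using assms by auto
    then show ?thesis using False by (simp only: rest_eq) simp
  qed (simp add: rest_eq shift_stacks_def)
qed

section \<open>Measurability of the walk and of path events\<close>

abbreviation stack_space :: "(nat \<Rightarrow> ('d::finite) site) measure" where
  "stack_space \<equiv> PiM UNIV (\<lambda>_. count_space UNIV)"

abbreviation stacks_space :: "('d::finite) stacks measure" where
  "stacks_space \<equiv> PiM UNIV (\<lambda>_. stack_space)"

lemma measurable_stack_entry: "(\<lambda>\<xi>. \<xi> y k) \<in> stacks_space \<rightarrow>\<^sub>M count_space UNIV"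
proof -
  have "(\<lambda>s. s k) \<in> stack_space \<rightarrow>\<^sub>M count_space UNIV" by measurable
  moreover have "(\<lambda>\<xi>. \<xi> y) \<in> stacks_space \<rightarrow>\<^sub>M stack_space" by measurable
  ultimately show ?thesis by (rule measurable_compose[rotated])
qed

lemma measurable_into_stacks:
  assumes "\<And>y k. (\<lambda>x. f x y k) \<in> M \<rightarrow>\<^sub>M count_space UNIV"
  shows "f \<in> M \<rightarrow>\<^sub>M stacks_space"
proof -
  have "(\<lambda>x. f x y) \<in> M \<rightarrow>\<^sub>M stack_space" for y
  proof -
    show ?thesis by (rule measurable_PiM_single') (use assms in auto)
  qed
  then show ?thesis by (intro measurable_PiM_single') (auto simp: space_PiM)
qed

lemma measurable_advance:
  "advance \<in> count_space UNIV \<Otimes>\<^sub>M stacks_space \<rightarrow>\<^sub>M count_space UNIV \<Otimes>\<^sub>M stacks_space"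
proof -
  have "(\<lambda>\<xi>. advance (x, \<xi>)) \<in> stacks_space \<rightarrow>\<^sub>M count_space UNIV \<Otimes>\<^sub>M stacks_space" for x :: "'a site"
  proof -
    have "(\<lambda>\<xi>. x + unit_step (\<xi> x 0)) \<in> stacks_space \<rightarrow>\<^sub>M count_space UNIV"
      by (rule measurable_compose[OF measurable_stack_entry]) simp
    moreover have "(\<lambda>\<xi>. \<xi>(x := \<lambda>k. \<xi> x (Suc k))) \<in> stacks_space \<rightarrow>\<^sub>M stacks_space"
    proof (rule measurable_into_stacks)
      fix y :: "'a site" and k
      show "(\<lambda>\<xi>. (\<xi>(x := \<lambda>k. \<xi> x (Suc k))) y k) \<in> stacks_space \<rightarrow>\<^sub>M count_space UNIV"
        by (cases "y = x") (simp_all add: measurable_stack_entry)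
    qed
    ultimately show ?thesis unfolding advance_def by (simp add: measurable_Pair)
  qed
  then have "(\<lambda>(x :: 'a site, \<xi>). advance (x, \<xi>)) \<in> count_space UNIV \<Otimes>\<^sub>M stacks_space \<rightarrow>\<^sub>M count_space UNIV \<Otimes>\<^sub>M stacks_space"
    by (intro measurable_pair_measure_countable1) auto
  then show ?thesis by simp
qed

lemma measurable_walk: "walk x \<in> stacks_space \<rightarrow>\<^sub>M path_space"
proof -
  have "(\<lambda>\<xi>. (advance ^^ n) (x, \<xi>)) \<in> stacks_space \<rightarrow>\<^sub>M count_space UNIV \<Otimes>\<^sub>M stacks_space" for n
  proof (induction n)
    case (Suc n)
    then show ?case by (simp add: measurable_compose[OF _ measurable_advance])
  qed simp
  then have "(\<lambda>\<xi>. walk x \<xi> n) \<in> stacks_space \<rightarrow>\<^sub>M count_space UNIV" for n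
    unfolding walk_def by (rule measurable_compose[OF _ measurable_fst])
  then show ?thesis by (intro measurable_PiM_single') auto
qed

lemma measurable_mix: "mix H \<eta> \<in> stacks_space \<rightarrow>\<^sub>M stacks_space"
proof (rule measurable_into_stacks)
  fix y k
  show "(\<lambda>\<xi>. mix H \<eta> \<xi> y k) \<in> stacks_space \<rightarrow>\<^sub>M count_space UNIV"
    by (cases "y \<in> H") (simp_all add: measurable_stack_entry)
qed

lemma measurable_mix_pair:
  "(\<lambda>(\<eta>, \<xi>). mix H \<eta> \<xi>) \<in> stacks_space \<Otimes>\<^sub>M stacks_space \<rightarrow>\<^sub>M stacks_space"
proof (rule measurable_into_stacks)
  fix y k
  show "(\<lambda>x. (case x of (\<eta>, \<xi>) \<Rightarrow> mix H \<eta> \<xi>) y k) \<in> stacks_space \<Otimes>\<^sub>M stacks_space \<rightarrow>\<^sub>M count_space UNIV"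
    by (cases "y \<in> H")
      (simp_all add: split_beta measurable_compose[OF measurable_fst measurable_stack_entry]
        measurable_compose[OF measurable_snd measurable_stack_entry])
qed

lemma measurable_shift_stacks: "shift_stacks c \<in> stacks_space \<rightarrow>\<^sub>M stacks_space"
  by (rule measurable_into_stacks) (simp add: shift_stacks_def measurable_stack_entry)

lemma measurable_translate: "(\<lambda>\<xi> y. \<xi> (a + y)) \<in> stacks_space \<rightarrow>\<^sub>M stacks_space"
  by (rule measurable_into_stacks) (simp add: measurable_stack_entry)

lemma space_stacks_space [simp]: "space stacks_space = UNIV"
  by (simp add: space_PiM)

lemma space_path_space [simp]: "space path_space = UNIV"
  by (simp add: space_PiM)

text \<open>There are only countably many prefixes of a given length, so every set of prefixes is
  measurable, and the event is the preimage of one.\<close>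

lemma sets_path_prefix:
  fixes P :: "(nat \<Rightarrow> ('d::finite) site) \<Rightarrow> bool"
  assumes "\<And>X Y. (\<And>i. i \<le> n \<Longrightarrow> X i = Y i) \<Longrightarrow> P X \<Longrightarrow> P Y"
  shows "{X. P X} \<in> sets path_space"
proof -
  let ?M = "PiM {..n} (\<lambda>_. count_space (UNIV :: 'd site set))"
  have sing: "{X} \<in> sets ?M" if "X \<in> {..n} \<rightarrow>\<^sub>E UNIV" for X
    using sets_singleton_PiM_count_space[of "{..n}" X] that by (auto simp: PiE_iff)
  let ?A = "(\<lambda>X. restrict X {..n}) ` {X. P X}"
  have sub: "?A \<subseteq> {..n} \<rightarrow>\<^sub>E UNIV"
    by (rule image_subsetI) (rule restrict_PiE_iff[THEN iffD2], simp)
  have "countable ?A"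
    by (rule countable_subset[OF sub]) (intro countable_PiE, auto)
  then have A: "?A \<in> sets ?M"
    using sing sub by (intro sets.countable[of ?A]) auto
  have "(\<lambda>X. restrict X {..n}) \<in> path_space \<rightarrow>\<^sub>M ?M"
    by (rule measurable_restrict_subset) simp
  from measurable_sets[OF this A] have "(\<lambda>X. restrict X {..n}) -` ?A \<in> sets path_space" by simp
  also have "(\<lambda>X. restrict X {..n}) -` ?A = {X. P X}"
  proof safe
    fix X Y assume "restrict X {..n} = restrict Y {..n}" "P Y"
    then have "X i = Y i" if "i \<le> n" for i using that by (metis atMost_iff restrict_apply')
    with \<open>P Y\<close> show "P X" using assms[of Y X] by auto
  qed auto
  finally show ?thesis .
qed

lemma sets_path_ex:
  fixes P :: "nat \<Rightarrow> (nat \<Rightarrow> ('d::finite) site) \<Rightarrow> bool"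
  assumes "\<And>n X Y. (\<And>i. i \<le> n \<Longrightarrow> X i = Y i) \<Longrightarrow> P n X \<Longrightarrow> P n Y"
  shows "{X. \<exists>n. P n X} \<in> sets path_space"
proof -
  have P: "{X. P n X} \<in> sets path_space" for n
    by (rule sets_path_prefix[of n]) (rule assms)
  have "{X. \<exists>n. P n X} = (\<Union>n. {X. P n X})" by auto
  also have "\<dots> \<in> sets path_space"
    using P by (intro sets.countable_UN) auto
  finally show ?thesis .
qed

lemma sets_path_all:
  fixes P :: "nat \<Rightarrow> (nat \<Rightarrow> ('d::finite) site) \<Rightarrow> bool"
  assumes "\<And>n X Y. (\<And>i. i \<le> n \<Longrightarrow> X i = Y i) \<Longrightarrow> P n X \<Longrightarrow> P n Y"
  shows "{X. \<forall>n. P n X} \<in> sets path_space"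
proof -
  have P: "{X. P n X} \<in> sets path_space" for n
    by (rule sets_path_prefix[of n]) (rule assms)
  have "{X. \<forall>n. P n X} = (\<Inter>n. {X. P n X})" by auto
  also have "\<dots> \<in> sets path_space"
    using P sets.top[of path_space] by (intro sets.countable_INT'') (auto simp: space_PiM)
  finally show ?thesis .
qed

lemma sets_path_Collect:
  fixes P Q :: "(nat \<Rightarrow> ('d::finite) site) \<Rightarrow> bool"
  assumes "{X. P X} \<in> sets path_space" "{X. Q X} \<in> sets path_space"
  shows "{X. P X \<and> Q X} \<in> sets path_space" "{X. P X \<or> Q X} \<in> sets path_space"
    "{X. \<not> P X} \<in> sets path_space"
proof -
  show "{X. P X \<and> Q X} \<in> sets path_space" using sets.Int[OF assms] by (simp add: Collect_conj_eq)
  show "{X. P X \<or> Q X} \<in> sets path_space" using sets.Un[OF assms] by (simp add: Collect_disj_eq)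
  show "{X. \<not> P X} \<in> sets path_space" using sets.compl_sets[OF assms(1)] by (simp add: Collect_neg_eq Compl_eq_Diff_UNIV)
qed

section \<open>Stacks that are independent over the sites\<close>

locale stationary_stacks =
  fixes m :: "(nat \<Rightarrow> ('d::finite) site) measure"
  assumes prob_space_m: "prob_space m"
    and sets_m: "sets m = sets stack_space"
    and shift_m: "\<And>c. distr m m (\<lambda>s k. s (k + c)) = m"
begin

definition law :: "'d stacks measure" where
  "law = PiM UNIV (\<lambda>_. m)"

definition path_law :: "(nat \<Rightarrow> 'd site) measure" where
  "path_law = distr law path_space (walk 0)"

lemma sets_law: "sets law = sets stacks_space"
  unfolding law_def by (intro sets_PiM_cong refl sets_m)

lemma space_law [simp]: "space law = UNIV"
  using sets_eq_imp_space_eq[OF sets_law] by simp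

lemma space_m [simp]: "space m = UNIV"
  using sets_eq_imp_space_eq[OF sets_m] by (simp add: space_PiM)

sublocale comp: product_prob_space "\<lambda>_. m" "UNIV :: 'd site set"
  by (intro product_prob_spaceI prob_space_m)

sublocale law: prob_space law
  unfolding law_def by (intro prob_space_PiM prob_space_m)

lemma measurable_law [simp]:
  "measurable law M = measurable stacks_space M" "measurable M law = measurable M stacks_space"
  by (rule measurable_cong_sets[OF sets_law refl] measurable_cong_sets[OF refl sets_law])+

sublocale path: prob_space path_law
  unfolding path_law_def by (intro law.prob_space_distr) (simp add: measurable_walk)

lemma sets_path_law [simp]: "sets path_law = sets path_space"
  by (simp add: path_law_def)

lemma space_path_law [simp]: "space path_law = UNIV"
  by (simp add: path_law_def space_PiM)

lemma prob_path_law: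
  "A \<in> sets path_space \<Longrightarrow> path.prob A = law.prob {\<xi>. walk 0 \<xi> \<in> A}"
  unfolding path_law_def
  by (subst measure_distr) (auto simp: measurable_walk vimage_def)

lemma distr_componentwise:
  assumes "\<And>y. \<phi> y \<in> stack_space \<rightarrow>\<^sub>M stack_space" "\<And>y. distr m m (\<phi> y) = m"
  shows "distr law law (\<lambda>\<xi> y. \<phi> y (\<xi> y)) = law"
proof -
  have \<phi>: "\<phi> y \<in> m \<rightarrow>\<^sub>M m" for y
    using assms(1) by (simp add: measurable_cong_sets[OF sets_m sets_m])
  have f: "(\<lambda>\<xi> y. \<phi> y (\<xi> y)) \<in> law \<rightarrow>\<^sub>M law"
    unfolding law_def
  proof (rule measurable_PiM_single')
    show "(\<lambda>\<xi>. \<phi> y (\<xi> y)) \<in> PiM UNIV (\<lambda>_. m) \<rightarrow>\<^sub>M m" for y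
      using measurable_compose[OF measurable_component_singleton[of y UNIV "\<lambda>_. m"] \<phi>[of y]] by simp
  qed (auto simp: space_PiM)
  show ?thesis
    unfolding law_def
  proof (rule comp.PiM_eq)
    fix J :: "'d site set" and F assume J: "finite J" and F: "\<And>j. j \<in> J \<Longrightarrow> F j \<in> sets m"
    have 1: "(\<lambda>\<xi> y. \<phi> y (\<xi> y)) -` prod_emb UNIV (\<lambda>_. m) J (Pi\<^sub>E J F) \<inter> space law
        = prod_emb UNIV (\<lambda>_. m) J (Pi\<^sub>E J (\<lambda>j. \<phi> j -` F j))"
      by (auto simp: prod_emb_def PiE_iff)
    have v: "\<phi> j -` F j \<in> sets m" if "j \<in> J" for j
      using measurable_sets[OF \<phi> F[OF that], of j] by simp
    have "emeasure (distr law law (\<lambda>\<xi> y. \<phi> y (\<xi> y))) (prod_emb UNIV (\<lambda>_. m) J (Pi\<^sub>E J F))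
        = emeasure law (prod_emb UNIV (\<lambda>_. m) J (Pi\<^sub>E J (\<lambda>j. \<phi> j -` F j)))"
      using J F by (subst emeasure_distr[OF f]) (auto simp: 1[unfolded law_def] law_def intro!: sets_PiM_I)
    also have "\<dots> = (\<Prod>j\<in>J. emeasure m (\<phi> j -` F j))"
      unfolding law_def using J v by (intro comp.emeasure_PiM_emb) auto
    also have "\<dots> = (\<Prod>j\<in>J. emeasure m (F j))"
    proof (rule prod.cong[OF refl])
      fix j assume "j \<in> J"
      then show "emeasure m (\<phi> j -` F j) = emeasure m (F j)"
        using emeasure_distr[OF \<phi> F, of j j] assms(2)[of j] by simp
    qed
    finally show "emeasure (distr (Pi\<^sub>M UNIV (\<lambda>_. m)) (Pi\<^sub>M UNIV (\<lambda>_. m)) (\<lambda>\<xi> y. \<phi> y (\<xi> y)))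
        (prod_emb UNIV (\<lambda>_. m) J (Pi\<^sub>E J F)) = (\<Prod>j\<in>J. emeasure m (F j))"
      by (simp add: law_def)
  qed simp
qed

text \<open>The shift \<open>c\<close> may differ from site to site but is fixed before the stacks
  are drawn; each component is then preserved by \<open>shift_m\<close>.\<close>

lemma distr_shift_stacks: "distr law law (shift_stacks c) = law"
proof -
  have "(\<lambda>s k. s (k + c)) \<in> stack_space \<rightarrow>\<^sub>M stack_space" for c :: nat
    by (rule measurable_PiM_single') (auto simp: space_PiM)
  then have "distr law law (\<lambda>\<xi> y. (\<lambda>s k. s (k + c y)) (\<xi> y)) = law"
    by (intro distr_componentwise shift_m) auto
  then show ?thesis by (simp add: shift_stacks_def[abs_def])
qed

lemma distr_translate: "distr law law (\<lambda>\<xi> y. \<xi> (a + y)) = law"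
  using distr_PiM_reindex[of UNIV "\<lambda>_. m" "\<lambda>y. a + y" UNIV] prob_space_m
  by (simp add: law_def restrict_UNIV)

lemma prob_distr:
  "f \<in> stacks_space \<rightarrow>\<^sub>M stacks_space \<Longrightarrow> distr law law f = law \<Longrightarrow> A \<in> sets stacks_space \<Longrightarrow>
    law.prob {\<xi>. f \<xi> \<in> A} = law.prob A"
  using measure_distr[of f law law A] by (simp add: sets_law vimage_def)

lemma measurable_mix_law: "(\<lambda>(\<eta>, \<xi>). mix H \<eta> \<xi>) \<in> law \<Otimes>\<^sub>M law \<rightarrow>\<^sub>M law"
  by (subst measurable_cong_sets[OF sets_pair_measure_cong[OF sets_law sets_law] sets_law])
    (rule measurable_mix_pair)

lemma distr_mix: "distr (law \<Otimes>\<^sub>M law) law (\<lambda>(\<eta>, \<xi>). mix H \<eta> \<xi>) = law"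
proof -
  note f = measurable_mix_law[of H]
  show ?thesis
    unfolding law_def
  proof (rule comp.PiM_eq)
    fix J :: "'d site set" and F assume J: "finite J" and F: "\<And>j. j \<in> J \<Longrightarrow> F j \<in> sets m"
    let ?e = "\<lambda>J. prod_emb UNIV (\<lambda>_. m) J (Pi\<^sub>E J F)"
    have 1: "(\<lambda>(\<eta>, \<xi>). mix H \<eta> \<xi>) -` ?e J \<inter> space (law \<Otimes>\<^sub>M law) = ?e (J - H) \<times> ?e (J \<inter> H)"
      by (auto simp: prod_emb_def PiE_iff mix_def space_pair_measure split: if_splits)
    have e: "?e J' \<in> sets law" if "J' \<subseteq> J" for J'
      unfolding law_def using J F that finite_subset[OF that J] by (intro sets_PiM_I) auto
    have em: "emeasure law (?e J') = (\<Prod>j\<in>J'. emeasure m (F j))" if "J' \<subseteq> J" for J'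
      unfolding law_def using F that finite_subset[OF that J] by (intro comp.emeasure_PiM_emb) auto
    have "emeasure (distr (law \<Otimes>\<^sub>M law) law (\<lambda>(\<eta>, \<xi>). mix H \<eta> \<xi>)) (?e J)
        = emeasure (law \<Otimes>\<^sub>M law) (?e (J - H) \<times> ?e (J \<inter> H))"
      using e[of J] by (subst emeasure_distr[OF f]) (auto simp: 1)
    also have "\<dots> = emeasure law (?e (J - H)) * emeasure law (?e (J \<inter> H))"
      by (rule law.emeasure_pair_measure_Times) (auto intro: e)
    also have "\<dots> = (\<Prod>j\<in>J. emeasure m (F j))"
      using J by (simp add: em prod.Int_Diff[of J _ H] mult.commute)
    finally show "emeasure (distr (Pi\<^sub>M UNIV (\<lambda>_. m) \<Otimes>\<^sub>M Pi\<^sub>M UNIV (\<lambda>_. m)) (Pi\<^sub>M UNIV (\<lambda>_. m)) (\<lambda>(\<eta>, \<xi>). mix H \<eta> \<xi>)) (?e J)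
        = (\<Prod>j\<in>J. emeasure m (F j))"
      by (simp add: law_def)
  qed simp
qed

text \<open>Fubini for two independent copies of the stacks: by \<open>distr_mix\<close>, taking the
  sites in \<open>H\<close> from one copy and the others from the second again has law
  \<open>law\<close>.\<close>

lemma emeasure_mix:
  assumes A: "A \<in> sets stacks_space"
  shows "emeasure law A = (\<integral>\<^sup>+\<eta>. emeasure law {\<xi>. mix H \<eta> \<xi> \<in> A} \<partial>law)"
proof -
  note f = measurable_mix_law[of H]
  have A': "A \<in> sets law" using A by (simp add: sets_law)
  have "emeasure law A = emeasure (law \<Otimes>\<^sub>M law) ((\<lambda>(\<eta>, \<xi>). mix H \<eta> \<xi>) -` A \<inter> space (law \<Otimes>\<^sub>M law))"
    by (subst distr_mix[symmetric, of H]) (rule emeasure_distr[OF f A'])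
  also have "\<dots> = (\<integral>\<^sup>+\<eta>. emeasure law (Pair \<eta> -` ((\<lambda>(\<eta>, \<xi>). mix H \<eta> \<xi>) -` A \<inter> space (law \<Otimes>\<^sub>M law))) \<partial>law)"
    by (rule law.emeasure_pair_measure_alt[OF measurable_sets[OF f A']])
  finally show ?thesis by (simp add: space_pair_measure vimage_def)
qed

text \<open>A conditional bound: given the stacks outside \<open>H\<close>, the event
  \<open>A\<close> has probability at most \<open>\<epsilon>\<close>, and it is possible only when
  \<open>C\<close> holds. This is one step of the induction over levels in
  \<open>prob_swift_Int\<close>.\<close>

lemma prob_le_mix:
  assumes A: "A \<in> sets stacks_space" and C: "C \<in> sets stacks_space"
    and sub: "\<And>\<eta> \<xi>. mix H \<eta> \<xi> \<in> A \<Longrightarrow> \<eta> \<in> C"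
    and le: "\<And>\<eta>. law.prob {\<xi>. mix H \<eta> \<xi> \<in> A} \<le> \<epsilon>" and "0 \<le> \<epsilon>"
  shows "law.prob A \<le> \<epsilon> * law.prob C"
proof -
  have "emeasure law A = (\<integral>\<^sup>+\<eta>. emeasure law {\<xi>. mix H \<eta> \<xi> \<in> A} \<partial>law)"
    by (rule emeasure_mix[OF A])
  also have "\<dots> \<le> (\<integral>\<^sup>+\<eta>. ennreal \<epsilon> * indicator C \<eta> \<partial>law)"
  proof (rule nn_integral_mono)
    fix \<eta>
    show "emeasure law {\<xi>. mix H \<eta> \<xi> \<in> A} \<le> ennreal \<epsilon> * indicator C \<eta>"
    proof (cases "\<eta> \<in> C")
      case True
      then show ?thesis using le[of \<eta>] by (simp add: law.emeasure_eq_measure ennreal_leI)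
    next
      case False
      then have "{\<xi>. mix H \<eta> \<xi> \<in> A} = {}" using sub by auto
      then show ?thesis by simp
    qed
  qed
  also have "\<dots> = ennreal (\<epsilon> * law.prob C)"
    using C \<open>0 \<le> \<epsilon>\<close> by (simp add: nn_integral_cmult_indicator sets_law law.emeasure_eq_measure ennreal_mult)
  finally show ?thesis
    using \<open>0 \<le> \<epsilon>\<close> by (simp add: law.emeasure_eq_measure)
qed

text \<open>In \<open>mix H \<eta> \<xi>\<close> the event \<open>A\<close> depends on
  \<open>\<eta>\<close> alone and \<open>B\<close> on \<open>\<xi>\<close> alone, so the integral in
  \<open>emeasure_mix\<close> factors.\<close>

lemma emeasure_indep_sites:
  assumes A: "A \<in> sets stacks_space" and B: "B \<in> sets stacks_space"
    and detA: "\<And>\<xi> \<xi>'. (\<And>y. y \<notin> H \<Longrightarrow> \<xi> y = \<xi>' y) \<Longrightarrow> \<xi> \<in> A \<Longrightarrow> \<xi>' \<in> A"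
    and detB: "\<And>\<xi> \<xi>'. (\<And>y. y \<in> H \<Longrightarrow> \<xi> y = \<xi>' y) \<Longrightarrow> \<xi> \<in> B \<Longrightarrow> \<xi>' \<in> B"
  shows "emeasure law (A \<inter> B) = emeasure law A * emeasure law B"
proof -
  have a: "mix H \<eta> \<xi> \<in> A \<longleftrightarrow> \<eta> \<in> A" for \<eta> \<xi>
    using detA[of \<eta> "mix H \<eta> \<xi>"] detA[of "mix H \<eta> \<xi>" \<eta>] by auto
  have b: "mix H \<eta> \<xi> \<in> B \<longleftrightarrow> \<xi> \<in> B" for \<eta> \<xi>
    using detB[of \<xi> "mix H \<eta> \<xi>"] detB[of "mix H \<eta> \<xi>" \<xi>] by auto
  have "emeasure law (A \<inter> B) = (\<integral>\<^sup>+\<eta>. emeasure law {\<xi>. mix H \<eta> \<xi> \<in> A \<inter> B} \<partial>law)"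
    by (rule emeasure_mix) (use A B in auto)
  also have "\<dots> = (\<integral>\<^sup>+\<eta>. emeasure law B * indicator A \<eta> \<partial>law)"
    by (rule nn_integral_cong) (auto simp: a b indicator_def)
  also have "\<dots> = emeasure law A * emeasure law B"
    using A by (subst nn_integral_cmult_indicator) (auto simp: sets_law mult.commute)
  finally show ?thesis .
qed

end

section \<open>Independence of the past and of the path after a record height\<close>

definition shift_path :: "nat \<Rightarrow> (nat \<Rightarrow> ('d::finite) site) \<Rightarrow> nat \<Rightarrow> 'd site" where
  "shift_path n X = (\<lambda>i. X (n + i) - X n)"

lemma measurable_shift_path: "shift_path n \<in> path_space \<rightarrow>\<^sub>M path_space"
proof -
  have "(\<lambda>X. shift_path n X i) \<in> path_space \<rightarrow>\<^sub>M count_space UNIV" for i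
    unfolding shift_path_def by measurable
  then show ?thesis by (intro measurable_PiM_single') auto
qed

lemma shift_path_walk:
  "shift_path n (walk 0 \<xi>) = walk 0 (\<lambda>y. rest 0 \<xi> n (walk 0 \<xi> n + y))"
proof
  fix i
  show "shift_path n (walk 0 \<xi>) i = walk 0 (\<lambda>y. rest 0 \<xi> n (walk 0 \<xi> n + y)) i"
    using walk_translate[of "walk 0 \<xi> n" 0 "rest 0 \<xi> n" i]
    by (simp add: shift_path_def walk_add)
qed

text \<open>The bound in \<open>h_unit\<close> ensures that the walk cannot jump over a slab of
  height 1, and that it passes an integer level with overshoot below 1.\<close>

locale stack_walk = stationary_stacks m for m :: "(nat \<Rightarrow> ('d::finite) site) measure" +
  fixes h :: "'d site \<Rightarrow> real"
  assumes h_add: "h (x + y) = h x + h y"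
    and h_unit: "e \<in> unit_steps \<Longrightarrow> \<bar>h e\<bar> \<le> 1"
begin

lemma h_0 [simp]: "h 0 = 0" using h_add[of 0 0] by simp

lemma h_diff: "h (x - y) = h x - h y" using h_add[of "x - y" y] by simp

lemma h_step: "\<bar>h (walk x \<xi> (Suc n)) - h (walk x \<xi> n)\<bar> \<le> 1"
  by (simp add: walk_Suc h_add h_unit unit_step_in)

lemma h_walk_le: "h (walk x \<xi> n) \<le> h x + real n"
proof (induction n)
  case (Suc n)
  then show ?case using h_step[of x \<xi> n] by simp
qed simp

definition stay :: "(nat \<Rightarrow> 'd site) set" where
  "stay = {X. \<forall>n. 0 \<le> h (X n)}"

lemma sets_stay: "stay \<in> sets path_space"
proof -
  have "stay = (\<Inter>n. {X. 0 \<le> h (X n)})" by (auto simp: stay_def)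
  also have "\<dots> \<in> sets path_space"
  proof (rule sets.countable_INT')
    show "range (\<lambda>n. {X. 0 \<le> h (X n)}) \<subseteq> sets path_space"
    proof safe
      fix n show "{X. 0 \<le> h (X n)} \<in> sets path_space" by (rule sets_path_prefix[of n]) auto
    qed
  qed auto
  finally show ?thesis .
qed

lemma walk_stay_cong:
  assumes "B \<subseteq> stay" "\<And>y. 0 \<le> h y \<Longrightarrow> \<xi> y = \<xi>' y" "walk 0 \<xi> \<in> B"
  shows "walk 0 \<xi>' \<in> B"
proof -
  have "walk 0 \<xi>' n = walk 0 \<xi> n" for n
    by (rule walk_agree(1)[where H="{y. 0 \<le> h y}"]) (use assms in \<open>auto simp: stay_def\<close>)
  then have "walk 0 \<xi>' = walk 0 \<xi>" by auto
  then show ?thesis using assms(3) by simp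
qed

text \<open>On \<open>F\<close> time \<open>n\<close> is a strict record of \<open>h\<close>, so no
  stack at height \<open>h (X n)\<close> or above has been read. A continuation in \<open>B\<close>,
  being part of \<open>stay\<close>, reads only those. For a fixed position \<open>x\<close> at time
  \<open>n\<close> the past and the future are therefore determined by the stacks on the two sides
  of height \<open>h x\<close>; the probability of the future does not depend on \<open>x\<close>,
  and summing over \<open>x\<close> gives the product.\<close>

lemma emeasure_fresh:
  assumes F: "F \<in> sets path_space" and B: "B \<in> sets path_space" and "B \<subseteq> stay"
    and det: "\<And>X Y. (\<And>i. i \<le> n \<Longrightarrow> X i = Y i) \<Longrightarrow> X \<in> F \<Longrightarrow> Y \<in> F"
    and rec: "\<And>X i. X \<in> F \<Longrightarrow> i < n \<Longrightarrow> h (X i) < h (X n)"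
  shows "emeasure path_law (F \<inter> shift_path n -` B) = emeasure path_law F * emeasure path_law B"
proof -
  have [measurable]: "walk x \<in> stacks_space \<rightarrow>\<^sub>M path_space" for x :: "'d site" by (rule measurable_walk)
  have wn [measurable]: "(\<lambda>\<xi>. walk 0 \<xi> n) \<in> stacks_space \<rightarrow>\<^sub>M count_space (UNIV :: 'd site set)"
    by (rule measurable_compose[OF measurable_walk]) simp
  have vim: "f -` S \<in> sets stacks_space" if "f \<in> stacks_space \<rightarrow>\<^sub>M N" "S \<in> sets N" for f :: "'d stacks \<Rightarrow> 'b" and S N
    using measurable_sets[OF that] by simp
  have em: "emeasure path_law S = emeasure law {\<xi>. walk 0 \<xi> \<in> S}" if "S \<in> sets path_space" for S
    unfolding path_law_def using that by (subst emeasure_distr) (auto simp: measurable_walk vimage_def)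
  define A where "A x = {\<xi>. walk 0 \<xi> \<in> F \<and> walk 0 \<xi> n = x}" for x
  define A' where "A' x = {\<xi>. walk 0 (\<lambda>y. \<xi> (x + y)) \<in> B}" for x
  have A: "A x \<in> sets stacks_space" for x
  proof -
    have "A x = walk 0 -` F \<inter> (\<lambda>\<xi>. walk 0 \<xi> n) -` {x}" by (auto simp: A_def)
    also have "\<dots> \<in> sets stacks_space" using F by (intro sets.Int vim[OF measurable_walk] vim[OF wn]) auto
    finally show ?thesis .
  qed
  have A': "A' x \<in> sets stacks_space" for x
    unfolding A'_def
    using vim[OF measurable_compose[OF measurable_translate[of x] measurable_walk] B, of 0]
    by (simp add: vimage_def)
  have eA': "emeasure law (A' x) = emeasure path_law B" for x
  proof -
    let ?S = "{\<xi>. walk 0 \<xi> \<in> B}"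
    have S: "?S \<in> sets law" using vim[OF measurable_walk B] by (simp add: sets_law vimage_def)
    have "emeasure law ?S = emeasure (distr law law (\<lambda>\<xi> y. \<xi> (x + y))) ?S" by (simp add: distr_translate)
    also have "\<dots> = emeasure law (A' x)"
      using S by (subst emeasure_distr) (auto simp: measurable_translate A'_def vimage_def)
    finally show ?thesis by (simp add: em B)
  qed
  have ind: "emeasure law (A x \<inter> A' x) = emeasure law (A x) * emeasure law (A' x)" for x
  proof (rule emeasure_indep_sites[OF A A', where H="{y. h x \<le> h y}"])
    fix \<xi> \<xi>' :: "'d stacks"
    { assume agree: "\<And>y. y \<notin> {y. h x \<le> h y} \<Longrightarrow> \<xi> y = \<xi>' y" and a: "\<xi> \<in> A x"
      have eq: "walk 0 \<xi>' i = walk 0 \<xi> i" if "i \<le> n" for i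
        by (rule walk_agree(1)[where H="{y. h y < h x}"])
          (use agree a rec that in \<open>auto simp: A_def not_le\<close>)
      then show "\<xi>' \<in> A x" using a det[of "walk 0 \<xi>" "walk 0 \<xi>'"] by (auto simp: A_def) }
    { assume agree: "\<And>y. y \<in> {y. h x \<le> h y} \<Longrightarrow> \<xi> y = \<xi>' y" and a: "\<xi> \<in> A' x"
      show "\<xi>' \<in> A' x" unfolding A'_def
        using walk_stay_cong[OF \<open>B \<subseteq> stay\<close>, of "\<lambda>y. \<xi> (x + y)" "\<lambda>y. \<xi>' (x + y)"] agree a
        by (auto simp: A'_def h_add) }
  qed
  have eq: "{\<xi>. walk 0 \<xi> \<in> F \<inter> shift_path n -` B} = (\<Union>x. A x \<inter> A' x)"
  proof -
    have "shift_path n (walk 0 \<xi>) \<in> B \<longleftrightarrow> \<xi> \<in> A' (walk 0 \<xi> n)" if "walk 0 \<xi> \<in> F" for \<xi>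
    proof -
      let ?x = "walk 0 \<xi> n"
      \<comment> \<open>Stacks at or above the record height are untouched at time \<open>n\<close>,
        because all sites visited earlier lie strictly below.\<close>
      have "rest 0 \<xi> n (?x + y) = \<xi> (?x + y)" if "0 \<le> h y" for y
      proof -
        have "h (walk 0 \<xi> i) < h (?x + y)" if "i < n" for i
          using rec[OF \<open>walk 0 \<xi> \<in> F\<close> that] \<open>0 \<le> h y\<close> by (simp add: h_add)
        then have none: "{i. i < n \<and> walk 0 \<xi> i = ?x + y} = {}" by force
        show ?thesis unfolding rest_eq none by simp
      qed
      then show ?thesis
        unfolding shift_path_walk A'_def mem_Collect_eq
        using walk_stay_cong[OF \<open>B \<subseteq> stay\<close>, of "\<lambda>y. rest 0 \<xi> n (?x + y)" "\<lambda>y. \<xi> (?x + y)"]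
          walk_stay_cong[OF \<open>B \<subseteq> stay\<close>, of "\<lambda>y. \<xi> (?x + y)" "\<lambda>y. rest 0 \<xi> n (?x + y)"]
        by metis
    qed
    then show ?thesis by (auto simp: A_def)
  qed
  have FB: "F \<inter> shift_path n -` B \<in> sets path_space"
    using measurable_sets[OF measurable_shift_path B, of n] F by (auto simp: space_PiM)
  have "emeasure path_law (F \<inter> shift_path n -` B) = emeasure law (\<Union>x. A x \<inter> A' x)"
    by (simp only: em[OF FB] eq)
  also have "\<dots> = (\<integral>\<^sup>+x. emeasure law (A x \<inter> A' x) \<partial>count_space UNIV)"
    by (rule emeasure_UN_countable) (use A A' in \<open>auto simp: disjoint_family_on_def A_def sets_law\<close>)
  also have "\<dots> = (\<integral>\<^sup>+x. emeasure law (A x) \<partial>count_space UNIV) * emeasure path_law B"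
    by (simp add: ind eA' nn_integral_multc)
  also have "(\<integral>\<^sup>+x. emeasure law (A x) \<partial>count_space UNIV) = emeasure law (\<Union>x. A x)"
    by (rule emeasure_UN_countable[symmetric]) (use A in \<open>auto simp: disjoint_family_on_def A_def sets_law\<close>)
  also have "(\<Union>x. A x) = {\<xi>. walk 0 \<xi> \<in> F}" by (auto simp: A_def)
  finally show ?thesis by (simp add: em F)
qed

end

section \<open>Slab visits when the walk cannot escape\<close>

context stack_walk
begin

text \<open>Slowness is counted in visits: a level \<open>u\<close> for which this fails costs the
  walk at least \<open>R\<close> time steps in the slab above \<open>u\<close> before it reaches
  height \<open>u + M\<close>.\<close>

definition swift :: "real \<Rightarrow> nat \<Rightarrow> nat \<Rightarrow> (nat \<Rightarrow> 'd site) set" where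
  "swift u M R =
    {X. \<exists>n. u + real M \<le> h (X n) \<and> card {i. i < n \<and> u \<le> h (X i) \<and> h (X i) < u + 1} < R}"

text \<open>The exceptional event for excursions above the start: a path outside it that ever gains
  \<open>M\<close> drops below its starting height within \<open>S\<close> steps.\<close>

definition slow_exit :: "nat \<Rightarrow> nat \<Rightarrow> (nat \<Rightarrow> 'd site) set" where
  "slow_exit S M =
    {X. (\<forall>i\<le>S. h (X 0) \<le> h (X i)) \<and> ((\<exists>i. h (X i) < h (X 0)) \<or> (\<exists>i. h (X 0) + real M \<le> h (X i)))}"

definition unbounded :: "(nat \<Rightarrow> 'd site) set" where
  "unbounded = {X. \<forall>k. \<exists>n. real k \<le> h (X n)}"

definition escape :: "(nat \<Rightarrow> 'd site) set" where
  "escape = stay \<inter> unbounded"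

definition swift_bound :: "nat \<Rightarrow> nat \<Rightarrow> real \<Rightarrow> bool" where
  "swift_bound M R \<epsilon> \<longleftrightarrow> (\<forall>\<eta> u x. u \<le> h x \<longrightarrow> h x < u + 1 \<longrightarrow>
    law.prob {\<xi>. walk x (mix {y. u \<le> h y} \<eta> \<xi>) \<in> swift u M R} \<le> \<epsilon>)"

lemma sets_unbounded: "unbounded \<in> sets path_space"
proof -
  have P: "{X. \<exists>n. real k \<le> h (X n)} \<in> sets path_space" for k
    by (rule sets_path_ex) auto
  have "unbounded = (\<Inter>k. {X. \<exists>n. real k \<le> h (X n)})" by (auto simp: unbounded_def)
  also have "\<dots> \<in> sets path_space"
    using P sets.top[of path_space] by (intro sets.countable_INT'') (auto simp: space_PiM)
  finally show ?thesis .
qed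

lemma sets_escape: "escape \<in> sets path_space"
  unfolding escape_def by (intro sets.Int sets_stay sets_unbounded)

lemma sets_swift: "swift u M R \<in> sets path_space"
  unfolding swift_def
proof (rule sets_path_ex)
  fix n and X Y :: "nat \<Rightarrow> 'd site"
  assume eq: "\<And>i. i \<le> n \<Longrightarrow> X i = Y i"
    and X: "u + real M \<le> h (X n) \<and> card {i. i < n \<and> u \<le> h (X i) \<and> h (X i) < u + 1} < R"
  have "{i. i < n \<and> u \<le> h (X i) \<and> h (X i) < u + 1} = {i. i < n \<and> u \<le> h (Y i) \<and> h (Y i) < u + 1}"
    using eq by auto
  then show "u + real M \<le> h (Y n) \<and> card {i. i < n \<and> u \<le> h (Y i) \<and> h (Y i) < u + 1} < R"
    using X eq[of n] by simp
qed

lemma sets_slow_exit: "slow_exit S M \<in> sets path_space"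
proof -
  have "{X. \<forall>i\<le>S. h (X 0) \<le> h (X i)} \<in> sets path_space"
    by (rule sets_path_prefix[of S]) auto
  moreover have "{X. \<exists>i. h (X i) < h (X 0)} \<in> sets path_space"
  proof (rule sets_path_ex)
    fix n and X Y :: "nat \<Rightarrow> 'd site"
    assume "\<And>i. i \<le> n \<Longrightarrow> X i = Y i" "h (X n) < h (X 0)"
    then show "h (Y n) < h (Y 0)" by (metis le_refl zero_le)
  qed
  moreover have "{X. \<exists>i. h (X 0) + real M \<le> h (X i)} \<in> sets path_space"
  proof (rule sets_path_ex)
    fix n and X Y :: "nat \<Rightarrow> 'd site"
    assume "\<And>i. i \<le> n \<Longrightarrow> X i = Y i" "h (X 0) + real M \<le> h (X n)"
    then show "h (Y 0) + real M \<le> h (Y n)" by (metis le_refl zero_le)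
  qed
  ultimately show ?thesis unfolding slow_exit_def by (intro sets_path_Collect)
qed

lemma swift_antimono: "M \<le> M' \<Longrightarrow> swift u M' R \<subseteq> swift u M R"
  unfolding swift_def by (auto, smt (verit) of_nat_mono)

lemma vimage_walk:
  assumes "f \<in> stacks_space \<rightarrow>\<^sub>M stacks_space" "A \<in> sets path_space"
  shows "{\<xi>. walk x (f \<xi>) \<in> A} \<in> sets stacks_space"
  using measurable_sets[OF measurable_compose[OF assms(1) measurable_walk] assms(2), of x]
  by (simp add: vimage_def)

lemmas vimage_walk_mix = vimage_walk[OF measurable_mix]
  and vimage_walk_id = vimage_walk[OF measurable_ident_sets[OF refl]]

lemma AE_path_0: "AE X in path_law. X 0 = 0"
proof -
  have "{X. X 0 = (0 :: 'd site)} \<in> sets path_space" by (rule sets_path_prefix[of 0]) auto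
  then show ?thesis
    unfolding path_law_def by (subst AE_distr_iff) (auto simp: measurable_walk)
qed

text \<open>Two decreasing families of events cover \<open>slow_exit\<close>. Paths that fall below
  the start, but only after time \<open>S\<close>, shrink to the empty set; paths that never fall
  below it and gain \<open>M\<close> shrink to \<open>escape\<close>, which is null.\<close>

lemma slow_exit_small:
  assumes 0: "path.prob escape = 0" and "0 < \<epsilon>"
  shows "\<exists>S M. path.prob (slow_exit S M) < \<epsilon>"
proof -
  define A where "A S = {X. \<forall>i\<le>S. 0 \<le> h (X i)} - stay" for S :: nat
  define B where "B M = stay \<inter> {X. \<exists>i. real M \<le> h (X i)}" for M :: nat
  have A: "A S \<in> sets path_space" for S
    unfolding A_def by (intro sets.Diff sets_stay sets_path_prefix[of S]) auto
  have B: "B M \<in> sets path_space" for M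
    unfolding B_def by (intro sets.Int sets_stay sets_path_ex) auto
  have "(\<lambda>S. path.prob (A S)) \<longlonglongrightarrow> path.prob (\<Inter>S. A S)"
    using A by (intro path.finite_Lim_measure_decseq) (auto simp: decseq_def A_def)
  moreover have "(\<Inter>S. A S) = {}" by (auto simp: A_def stay_def)
  ultimately have "(\<lambda>S. path.prob (A S)) \<longlonglongrightarrow> 0" by simp
  from order_tendstoD(2)[OF this, of "\<epsilon> / 2"] obtain S where S: "path.prob (A S) < \<epsilon> / 2"
    using \<open>0 < \<epsilon>\<close> by (auto simp: eventually_sequentially)
  have "(\<lambda>M. path.prob (B M)) \<longlonglongrightarrow> path.prob (\<Inter>M. B M)"
    using B by (intro path.finite_Lim_measure_decseq)
      (auto simp: decseq_def B_def, meson of_nat_mono order_trans)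
  moreover have "(\<Inter>M. B M) = escape" by (auto simp: B_def escape_def unbounded_def)
  ultimately have "(\<lambda>M. path.prob (B M)) \<longlonglongrightarrow> 0" using 0 by simp
  from order_tendstoD(2)[OF this, of "\<epsilon> / 2"] obtain M where M: "path.prob (B M) < \<epsilon> / 2"
    using \<open>0 < \<epsilon>\<close> by (auto simp: eventually_sequentially)
  have "path.prob (slow_exit S M) \<le> path.prob (A S \<union> B M)"
  proof (rule path.finite_measure_mono_AE)
    show "AE X in path_law. X \<in> slow_exit S M \<longrightarrow> X \<in> A S \<union> B M"
      using AE_path_0
    proof eventually_elim
      fix X :: "nat \<Rightarrow> 'd site" assume "X 0 = 0"
      then show "X \<in> slow_exit S M \<longrightarrow> X \<in> A S \<union> B M"
        by (auto simp: slow_exit_def A_def B_def stay_def not_le)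
    qed
  qed (use A B in auto)
  also have "\<dots> \<le> path.prob (A S) + path.prob (B M)"
    using A B by (intro measure_Un_le) auto
  finally show ?thesis using S M by (intro exI[of _ S] exI[of _ M]) simp
qed

lemma swift_bound_mono:
  assumes "swift_bound M R \<epsilon>" "M \<le> M'"
  shows "swift_bound M' R \<epsilon>"
  unfolding swift_bound_def
proof (intro allI impI)
  fix \<eta> :: "'d stacks" and u :: real and x :: "'d site"
  assume u: "u \<le> h x" "h x < u + 1"
  have "law.prob {\<xi>. walk x (mix {y. u \<le> h y} \<eta> \<xi>) \<in> swift u M' R}
      \<le> law.prob {\<xi>. walk x (mix {y. u \<le> h y} \<eta> \<xi>) \<in> swift u M R}"
  proof (rule law.finite_measure_mono)
    show "{\<xi>. walk x (mix {y. u \<le> h y} \<eta> \<xi>) \<in> swift u M R} \<in> sets law"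
      unfolding sets_law by (intro vimage_walk_mix sets_swift)
  qed (use swift_antimono[OF assms(2), of u R] in auto)
  also have "\<dots> \<le> \<epsilon>" using assms(1) u unfolding swift_bound_def by blast
  finally show "law.prob {\<xi>. walk x (mix {y. u \<le> h y} \<eta> \<xi>) \<in> swift u M' R} \<le> \<epsilon>" .
qed

lemma prob_slow_exit_mix:
  assumes H: "\<And>y. h x \<le> h y \<Longrightarrow> y \<in> H"
  shows "law.prob {\<xi>. walk x (mix H \<eta> \<xi>) \<in> slow_exit S M} \<le> path.prob (slow_exit S M)"
proof -
  let ?G = "slow_exit S M"
  have "{\<xi>. walk x (mix H \<eta> \<xi>) \<in> ?G} \<subseteq> {\<xi>. walk x \<xi> \<in> ?G}"
  proof safe
    fix \<xi> assume G: "walk x (mix H \<eta> \<xi>) \<in> ?G"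
    have agree: "walk x \<xi> n = walk x (mix H \<eta> \<xi>) n" if "\<And>i. i < n \<Longrightarrow> h x \<le> h (walk x (mix H \<eta> \<xi>) i)" for n
      by (rule walk_agree(1)[where H="{y. h x \<le> h y}"]) (use that H in auto)
    show "walk x \<xi> \<in> ?G"
    proof (cases "\<exists>i. h (walk x (mix H \<eta> \<xi>) i) < h x")
      case True
      define t where "t = (LEAST i. h (walk x (mix H \<eta> \<xi>) i) < h x)"
      have t: "h (walk x (mix H \<eta> \<xi>) t) < h x" unfolding t_def using True by (rule LeastI_ex)
      have "h x \<le> h (walk x (mix H \<eta> \<xi>) i)" if "i < t" for i
        using that not_less_Least[of i "\<lambda>i. h (walk x (mix H \<eta> \<xi>) i) < h x"] by (simp add: t_def)
      then have eq: "walk x \<xi> i = walk x (mix H \<eta> \<xi>) i" if "i \<le> t" for i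
        using that by (intro agree) auto
      have "S < t"
      proof (rule ccontr)
        assume "\<not> S < t"
        then have "h x \<le> h (walk x (mix H \<eta> \<xi>) t)" using G by (simp add: slow_exit_def)
        with t show False by simp
      qed
      have "h x \<le> h (walk x \<xi> i)" if "i \<le> S" for i
        using G eq[of i] that \<open>S < t\<close> by (simp add: slow_exit_def)
      moreover have "h (walk x \<xi> t) < h x" using eq[of t] t by simp
      ultimately show ?thesis unfolding slow_exit_def by auto
    next
      case False
      then have "walk x \<xi> n = walk x (mix H \<eta> \<xi>) n" for n by (intro agree) (auto simp: not_less)
      then have "walk x \<xi> = walk x (mix H \<eta> \<xi>)" by auto
      then show ?thesis using G by simp
    qed
  qed
  then have "law.prob {\<xi>. walk x (mix H \<eta> \<xi>) \<in> ?G} \<le> law.prob {\<xi>. walk x \<xi> \<in> ?G}"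
    by (rule law.finite_measure_mono) (simp add: sets_law vimage_walk_id sets_slow_exit)
  also have "{\<xi>. walk x \<xi> \<in> ?G} = {\<xi>. (\<lambda>y. \<xi> (x + y)) \<in> {\<xi>. walk 0 \<xi> \<in> ?G}}"
    using walk_translate[of x 0, simplified] by (simp add: slow_exit_def h_add add.assoc)
  also have "law.prob \<dots> = law.prob {\<xi>. walk 0 \<xi> \<in> ?G}"
    by (intro prob_distr measurable_translate distr_translate vimage_walk_id sets_slow_exit)
  finally show ?thesis by (simp add: prob_path_law sets_slow_exit)
qed

lemma height_at_entry:
  assumes "\<And>i. i < t \<Longrightarrow> h (walk z \<eta> i) < u" "h z < u + 1"
  shows "h (walk z \<eta> t) < u + 1"
proof (cases t)
  case (Suc s)
  then show ?thesis using assms(1)[of s] h_step[of z \<eta> s] by simp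
qed (simp add: assms(2))

lemma finite_displacements:
  "\<exists>Q. finite Q \<and> (\<forall>x \<xi>. \<forall>i\<le>S. walk x \<xi> i - x \<in> (Q :: 'd site set))"
proof (induction S)
  case 0
  show ?case by (intro exI[of _ "{0}"]) auto
next
  case (Suc S)
  then obtain Q where Q: "finite Q" "\<And>x \<xi> i. i \<le> S \<Longrightarrow> walk x \<xi> i - x \<in> (Q :: 'd site set)" by blast
  let ?Q = "Q \<union> (\<lambda>(y, e). y + e) ` (Q \<times> unit_steps)"
  have "walk x \<xi> i - x \<in> ?Q" if "i \<le> Suc S" for x \<xi> i
  proof (cases "i \<le> S")
    case False
    with that have i: "i = Suc S" by simp
    have "walk x \<xi> i - x = (walk x \<xi> S - x) + unit_step (rest x \<xi> S (walk x \<xi> S) 0)"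
      unfolding i walk_Suc by simp
    moreover have "walk x \<xi> S - x \<in> Q" by (rule Q(2)) simp
    ultimately have "walk x \<xi> i - x \<in> (\<lambda>(y, e). y + e) ` (Q \<times> unit_steps)"
      using unit_step_in
      by (intro image_eqI[of _ _ "(walk x \<xi> S - x, unit_step (rest x \<xi> S (walk x \<xi> S) 0))"]) auto
    then show ?thesis ..
  qed (use Q in auto)
  moreover have "finite ?Q" using Q(1) finite_unit_steps by auto
  ultimately show ?case by blast
qed

text \<open>
  The stacks below height \<open>u\<close> are arbitrary. Each excursion from \<open>x\<close> above height \<open>h x\<close> that ends
  within \<open>S\<close> steps follows one of finitely many paths; after it, the stacks above \<open>u\<close> are shifted,
  and shifting them by a fixed amount preserves their law. So up to a constant factor the next
  visit of the slab sees fresh stacks above \<open>u\<close>.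
\<close>

lemma prob_swift_small:
  assumes esc: "path.prob escape = 0"
  shows "0 < \<epsilon> \<Longrightarrow> \<exists>M. swift_bound M R \<epsilon>"
proof (induction R arbitrary: \<epsilon>)
  case 0
  then show ?case by (intro exI[of _ 0]) (simp add: swift_bound_def swift_def)
next
  case (Suc R)
  obtain S M' where SM: "path.prob (slow_exit S M') < \<epsilon> / 2"
    using slow_exit_small[OF esc, of "\<epsilon> / 2"] Suc.prems by auto
  obtain Q where Q: "finite Q" "\<And>x \<xi> i. i \<le> S \<Longrightarrow> walk x \<xi> i - x \<in> (Q :: 'd site set)"
    using finite_displacements by blast
  \<comment> \<open>A pair consists of the time of the first drop below \<open>h x\<close> and the
    path of the first \<open>S\<close> steps, as displacements from \<open>x\<close>.\<close>
  define I where "I = {1..S} \<times> ({..S} \<rightarrow>\<^sub>E Q)"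
  have I: "finite I" unfolding I_def using Q(1) by (intro finite_cartesian_product finite_PiE) auto
  \<comment> \<open>The union over \<open>I\<close> may cost \<open>\<epsilon> / 2\<close>, the
    other half being spent on \<open>slow_exit\<close>. The added 1 keeps the denominator
    positive.\<close>
  define \<epsilon>' where "\<epsilon>' = \<epsilon> / (2 * (real (card I) + 1))"
  have \<epsilon>': "0 < \<epsilon>'" using Suc.prems by (simp add: \<epsilon>'_def add_nonneg_pos)
  obtain M1 where M1: "\<And>\<eta> u x. u \<le> h x \<Longrightarrow> h x < u + 1 \<Longrightarrow>
      law.prob {\<xi>. walk x (mix {y. u \<le> h y} \<eta> \<xi>) \<in> swift u M1 R} \<le> \<epsilon>'"
    using Suc.IH[OF \<epsilon>'] unfolding swift_bound_def by blast
  \<comment> \<open>Reaching height \<open>u + M\<close> must imply three things: a rise to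
    \<open>u + M1\<close> for the restarted walk, a gain of \<open>M'\<close> for
    \<open>slow_exit\<close>, and a time later than \<open>S\<close>. For the last, \<open>S\<close>
    steps from below \<open>u + 1\<close> cannot reach \<open>u + S + 2\<close>.\<close>
  define M where "M = M1 + M' + S + 2"
  show ?case
    unfolding swift_bound_def
  proof (intro exI[of _ M] allI impI)
    fix \<eta> :: "'d stacks" and u :: real and x :: "'d site"
    assume ux: "u \<le> h x" "h x < u + 1"
    define H where "H = {y. u \<le> h y}"
    let ?w = "\<lambda>\<xi>. walk x (mix H \<eta> \<xi>)"
    define E where "E = (\<lambda>(s, \<beta>). {\<xi>. ?w \<xi> \<in> swift u M (Suc R) \<and> (\<forall>i\<le>S. ?w \<xi> i - x = \<beta> i)
      \<and> h (?w \<xi> s) < h x \<and> (\<forall>i<s. h x \<le> h (?w \<xi> i))})"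
    have setsE: "E p \<in> sets law" for p
    proof -
      obtain s \<beta> where p: "p = (s, \<beta>)" by (cases p)
      have 1: "{\<xi>. ?w \<xi> \<in> swift u M (Suc R)} \<in> sets stacks_space"
        by (intro vimage_walk_mix sets_swift)
      let ?P = "{X. (\<forall>i\<le>S. X i - x = \<beta> i) \<and> h (X s) < h x \<and> (\<forall>i<s. h x \<le> h (X i))}"
      have "?P \<in> sets path_space"
        by (rule sets_path_prefix[of "max S s"]) auto
      then have 2: "{\<xi>. ?w \<xi> \<in> ?P} \<in> sets stacks_space" by (rule vimage_walk_mix)
      have "E p = {\<xi>. ?w \<xi> \<in> swift u M (Suc R)} \<inter> {\<xi>. ?w \<xi> \<in> ?P}"
        unfolding E_def p by auto
      then show ?thesis using 1 2 by (simp add: sets_law)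
    qed
    have sub: "{\<xi>. ?w \<xi> \<in> swift u M (Suc R)} \<subseteq> {\<xi>. ?w \<xi> \<in> slow_exit S M'} \<union> (\<Union>p\<in>I. E p)"
    proof
      fix \<xi> assume "\<xi> \<in> {\<xi>. ?w \<xi> \<in> swift u M (Suc R)}"
      then have sw: "?w \<xi> \<in> swift u M (Suc R)" by simp
      show "\<xi> \<in> {\<xi>. ?w \<xi> \<in> slow_exit S M'} \<union> (\<Union>p\<in>I. E p)"
      proof (cases "\<exists>s\<le>S. h (?w \<xi> s) < h x")
        case True
        then obtain s0 where s0: "s0 \<le> S" "h (?w \<xi> s0) < h x" by blast
        define s where "s = (LEAST s. h (?w \<xi> s) < h x)"
        have s: "h (?w \<xi> s) < h x" unfolding s_def using s0(2) by (rule LeastI)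
        have lt: "h x \<le> h (?w \<xi> i)" if "i < s" for i
          using that not_less_Least[of i "\<lambda>s. h (?w \<xi> s) < h x"] by (simp add: s_def)
        have "s \<le> S" using s0 Least_le[of "\<lambda>s. h (?w \<xi> s) < h x" s0] by (simp add: s_def)
        moreover have "s \<noteq> 0" using s by (metis less_irrefl walk_0)
        moreover define \<beta> where "\<beta> = restrict (\<lambda>i. ?w \<xi> i - x) {..S}"
        ultimately have "(s, \<beta>) \<in> I" using Q(2) by (auto simp: I_def \<beta>_def)
        moreover have "\<xi> \<in> E (s, \<beta>)" using sw s lt by (auto simp: E_def \<beta>_def)
        ultimately show ?thesis by blast
      next
        case False
        obtain n where n: "u + real M \<le> h (?w \<xi> n)" using sw by (auto simp: swift_def)
        have "h x + real M' \<le> h (?w \<xi> n)" using n ux by (simp add: M_def)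
        then have "?w \<xi> \<in> slow_exit S M'" using False by (auto simp: slow_exit_def not_less)
        then show ?thesis by simp
      qed
    qed
    have E_le: "law.prob (E p) \<le> \<epsilon>'" if "p \<in> I" for p
    proof -
      obtain s \<beta> where p: "p = (s, \<beta>)" by (cases p)
      have s: "1 \<le> s" "s \<le> S" using that by (auto simp: I_def p)
      define z where "z = x + \<beta> s"
      \<comment> \<open>The visits are counted along the prescribed path \<open>\<beta>\<close>, not
        along the random walk, so that \<open>c\<close> is a constant shift and
        \<open>distr_shift_stacks\<close> applies.\<close>
      define c where "c y = card {i. i < s \<and> x + \<beta> i = y}" for y
      have E: "?w \<xi> \<in> swift u M (Suc R)" "?w \<xi> s = z" "h z < h x" "\<And>i. i < s \<Longrightarrow> h x \<le> h (?w \<xi> i)"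
        "\<And>i. ?w \<xi> (s + i) = walk z (mix H \<eta> (shift_stacks c \<xi>)) i" if "\<xi> \<in> E p" for \<xi>
      proof -
        have \<beta>: "?w \<xi> i = x + \<beta> i" if "i \<le> S" for i
          using \<open>\<xi> \<in> E p\<close> that by (auto simp: E_def p algebra_simps)
        show 1: "?w \<xi> \<in> swift u M (Suc R)" "?w \<xi> s = z" "h z < h x" "\<And>i. i < s \<Longrightarrow> h x \<le> h (?w \<xi> i)"
          using that \<beta> s by (auto simp: E_def p z_def)
        have "{i. i < s \<and> ?w \<xi> i = y} = {i. i < s \<and> x + \<beta> i = y}" for y
          using \<beta> s by auto
        then have "(\<lambda>y. card {i. i < s \<and> ?w \<xi> i = y}) = c" by (simp add: c_def fun_eq_iff)
        moreover have "?w \<xi> i \<in> H" if "i < s" for i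
          using 1(4)[OF that] ux by (simp add: H_def)
        ultimately have "rest x (mix H \<eta> \<xi>) s = mix H \<eta> (shift_stacks c \<xi>)"
          by (subst rest_mix_inside) auto
        then show "?w \<xi> (s + i) = walk z (mix H \<eta> (shift_stacks c \<xi>)) i" for i
          by (simp add: walk_add 1)
      qed
      have late: "s < n" if "u + real M \<le> h (?w \<xi> n)" for n \<xi>
        using that h_walk_le[of x "mix H \<eta> \<xi>" n] ux s by (simp add: M_def)
      show ?thesis
      proof (cases rule: walk_mix_entry[of z H \<eta>])
        case never
        have "E p = {}"
        proof (rule ccontr)
          assume "E p \<noteq> {}"
          then obtain \<xi> where \<xi>: "\<xi> \<in> E p" by blast
          then obtain n where n: "u + real M \<le> h (?w \<xi> n)" using E(1) by (auto simp: swift_def)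
          then have "?w \<xi> n = walk z (mix H \<eta> (shift_stacks c \<xi>)) (n - s)"
            using E(5)[OF \<xi>, of "n - s"] late[OF n] by simp
          then have "walk z (mix H \<eta> (shift_stacks c \<xi>)) (n - s) \<in> H" using n by (simp add: H_def)
          then show False using never by blast
        qed
        then show ?thesis using \<epsilon>' by simp
      next
        case (entry t \<eta>')
        show ?thesis
        proof (cases "E p = {}")
          case False
          then have hz: "h z < u + 1" using E(3) ux by force
          define y where "y = walk z \<eta> t"
          have y1: "u \<le> h y" using entry(1) by (simp add: y_def H_def)
          have y2: "h y < u + 1"
            unfolding y_def by (rule height_at_entry[OF _ hz]) (use entry(2) in \<open>simp add: H_def not_le\<close>)
          let ?B = "{\<xi>. walk y (mix H \<eta>' \<xi>) \<in> swift u M1 R}"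
          have "E p \<subseteq> {\<xi>. shift_stacks c \<xi> \<in> ?B}"
          proof
            fix \<xi> assume \<xi>: "\<xi> \<in> E p"
            let ?\<xi> = "shift_stacks c \<xi>"
            obtain n where n: "u + real M \<le> h (?w \<xi> n)"
              and cn: "card {i. i < n \<and> u \<le> h (?w \<xi> i) \<and> h (?w \<xi> i) < u + 1} < Suc R"
              using E(1)[OF \<xi>] by (auto simp: swift_def)
            have eqn: "?w \<xi> (s + t + i) = walk y (mix H \<eta>' ?\<xi>) i" for i
              using E(5)[OF \<xi>, of "t + i"] by (simp add: entry(4) y_def add.assoc)
            have "s + t \<le> n"
            proof (rule ccontr)
              assume "\<not> s + t \<le> n"
              then have lt: "n - s < t" using late[OF n] by simp
              have "?w \<xi> n = walk z (mix H \<eta> ?\<xi>) (n - s)"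
                using E(5)[OF \<xi>, of "n - s"] late[OF n] by simp
              also have "\<dots> = walk z \<eta> (n - s)" using lt by (intro entry(3)) simp
              finally have "walk z \<eta> (n - s) \<in> H" using n by (simp add: H_def)
              with entry(2)[OF lt] show False by simp
            qed
            then obtain k where k: "n = s + t + k" using le_Suc_ex by blast
            let ?C = "{i. i < k \<and> u \<le> h (walk y (mix H \<eta>' ?\<xi>) i) \<and> h (walk y (mix H \<eta>' ?\<xi>) i) < u + 1}"
            \<comment> \<open>Time 0 is a visit of the slab that the walk restarted at time
              \<open>s + t\<close> does not see. As \<open>s\<close> is positive it is a separate
              visit, and \<open>Suc R\<close> drops to \<open>R\<close>.\<close>
            have "card (insert 0 ((\<lambda>i. s + t + i) ` ?C))
                \<le> card {i. i < n \<and> u \<le> h (?w \<xi> i) \<and> h (?w \<xi> i) < u + 1}"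
              by (rule card_mono) (use k s ux eqn in auto)
            moreover have "card (insert 0 ((\<lambda>i. s + t + i) ` ?C)) = Suc (card ?C)"
              using s by (subst card_insert_disjoint) (auto simp: card_image inj_on_def)
            ultimately have "card ?C < R" using cn by simp
            moreover have "u + real M1 \<le> h (walk y (mix H \<eta>' ?\<xi>) k)"
              using n eqn[of k] by (simp add: k M_def)
            ultimately show "\<xi> \<in> {\<xi>. shift_stacks c \<xi> \<in> ?B}" by (auto simp: swift_def)
          qed
          moreover have B: "?B \<in> sets stacks_space" by (intro vimage_walk_mix sets_swift)
          moreover have "{\<xi>. shift_stacks c \<xi> \<in> ?B} \<in> sets law"
            using measurable_sets[OF measurable_shift_stacks B, of c] by (simp only: sets_law) (simp add: vimage_def)
          ultimately have "law.prob (E p) \<le> law.prob {\<xi>. shift_stacks c \<xi> \<in> ?B}"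
            by (intro law.finite_measure_mono)
          also have "\<dots> = law.prob ?B"
            by (intro prob_distr measurable_shift_stacks distr_shift_stacks B)
          also have "\<dots> \<le> \<epsilon>'" unfolding H_def by (rule M1[OF y1 y2])
          finally show ?thesis .
        qed (use \<epsilon>' in simp)
      qed
    qed
    have G: "{\<xi>. ?w \<xi> \<in> slow_exit S M'} \<in> sets law"
      unfolding sets_law by (intro vimage_walk_mix sets_slow_exit)
    have U: "(\<Union>p\<in>I. E p) \<in> sets law" by (intro sets.finite_UN I setsE)
    have "law.prob {\<xi>. ?w \<xi> \<in> swift u M (Suc R)} \<le> law.prob ({\<xi>. ?w \<xi> \<in> slow_exit S M'} \<union> (\<Union>p\<in>I. E p))"
      by (rule law.finite_measure_mono[OF sub]) (intro sets.Un G U)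
    also have "\<dots> \<le> law.prob {\<xi>. ?w \<xi> \<in> slow_exit S M'} + law.prob (\<Union>p\<in>I. E p)"
      by (rule measure_Un_le[OF G U])
    also have "law.prob {\<xi>. ?w \<xi> \<in> slow_exit S M'} \<le> path.prob (slow_exit S M')"
      by (rule prob_slow_exit_mix) (use ux in \<open>auto simp: H_def\<close>)
    also have "\<dots> \<le> \<epsilon> / 2" using SM by simp
    also have "law.prob (\<Union>p\<in>I. E p) \<le> (\<Sum>p\<in>I. law.prob (E p))"
      by (rule law.finite_measure_subadditive_finite) (use I setsE in auto)
    also have "\<dots> \<le> (\<Sum>p\<in>I. \<epsilon>')" by (rule sum_mono) (rule E_le)
    also have "\<dots> \<le> \<epsilon> / 2"
      using Suc.prems by (simp add: \<epsilon>'_def field_simps)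
    finally show "law.prob {\<xi>. walk x (mix {y. u \<le> h y} \<eta> \<xi>) \<in> swift u M (Suc R)} \<le> \<epsilon>"
      by (simp add: H_def)
  qed
qed

end

section \<open>Counting slabs: speed at most 0 when escape is null\<close>

text \<open>Levels in one residue class modulo \<open>M\<close> are at least \<open>M\<close> apart,
  the spacing that \<open>prob_swift_Int\<close> requires.\<close>

lemma card_residue_classes_le:
  fixes P :: "nat \<Rightarrow> bool"
  assumes "0 < M"
  shows "card {j. j < t * M \<and> P j} \<le> (\<Sum>r<M. card {i. i < t \<and> P (r + i * M)})"
proof -
  have "{j. j < t * M \<and> P j} \<subseteq> (\<Union>r\<in>{..<M}. (\<lambda>i. r + i * M) ` {i. i < t \<and> P (r + i * M)})"
  proof
    fix j assume "j \<in> {j. j < t * M \<and> P j}"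
    then have "j < t * M" "P j" by auto
    then have "j = j mod M + j div M * M" "j mod M < M" "j div M < t"
      using \<open>0 < M\<close> by (auto simp: less_mult_imp_div_less)
    then show "j \<in> (\<Union>r\<in>{..<M}. (\<lambda>i. r + i * M) ` {i. i < t \<and> P (r + i * M)})"
      using \<open>P j\<close> by (intro UN_I[of "j mod M"] image_eqI[of _ _ "j div M"]) auto
  qed
  then have "card {j. j < t * M \<and> P j}
      \<le> card (\<Union>r\<in>{..<M}. (\<lambda>i. r + i * M) ` {i. i < t \<and> P (r + i * M)})"
    by (rule card_mono[rotated]) auto
  also have "\<dots> \<le> (\<Sum>r<M. card ((\<lambda>i. r + i * M) ` {i. i < t \<and> P (r + i * M)}))"
    by (rule card_UN_le) simp
  also have "\<dots> \<le> (\<Sum>r<M. card {i. i < t \<and> P (r + i * M)})"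
    by (intro sum_mono card_image_le) simp
  finally show ?thesis .
qed

text \<open>The slabs are disjoint, so each time before \<open>n\<close> is spent in at most one of
  them.\<close>

lemma card_often_visited_le:
  fixes f :: "nat \<Rightarrow> real"
  shows "card {j. j < J \<and> R \<le> card {i. i < n \<and> real j \<le> f i \<and> f i < real j + 1}} * R \<le> n"
proof -
  let ?V = "\<lambda>j. {i. i < n \<and> real j \<le> f i \<and> f i < real j + 1}"
  let ?B = "{j. j < J \<and> R \<le> card (?V j)}"
  have "card ?B * R = (\<Sum>j\<in>?B. R)" by simp
  also have "\<dots> \<le> (\<Sum>j\<in>?B. card (?V j))" by (rule sum_mono) simp
  also have "\<dots> = card (\<Union>j\<in>?B. ?V j)"
    by (rule card_UN_disjoint[symmetric]) auto
  also have "\<dots> \<le> card {..<n}" by (rule card_mono) auto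
  finally show ?thesis by simp
qed

context stack_walk
begin

text \<open>Before the entry into the half-space the path is frozen and has not visited the slab; it
  enters below height \<open>b + 1\<close>. From there \<open>swift_bound\<close> applies with the
  remaining frozen stacks.\<close>

lemma prob_swift_from_origin:
  fixes b :: nat
  assumes bound: "swift_bound M R \<epsilon>"
    and "0 \<le> \<epsilon>"
  shows "law.prob {\<xi>. walk 0 (mix {y. real b \<le> h y} \<eta> \<xi>) \<in> swift b M R} \<le> \<epsilon>"
proof -
  define H where "H = {y. real b \<le> h y}"
  let ?w = "\<lambda>\<xi>. walk 0 (mix H \<eta> \<xi>)"
  have "law.prob {\<xi>. ?w \<xi> \<in> swift b M R} \<le> \<epsilon>"
  proof (cases rule: walk_mix_entry[of 0 H \<eta>])
    case never
    have "{\<xi>. ?w \<xi> \<in> swift b M R} = {}"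
    proof -
      have "?w \<xi> \<notin> swift b M R" for \<xi>
      proof
        assume "?w \<xi> \<in> swift b M R"
        then obtain n where "real b + real M \<le> h (?w \<xi> n)" by (auto simp: swift_def)
        then have "?w \<xi> n \<in> H" by (simp add: H_def)
        with never show False by blast
      qed
      then show ?thesis by blast
    qed
    then show ?thesis using \<open>0 \<le> \<epsilon>\<close> by simp
  next
    case (entry t \<eta>')
    define y where "y = walk 0 \<eta> t"
    have y1: "real b \<le> h y" using entry(1) by (simp add: y_def H_def)
    have y2: "h y < real b + 1"
      unfolding y_def
    proof (rule height_at_entry)
      show "h (walk 0 \<eta> i) < real b" if "i < t" for i
        using entry(2)[OF that] by (simp add: H_def)
    qed simp
    let ?B = "{\<xi>. walk y (mix H \<eta>' \<xi>) \<in> swift b M R}"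
    have "{\<xi>. ?w \<xi> \<in> swift b M R} \<subseteq> ?B"
    proof safe
      fix \<xi> assume "?w \<xi> \<in> swift b M R"
      then obtain n where n: "real b + real M \<le> h (?w \<xi> n)"
        and cn: "card {i. i < n \<and> real b \<le> h (?w \<xi> i) \<and> h (?w \<xi> i) < real b + 1} < R"
        by (auto simp: swift_def)
      have "t \<le> n"
      proof (rule ccontr)
        assume "\<not> t \<le> n"
        then have "walk 0 \<eta> n \<in> H" using entry(3)[of n \<xi>] n by (simp add: H_def)
        then show False using entry(2)[of n] \<open>\<not> t \<le> n\<close> by simp
      qed
      then obtain k where k: "n = t + k" using le_Suc_ex by blast
      have eqn: "?w \<xi> (t + i) = walk y (mix H \<eta>' \<xi>) i" for i
        by (simp add: entry(4) y_def)
      let ?C = "{i. i < k \<and> real b \<le> h (walk y (mix H \<eta>' \<xi>) i) \<and> h (walk y (mix H \<eta>' \<xi>) i) < real b + 1}"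
      have "card ((\<lambda>i. t + i) ` ?C)
          \<le> card {i. i < n \<and> real b \<le> h (?w \<xi> i) \<and> h (?w \<xi> i) < real b + 1}"
        by (rule card_mono) (use k eqn in auto)
      then have "card ?C < R" using cn by (simp add: card_image)
      then show "walk y (mix H \<eta>' \<xi>) \<in> swift b M R"
        unfolding swift_def mem_Collect_eq
        by (intro exI[of _ k] conjI) (use n eqn[of k] in \<open>simp_all add: k\<close>)
    qed
    moreover have "?B \<in> sets law" unfolding sets_law by (intro vimage_walk_mix sets_swift)
    ultimately have "law.prob {\<xi>. ?w \<xi> \<in> swift b M R} \<le> law.prob ?B"
      by (rule law.finite_measure_mono)
    also have "\<dots> \<le> \<epsilon>" unfolding H_def
      by (rule bound[unfolded swift_bound_def, rule_format, OF y1 y2])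
    finally show ?thesis .
  qed
  then show ?thesis by (simp add: H_def)
qed

lemma sets_swift_Int:
  "finite A \<Longrightarrow> (\<Inter>a\<in>A. swift (f a) M R) \<in> sets path_space"
proof (induction A rule: finite_induct)
  case empty
  then show ?case using sets.top[of path_space] by (simp add: space_PiM)
next
  case (insert a A)
  then show ?case using sets.Int[OF sets_swift insert.IH] by simp
qed

text \<open>Induction on the highest level \<open>b\<close>. The events at the lower levels force a
  corresponding event for the walk stopped on reaching height \<open>b\<close>, which has read only
  stacks below \<open>b\<close>; given these stacks, the event at \<open>b\<close> has probability
  at most \<open>\<epsilon>\<close>. No exact independence of the events is claimed.\<close>

lemma prob_swift_Int:
  assumes bound: "swift_bound M R \<epsilon>"
    and \<epsilon>: "0 \<le> \<epsilon>"
  shows "finite A \<Longrightarrow> (\<And>a b. a \<in> A \<Longrightarrow> b \<in> A \<Longrightarrow> a < b \<Longrightarrow> a + M \<le> b) \<Longrightarrow>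
    path.prob (\<Inter>a\<in>A. swift (real a) M R) \<le> \<epsilon> ^ card A"
proof (induction A rule: finite_linorder_max_induct)
  case empty
  show ?case by simp
next
  case (insert b A)
  define W where "W A = (\<Inter>a\<in>A. swift (real a) M R)" for A :: "nat set"
  have W: "W A' \<in> sets path_space" if "finite A'" for A'
    unfolding W_def using that by (rule sets_swift_Int)
  define H where "H = {y. real b \<le> h y}"
  have sub: "walk 0 \<eta> \<in> W A" if w: "walk 0 (mix H \<eta> \<xi>) \<in> W (insert b A)" for \<eta> \<xi>
  proof -
    let ?w = "walk 0 (mix H \<eta> \<xi>)"
    have "?w \<in> swift (real b) M R" using w by (simp add: W_def)
    then obtain i0 where "real b + real M \<le> h (?w i0)" by (auto simp: swift_def)
    then have i0: "real b \<le> h (?w i0)" by simp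
    define t where "t = (LEAST i. real b \<le> h (?w i))"
    have t: "real b \<le> h (?w t)" unfolding t_def using i0 by (rule LeastI)
    have lt: "?w i \<in> - H" if "i < t" for i
      using that not_less_Least[of i "\<lambda>i. real b \<le> h (?w i)"] by (simp add: t_def H_def)
    have eq: "walk 0 \<eta> i = ?w i" if "i \<le> t" for i
      by (rule walk_agree(1)[where H="- H"]) (use lt that in auto)
    show ?thesis unfolding W_def
    proof
      fix a assume a: "a \<in> A"
      then have "?w \<in> swift (real a) M R" using w by (simp add: W_def)
      then obtain n where n: "real a + real M \<le> h (?w n)"
        and cn: "card {i. i < n \<and> real a \<le> h (?w i) \<and> h (?w i) < real a + 1} < R"
        by (auto simp: swift_def)
      have "a + M \<le> b" using insert.prems[of a b] insert.hyps a by auto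
      then have abt: "real a + real M \<le> h (?w t)" using t by linarith
      \<comment> \<open>At time \<open>t\<close> the walk is already above \<open>a + M\<close>, and
        stopping earlier can only lower the number of visits, so \<open>swift\<close> is still
        witnessed at the smaller time.\<close>
      let ?n = "min n t"
      have "{i. i < ?n \<and> real a \<le> h (walk 0 \<eta> i) \<and> h (walk 0 \<eta> i) < real a + 1}
          \<subseteq> {i. i < n \<and> real a \<le> h (?w i) \<and> h (?w i) < real a + 1}"
        by (auto simp: eq)
      then have "card {i. i < ?n \<and> real a \<le> h (walk 0 \<eta> i) \<and> h (walk 0 \<eta> i) < real a + 1} < R"
        by (intro le_less_trans[OF card_mono cn]) auto
      moreover have "real a + real M \<le> h (walk 0 \<eta> ?n)"
        using n abt eq by (cases "n \<le> t") (auto simp: min_def)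
      ultimately show "walk 0 \<eta> \<in> swift (real a) M R" by (auto simp: swift_def)
    qed
  qed
  have fin: "finite (insert b A)" using insert.hyps by simp
  have "path.prob (W (insert b A)) = law.prob {\<xi>. walk 0 \<xi> \<in> W (insert b A)}"
    by (rule prob_path_law[OF W[OF fin]])
  also have "\<dots> \<le> \<epsilon> * law.prob {\<xi>. walk 0 \<xi> \<in> W A}"
  proof (rule prob_le_mix[where H=H])
    show "{\<xi>. walk 0 \<xi> \<in> W (insert b A)} \<in> sets stacks_space" "{\<xi>. walk 0 \<xi> \<in> W A} \<in> sets stacks_space"
      by (intro vimage_walk_id W fin insert.hyps)+
    show "\<eta> \<in> {\<xi>. walk 0 \<xi> \<in> W A}" if "mix H \<eta> \<xi> \<in> {\<xi>. walk 0 \<xi> \<in> W (insert b A)}" for \<eta> \<xi>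
      using that sub[of \<eta> \<xi>] by blast
    show "law.prob {\<xi>. mix H \<eta> \<xi> \<in> {\<xi>. walk 0 \<xi> \<in> W (insert b A)}} \<le> \<epsilon>" for \<eta>
    proof -
      have "law.prob {\<xi>. mix H \<eta> \<xi> \<in> {\<xi>. walk 0 \<xi> \<in> W (insert b A)}}
          \<le> law.prob {\<xi>. walk 0 (mix H \<eta> \<xi>) \<in> swift b M R}"
      proof (rule law.finite_measure_mono)
        show "{\<xi>. walk 0 (mix H \<eta> \<xi>) \<in> swift b M R} \<in> sets law"
          unfolding sets_law by (intro vimage_walk_mix sets_swift)
      qed (auto simp: W_def)
      also have "\<dots> \<le> \<epsilon>"
        unfolding H_def using bound \<epsilon> by (rule prob_swift_from_origin)
      finally show ?thesis .
    qed
  qed (rule \<epsilon>)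
  also have "law.prob {\<xi>. walk 0 \<xi> \<in> W A} = path.prob (W A)"
    by (rule prob_path_law[symmetric, OF W]) (rule insert.hyps)
  also have "path.prob (W A) \<le> \<epsilon> ^ card A"
    unfolding W_def by (rule insert.IH) (use insert.prems in auto)
  also have "\<epsilon> * \<epsilon> ^ card A = \<epsilon> ^ card (insert b A)"
    using insert.hyps by (subst card_insert_disjoint) auto
  finally show ?case using \<epsilon> by (simp add: W_def mult_left_mono)
qed

text \<open>If \<open>h (X n) > n / K\<close>, then fewer than \<open>h (X n) / 4\<close> slabs are
  visited \<open>R\<close> times before \<open>n\<close>. Most levels below \<open>h (X n)\<close>
  are then swift, so in some residue class modulo \<open>M\<close> more than a quarter of them are;
  this has exponentially small probability in the number of levels, and Borel-Cantelli
  applies.\<close>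

lemma AE_eventually_below:
  assumes esc: "path.prob escape = 0" and K: "0 < (K :: nat)"
  shows "AE X in path_law. eventually (\<lambda>n. h (X n) \<le> real n / real K) sequentially"
proof -
  \<comment> \<open>With \<open>c1\<close> slabs visited \<open>R\<close> times,
    \<open>c1 * R \<le> n < K * h (X n)\<close> gives \<open>4 * c1 < h (X n)\<close>.\<close>
  define R where "R = 4 * K"
  \<comment> \<open>The constant is \<open>(1 / 4) ^ 4\<close>: a set of at least
    \<open>t / 4\<close> swift levels then costs at most \<open>(1 / 4) ^ t\<close>, which beats the
    \<open>2 ^ t\<close> choices of the set.\<close>
  obtain M0 where "swift_bound M0 R (1 / 256)"
    using prob_swift_small[OF esc, of "1 / 256" R] by auto
  \<comment> \<open>Passing to the successor makes \<open>M\<close> positive, as the division into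
    residue classes requires.\<close>
  then have bound: "swift_bound (Suc M0) R (1 / 256)"
    by (rule swift_bound_mono) simp
  define M where "M = Suc M0"
  note bound = bound[folded M_def]
  define W where "W r S = (\<Inter>i\<in>S. swift (real (r + i * M)) M R)" for r S
  define I where "I t = {..<M} \<times> {S \<in> Pow {..<t}. t \<le> 4 * card S}" for t :: nat
  define G where "G t = (\<Union>(r, S)\<in>I t. W r S)" for t
  have I: "finite (I t)" "card (I t) \<le> M * 2 ^ t" for t
  proof -
    show "finite (I t)" by (simp add: I_def)
    have "card (I t) = M * card {S \<in> Pow {..<t}. t \<le> 4 * card S}"
      by (simp add: I_def card_cartesian_product)
    also have "card {S \<in> Pow {..<t}. t \<le> 4 * card S} \<le> card (Pow {..<t})" by (rule card_mono) auto
    finally show "card (I t) \<le> M * 2 ^ t" by (simp add: card_Pow)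
  qed
  have fS: "finite S" if "(r, S) \<in> I t" for r S t
    using that by (auto simp: I_def intro: finite_subset)
  have W: "W r S \<in> sets path_law" if "finite S" for r S
    unfolding W_def using that by (simp add: sets_swift_Int)
  have G: "G t \<in> sets path_law" for t
    unfolding G_def using W fS by (intro sets.finite_UN I(1)) auto
  have W_le: "path.prob (W r S) \<le> (1 / 4) ^ t" if "(r, S) \<in> I t" for r S t
  proof -
    have "0 < M" by (simp add: M_def)
    then have inj: "inj_on (\<lambda>i. r + i * M) S" by (auto simp: inj_on_def)
    have "W r S = (\<Inter>a\<in>(\<lambda>i. r + i * M) ` S. swift (real a) M R)" by (auto simp: W_def)
    also have "path.prob \<dots> \<le> (1 / 256) ^ card ((\<lambda>i. r + i * M) ` S)"
    proof (rule prob_swift_Int[OF bound])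
      fix a b assume ab: "a \<in> (\<lambda>i. r + i * M) ` S" "b \<in> (\<lambda>i. r + i * M) ` S" "a < b"
      then obtain i j where ij: "a = r + i * M" "b = r + j * M" by auto
      with \<open>a < b\<close> have "i * M < j * M" by simp
      then have "Suc i \<le> j" by simp
      then have "Suc i * M \<le> j * M" by (rule mult_le_mono1)
      then show "a + M \<le> b" by (simp add: ij)
    qed (use fS[OF that] in auto)
    also have "\<dots> = (1 / 4) ^ (4 * card S)"
      unfolding card_image[OF inj] power_mult by (simp add: power_divide)
    also have "\<dots> \<le> (1 / 4) ^ t"
      by (rule power_decreasing) (use that in \<open>auto simp: I_def\<close>)
    finally show ?thesis .
  qed
  have G_le: "path.prob (G t) \<le> real M * (1 / 2) ^ t" for t
  proof -
    have "path.prob (G t) \<le> (\<Sum>p\<in>I t. path.prob (case p of (r, S) \<Rightarrow> W r S))"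
      unfolding G_def using W fS by (intro path.finite_measure_subadditive_finite I(1)) auto
    also have "\<dots> \<le> (\<Sum>p\<in>I t. (1 / 4) ^ t)"
      by (rule sum_mono) (auto simp: W_le)
    also have "\<dots> \<le> real (M * 2 ^ t) * (1 / 4) ^ t"
      using I(2)[of t] by (simp only: sum_constant) (intro mult_right_mono of_nat_mono, auto)
    also have "\<dots> = real M * (2 * (1 / 4)) ^ t"
      by (simp only: power_mult_distrib of_nat_mult of_nat_power of_nat_numeral mult.assoc)
    finally show ?thesis by simp
  qed
  have "summable (\<lambda>t. path.prob (G t))"
    by (rule summable_comparison_test'[OF summable_mult[OF summable_geometric[of "1 / 2 :: real"]], where N=0])
      (use G_le in auto)
  then have "AE X in path_law. eventually (\<lambda>t. X \<in> space path_law - G t) sequentially"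
    by (intro borel_cantelli_AE1 G) (auto simp: path.emeasure_eq_measure)
  then show ?thesis
  proof eventually_elim
    fix X assume "eventually (\<lambda>t. X \<in> space path_law - G t) sequentially"
    then obtain t0 where t0: "\<And>t. t0 \<le> t \<Longrightarrow> X \<notin> G t" by (auto simp: eventually_sequentially)
    show "eventually (\<lambda>n. h (X n) \<le> real n / real K) sequentially"
      unfolding eventually_sequentially
    proof (intro exI allI impI)
      fix n assume n: "K * ((t0 + 3) * M) \<le> n"
      show "h (X n) \<le> real n / real K"
      proof (rule ccontr)
        assume "\<not> h (X n) \<le> real n / real K"
        then have big: "real n < real K * h (X n)" using K by (simp add: field_simps)
        define q where "q = nat \<lfloor>h (X n) / real M\<rfloor>"
        have "real (K * ((t0 + 3) * M)) < real K * h (X n)"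
          using n big by (meson le_less_trans of_nat_mono)
        then have "real ((t0 + 3) * M) < h (X n)" using K by (simp add: mult.assoc)
        then have "real (t0 + 3) < h (X n) / real M"
          by (simp add: M_def field_simps)
        then have q: "t0 + 3 \<le> q" "real q \<le> h (X n) / real M" "h (X n) / real M < real q + 1"
          unfolding q_def by linarith+
        then have q': "real q * real M \<le> h (X n)" "h (X n) < (real q + 1) * real M"
          by (simp_all add: M_def field_simps)
        \<comment> \<open>One block of \<open>M\<close> levels is given up, so that every level
          \<open>j < t * M\<close> satisfies \<open>j + M \<le> h (X n)\<close> and is either often
          visited or swift.\<close>
        define t where "t = q - 1"
        have t: "t0 + 2 \<le> t" "q = t + 1" using q by (auto simp: t_def)
        let ?V = "\<lambda>j. {i. i < n \<and> real j \<le> h (X i) \<and> h (X i) < real j + 1}"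
        let ?P = "\<lambda>j. X \<in> swift (real j) M R"
        have cover: "{..<t * M} \<subseteq> {j. j < t * M \<and> R \<le> card (?V j)} \<union> {j. j < t * M \<and> ?P j}"
        proof
          fix j assume "j \<in> {..<t * M}"
          then have j: "j < t * M" by simp
          have "real (j + M) \<le> real (q * M)" unfolding t(2) using j by (intro of_nat_mono) simp
          then have "real j + real M \<le> h (X n)" using q'(1) by simp
          then have "?P j" if "card (?V j) < R" using that by (auto simp: swift_def)
          then show "j \<in> {j. j < t * M \<and> R \<le> card (?V j)} \<union> {j. j < t * M \<and> ?P j}"
            using j by (cases "card (?V j) < R") (auto simp: not_less)
        qed
        define c1 where "c1 = card {j. j < t * M \<and> R \<le> card (?V j)}"
        define c2 where "c2 = card {j. j < t * M \<and> ?P j}"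
        have "t * M \<le> card ({j. j < t * M \<and> R \<le> card (?V j)} \<union> {j. j < t * M \<and> ?P j})"
          using card_mono[OF _ cover] by simp
        also have "\<dots> \<le> c1 + c2" unfolding c1_def c2_def by (rule card_Un_le)
        finally have "real (t * M) \<le> real (c1 + c2)" by (rule of_nat_mono)
        then have 1: "real t * real M \<le> real c1 + real c2" by simp
        have "c1 * R \<le> n" unfolding c1_def by (rule card_often_visited_le)
        then have "real (c1 * R) \<le> real n" by (rule of_nat_mono)
        then have "real c1 * (4 * real K) < real K * h (X n)" using big by (simp add: R_def)
        then have "real K * (4 * real c1) < real K * h (X n)" by (simp add: mult.commute mult.left_commute)
        then have 2: "4 * real c1 < h (X n)" using K by simp
        define c where "c r = card {i. i < t \<and> ?P (r + i * M)}" for r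
        have "c r * 4 \<le> t" if "r < M" for r
        proof (rule ccontr)
          let ?S = "{i. i < t \<and> ?P (r + i * M)}"
          assume "\<not> c r * 4 \<le> t"
          then have "t \<le> 4 * card ?S" by (simp add: c_def)
          then have "(r, ?S) \<in> I t" using that by (auto simp: I_def)
          moreover have "X \<in> W r ?S" by (simp add: W_def)
          ultimately have "X \<in> G t" unfolding G_def by blast
          with t0[of t] t show False by simp
        qed
        then have "(\<Sum>r<M. c r * 4) \<le> (\<Sum>r<M. t)"
          by (intro sum_mono) auto
        then have "(\<Sum>r<M. c r) * 4 \<le> M * t"
          by (simp add: sum_distrib_right)
        moreover have "c2 \<le> (\<Sum>r<M. c r)"
          unfolding c2_def c_def by (rule card_residue_classes_le) (simp add: M_def)
        ultimately have "c2 * 4 \<le> M * t" by linarith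
        then have "real (c2 * 4) \<le> real (M * t)" by (rule of_nat_mono)
        then have 3: "4 * real c2 \<le> real t * real M" by (simp add: mult.commute)
        have "h (X n) < real t * real M + 2 * real M"
          using q'(2) t(2) by (simp add: distrib_right)
        with 1 2 3 have "4 * (real t * real M) < 2 * (real t * real M) + 2 * real M" by linarith
        then have "real t * real M < real M" by linarith
        then show False using t by (simp add: M_def)
      qed
    qed
  qed
qed

lemma AE_speed_le_0:
  assumes esc: "path.prob escape = 0"
  shows "AE X in path_law. \<forall>c>0. eventually (\<lambda>n. h (X n) \<le> c * real n) sequentially"
proof -
  have "AE X in path_law. \<forall>k. eventually (\<lambda>n. h (X n) \<le> real n / real (Suc k)) sequentially"
    unfolding AE_all_countable by (intro allI AE_eventually_below esc) simp
  then show ?thesis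
  proof eventually_elim
    fix X assume *: "\<forall>k. eventually (\<lambda>n. h (X n) \<le> real n / real (Suc k)) sequentially"
    show "\<forall>c>0. eventually (\<lambda>n. h (X n) \<le> c * real n) sequentially"
    proof (intro allI impI)
      fix c :: real assume "0 < c"
      then obtain k where "1 / real (Suc k) < c"
        using reals_Archimedean[of c] by (auto simp: inverse_eq_divide)
      then have k: "real n / real (Suc k) \<le> c * real n" for n
        using mult_right_mono[of "1 / real (Suc k)" c "real n"] by simp
      show "eventually (\<lambda>n. h (X n) \<le> c * real n) sequentially"
        using *[rule_format, of k] by (rule eventually_mono) (use k order_trans in blast)
    qed
  qed
qed

end

section \<open>Regenerations\<close>

lemma strict_mono_straddle:
  fixes N :: "nat \<Rightarrow> nat"
  assumes N: "strict_mono N" "N 0 = 0"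
  shows "\<exists>j. N j \<le> n \<and> n < N (Suc j)"
proof -
  define j where "j = (GREATEST j. N j \<le> n)"
  have bd: "i \<le> n" if "N i \<le> n" for i
    using strict_mono_imp_increasing[OF N(1), of i] that by simp
  have "N j \<le> n"
    unfolding j_def by (rule GreatestI_nat[where k=0 and b=n]) (use N(2) bd in auto)
  moreover have "i \<le> j" if "N i \<le> n" for i
    unfolding j_def using that by (rule Greatest_le_nat[where b=n]) (use bd in auto)
  then have "n < N (Suc j)" by (metis not_less Suc_n_not_le_n)
  ultimately show ?thesis by blast
qed

text \<open>For \<open>N j \<le> n < N (Suc j)\<close> the ratio lies between
  \<open>x (N j) / N (Suc j)\<close> and \<open>x (N (Suc j)) / N j\<close>, which have the same
  limit. The rate \<open>b\<close> is used in place of the mean gap of \<open>N\<close>, so that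
  \<open>b = 0\<close> covers gaps of infinite mean.\<close>

lemma renewal_sandwich:
  fixes x :: "nat \<Rightarrow> real" and N :: "nat \<Rightarrow> nat"
  assumes N: "strict_mono N" "N 0 = 0" and nonneg: "\<And>n. 0 \<le> x n"
    and mono: "\<And>j n. N j \<le> n \<Longrightarrow> n \<le> N (Suc j) \<Longrightarrow> x (N j) \<le> x n \<and> x n \<le> x (N (Suc j))"
    and b: "(\<lambda>j. real j / real (N j)) \<longlonglongrightarrow> b" and w: "(\<lambda>j. x (N j) / real j) \<longlonglongrightarrow> w"
  shows "(\<lambda>n. x n / real n) \<longlonglongrightarrow> w * b"
proof -
  obtain J where J: "\<And>n. N (J n) \<le> n" and J': "\<And>n. n < N (Suc (J n))"
    using strict_mono_straddle[OF N] by metis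
  have Jtop: "filterlim J at_top sequentially"
    unfolding filterlim_at_top eventually_sequentially
  proof (intro allI exI impI)
    fix k n assume "N k \<le> n"
    then have "N k < N (Suc (J n))" using J'[of n] by simp
    then show "k \<le> J n" using strict_mono_less[OF N(1)] by simp
  qed
  have pos: "0 < N j" if "0 < j" for j
    using strict_mono_less[OF N(1), of 0 j] that N(2) by simp
  have canc: "p / c * (c / d) * (d / e) = p / e" if "c \<noteq> 0" "d \<noteq> 0" for p c d e :: real
    using that by simp
  have r1: "(\<lambda>j. real (Suc j) / real j) \<longlonglongrightarrow> 1"
    using LIMSEQ_Suc_n_over_n by simp
  have r2: "(\<lambda>j. real j / real (Suc j)) \<longlonglongrightarrow> 1"
    using LIMSEQ_n_over_Suc_n by simp
  have "(\<lambda>j. x (N (Suc j)) / real (Suc j) * (real (Suc j) / real j) * (real j / real (N j))) \<longlonglongrightarrow> w * 1 * b"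
    by (intro tendsto_mult LIMSEQ_Suc[OF w] r1 b)
  moreover have "eventually (\<lambda>j. x (N (Suc j)) / real (Suc j) * (real (Suc j) / real j) * (real j / real (N j))
      = x (N (Suc j)) / real (N j)) sequentially"
    using eventually_gt_at_top[of 0] by eventually_elim (rule canc, auto)
  ultimately have "(\<lambda>j. x (N (Suc j)) / real (N j)) \<longlonglongrightarrow> w * 1 * b"
    by (rule Lim_transform_eventually)
  then have u: "(\<lambda>j. x (N (Suc j)) / real (N j)) \<longlonglongrightarrow> w * b" by simp
  have "(\<lambda>j. x (N j) / real j * (real j / real (Suc j)) * (real (Suc j) / real (N (Suc j)))) \<longlonglongrightarrow> w * 1 * b"
    by (intro tendsto_mult LIMSEQ_Suc[OF b] r2 w)
  moreover have "eventually (\<lambda>j. x (N j) / real j * (real j / real (Suc j)) * (real (Suc j) / real (N (Suc j)))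
      = x (N j) / real (N (Suc j))) sequentially"
    using eventually_gt_at_top[of 0] by eventually_elim (rule canc, auto)
  ultimately have "(\<lambda>j. x (N j) / real (N (Suc j))) \<longlonglongrightarrow> w * 1 * b"
    by (rule Lim_transform_eventually)
  then have l: "(\<lambda>j. x (N j) / real (N (Suc j))) \<longlonglongrightarrow> w * b" by simp
  show ?thesis
  proof (rule tendsto_sandwich)
    show "(\<lambda>n. x (N (J n)) / real (N (Suc (J n)))) \<longlonglongrightarrow> w * b"
      using filterlim_compose[OF l Jtop] .
    show "(\<lambda>n. x (N (Suc (J n))) / real (N (J n))) \<longlonglongrightarrow> w * b"
      using filterlim_compose[OF u Jtop] .
    show "eventually (\<lambda>n. x (N (J n)) / real (N (Suc (J n))) \<le> x n / real n) sequentially"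
      using eventually_gt_at_top[of 0]
    proof eventually_elim
      fix n :: nat assume "0 < n"
      have "x (N (J n)) \<le> x n" using mono[OF J[of n]] J'[of n] by simp
      then show "x (N (J n)) / real (N (Suc (J n))) \<le> x n / real n"
        using J'[of n] \<open>0 < n\<close> nonneg by (intro frac_le) auto
    qed
    show "eventually (\<lambda>n. x n / real n \<le> x (N (Suc (J n))) / real (N (J n))) sequentially"
      using filterlim_at_top[THEN iffD1, OF Jtop, rule_format, of 1]
    proof eventually_elim
      fix n assume "1 \<le> J n"
      then have "0 < N (J n)" by (intro pos) simp
      moreover have "x n \<le> x (N (Suc (J n)))" using mono[OF J[of n]] J'[of n] by simp
      ultimately show "x n / real n \<le> x (N (Suc (J n))) / real (N (J n))"
        using J[of n] nonneg by (intro frac_le) auto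
    qed
  qed
qed

lemma shift_path_shift_path: "shift_path m (shift_path n X) = shift_path (n + m) X"
  by (simp add: shift_path_def fun_eq_iff add.assoc)

context stack_walk
begin

definition first_hit :: "nat \<Rightarrow> nat \<Rightarrow> (nat \<Rightarrow> 'd site) \<Rightarrow> bool" where
  "first_hit i n X \<longleftrightarrow> real i \<le> h (X n) \<and> (\<forall>m<n. h (X m) < real i)"

definition success :: "nat \<Rightarrow> (nat \<Rightarrow> 'd site) set" where
  "success i = {X. \<exists>n. first_hit i n X \<and> shift_path n X \<in> escape}"

text \<open>A regeneration may occur at any real height. The event \<open>success i\<close> is the
  case in which it occurs at the first passage of the integer level \<open>i\<close>.\<close>

definition regen :: "nat \<Rightarrow> (nat \<Rightarrow> 'd site) \<Rightarrow> bool" where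
  "regen n X \<longleftrightarrow> (\<forall>m<n. h (X m) < h (X n)) \<and> shift_path n X \<in> escape"

text \<open>Holds for every walk driven by stacks, but not for every point of the path space;
  \<open>AE_steady\<close> makes it available under \<open>path_law\<close>.\<close>

definition steady :: "(nat \<Rightarrow> 'd site) \<Rightarrow> bool" where
  "steady X \<longleftrightarrow> X 0 = 0 \<and> (\<forall>n. \<bar>h (X (Suc n)) - h (X n)\<bar> \<le> 1)"

lemma AE_steady: "AE X in path_law. steady X"
proof -
  have "{X. X 0 = (0 :: 'd site)} \<in> sets path_space" by (rule sets_path_prefix[of 0]) auto
  moreover have "{X. \<forall>n. \<forall>i<n. \<bar>h (X (Suc i)) - h (X i)\<bar> \<le> 1} \<in> sets path_space"
  proof (intro sets_path_all allI impI)
    fix n i and X Y :: "nat \<Rightarrow> 'd site"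
    assume eq: "\<And>i. i \<le> n \<Longrightarrow> X i = Y i" and "\<forall>i<n. \<bar>h (X (Suc i)) - h (X i)\<bar> \<le> 1" "i < n"
    then show "\<bar>h (Y (Suc i)) - h (Y i)\<bar> \<le> 1" using eq[of i] eq[of "Suc i"] by auto
  qed
  ultimately have "{X. X 0 = 0 \<and> (\<forall>n. \<forall>i<n. \<bar>h (X (Suc i)) - h (X i)\<bar> \<le> 1)} \<in> sets path_space"
    by (rule sets_path_Collect)
  also have "{X. X 0 = 0 \<and> (\<forall>n. \<forall>i<n. \<bar>h (X (Suc i)) - h (X i)\<bar> \<le> 1)} = {X. steady X}"
    by (auto simp: steady_def)
  finally show ?thesis
    unfolding path_law_def by (subst AE_distr_iff) (auto simp: measurable_walk steady_def h_step)
qed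

lemma steady_le: "steady X \<Longrightarrow> h (X n) \<le> real n"
proof (induction n)
  case (Suc n)
  then have "h (X n) \<le> real n" "\<bar>h (X (Suc n)) - h (X n)\<bar> \<le> 1" by (auto simp: steady_def)
  then show ?case by simp
qed (simp add: steady_def)

lemma first_hit_le: "steady X \<Longrightarrow> first_hit i n X \<Longrightarrow> i \<le> n"
  using steady_le[of X n] by (simp add: first_hit_def)

lemma first_hit_less:
  assumes "steady X" "first_hit i n X"
  shows "h (X n) < real i + 1"
proof (cases n)
  case 0
  then show ?thesis using assms(1) by (simp add: steady_def)
next
  case (Suc m)
  then have "h (X m) < real i" "\<bar>h (X (Suc m)) - h (X m)\<bar> \<le> 1"
    using assms by (auto simp: first_hit_def steady_def)
  then show ?thesis by (simp add: Suc)
qed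

lemma first_hit_unique: "first_hit i n X \<Longrightarrow> first_hit i n' X \<Longrightarrow> n = n'"
  unfolding first_hit_def by (metis linorder_neqE_nat not_le)

lemma ex_first_hit: "(\<exists>n. first_hit i n X) \<longleftrightarrow> (\<exists>n. real i \<le> h (X n))"
proof
  assume "\<exists>n. real i \<le> h (X n)"
  then have "real i \<le> h (X (LEAST n. real i \<le> h (X n)))" by (rule LeastI_ex)
  moreover have "h (X m) < real i" if "m < (LEAST n. real i \<le> h (X n))" for m
    using not_less_Least[OF that] by simp
  ultimately show "\<exists>n. first_hit i n X" unfolding first_hit_def by blast
qed (auto simp: first_hit_def)

lemma sets_vimage_shift: "B \<in> sets path_space \<Longrightarrow> shift_path n -` B \<in> sets path_space"
  using measurable_sets[OF measurable_shift_path, of B n] by (simp add: space_PiM)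

lemma sets_first_hit: "{X. first_hit i n X} \<in> sets path_space"
  by (rule sets_path_prefix[of n]) (auto simp: first_hit_def)

lemma sets_success: "success i \<in> sets path_space"
proof -
  have "success i = (\<Union>n. {X. first_hit i n X} \<inter> shift_path n -` escape)"
    by (auto simp: success_def)
  also have "\<dots> \<in> sets path_space"
    by (intro sets.countable_UN) (auto intro!: sets.Int sets_first_hit sets_vimage_shift sets_escape)
  finally show ?thesis .
qed

lemma escape_subset: "escape \<subseteq> stay" by (auto simp: escape_def)

text \<open>The first passage of level \<open>i\<close> takes at least \<open>i \<ge> k\<close>
  steps, so \<open>E\<close> is decided by then. Decompose by the passage time and apply
  \<open>emeasure_fresh\<close> to each part.\<close>

lemma prob_prefix_success:
  assumes E: "E \<in> sets path_space"
    and det: "\<And>X Y. (\<And>j. j \<le> k \<Longrightarrow> X j = Y j) \<Longrightarrow> X \<in> E \<Longrightarrow> Y \<in> E"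
    and "k \<le> i"
  shows "path.prob (E \<inter> success i) = path.prob (E \<inter> {X. \<exists>n. real i \<le> h (X n)}) * path.prob escape"
proof -
  define F where "F n = E \<inter> {X. first_hit i n X}" for n
  \<comment> \<open>Passage times are written as \<open>n + i\<close>, so that every index stands
    for a time at which \<open>E\<close> is decided.\<close>
  define F' where "F' n = F (n + i) \<inter> shift_path (n + i) -` escape" for n
  have F: "F n \<in> sets path_space" for n unfolding F_def by (intro sets.Int E sets_first_hit)
  have F': "F' n \<in> sets path_space" for n
    unfolding F'_def by (intro sets.Int F sets_vimage_shift sets_escape)
  have disj: "disjoint_family F'" "disjoint_family (\<lambda>n. F (n + i))"
    unfolding disjoint_family_on_def F'_def F_def by (auto dest: first_hit_unique)
  have eF': "emeasure path_law (F' n) = emeasure path_law (F (n + i)) * emeasure path_law escape" for n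
    unfolding F'_def
  proof (rule emeasure_fresh[OF F sets_escape escape_subset])
    fix X Y :: "nat \<Rightarrow> 'd site" assume eq: "\<And>j. j \<le> n + i \<Longrightarrow> X j = Y j" and X: "X \<in> F (n + i)"
    then have "Y \<in> E" using det[of X Y] \<open>k \<le> i\<close> by (auto simp: F_def)
    moreover have "first_hit i (n + i) Y" using X eq by (auto simp: F_def first_hit_def)
    ultimately show "Y \<in> F (n + i)" by (simp add: F_def)
  next
    fix X j assume "X \<in> F (n + i)" "j < n + i"
    then show "h (X j) < h (X (n + i))" by (auto simp: F_def first_hit_def intro: less_le_trans)
  qed
  have "emeasure path_law (E \<inter> success i) = emeasure path_law (\<Union>n. F' n)"
  proof (rule emeasure_eq_AE)
    show "AE X in path_law. X \<in> E \<inter> success i \<longleftrightarrow> X \<in> (\<Union>n. F' n)"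
      using AE_steady
    proof eventually_elim
      fix X assume X: "steady X"
      show "X \<in> E \<inter> success i \<longleftrightarrow> X \<in> (\<Union>n. F' n)"
      proof
        assume "X \<in> E \<inter> success i"
        then obtain n where n: "X \<in> E" "first_hit i n X" "shift_path n X \<in> escape" by (auto simp: success_def)
        then have "i \<le> n" using first_hit_le X by blast
        then have "X \<in> F' (n - i)" using n by (auto simp: F'_def F_def)
        then show "X \<in> (\<Union>n. F' n)" by blast
      qed (auto simp: F'_def F_def success_def)
    qed
  qed (use E sets_success F' in auto)
  also have "\<dots> = (\<Sum>n. emeasure path_law (F' n))"
    using F' disj by (intro suminf_emeasure[symmetric]) auto
  also have "\<dots> = (\<Sum>n. emeasure path_law (F (n + i))) * emeasure path_law escape"
    by (simp add: eF')
  also have "(\<Sum>n. emeasure path_law (F (n + i))) = emeasure path_law (\<Union>n. F (n + i))"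
    using F disj by (intro suminf_emeasure) auto
  also have "\<dots> = emeasure path_law (E \<inter> {X. \<exists>n. real i \<le> h (X n)})"
  proof (rule emeasure_eq_AE)
    show "AE X in path_law. X \<in> (\<Union>n. F (n + i)) \<longleftrightarrow> X \<in> E \<inter> {X. \<exists>n. real i \<le> h (X n)}"
      using AE_steady
    proof eventually_elim
      fix X assume X: "steady X"
      show "X \<in> (\<Union>n. F (n + i)) \<longleftrightarrow> X \<in> E \<inter> {X. \<exists>n. real i \<le> h (X n)}"
      proof
        assume a: "X \<in> E \<inter> {X. \<exists>n. real i \<le> h (X n)}"
        then obtain n where n: "first_hit i n X" using ex_first_hit by blast
        then have "i \<le> n" using first_hit_le X by blast
        then have "X \<in> F ((n - i) + i)" using n a by (simp add: F_def)
        then show "X \<in> (\<Union>n. F (n + i))" by blast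
      qed (auto simp: F_def first_hit_def)
    qed
    show "E \<inter> {X. \<exists>n. real i \<le> h (X n)} \<in> sets path_law"
      using sets_path_ex[of "\<lambda>n X. real i \<le> h (X n)"] E by auto
  qed (use F in auto)
  finally show ?thesis
    by (simp add: path.emeasure_eq_measure ennreal_mult'[symmetric])
qed

text \<open>A mixing property: far levels become regeneration levels independently of any event
  \<open>E\<close>, given that they are reached. For events decided by a prefix it follows from
  \<open>prob_prefix_success\<close> and continuity; it extends to all measurable \<open>E\<close>
  by a Dynkin argument, where the limit and a disjoint union commute because the terms are dominated
  by \<open>path.prob (A n)\<close>.\<close>

lemma prob_success_limit:
  assumes "E \<in> sets path_space"
  shows "(\<lambda>i. path.prob (E \<inter> success i)) \<longlonglongrightarrow> path.prob (E \<inter> unbounded) * path.prob escape"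
proof -
  let ?M = "\<lambda>_::nat. count_space (UNIV :: 'd site set)"
  let ?\<Omega> = "\<Pi>\<^sub>E i\<in>UNIV. space (?M i)"
  let ?Q = "\<lambda>E. (\<lambda>i. path.prob (E \<inter> success i)) \<longlonglongrightarrow> path.prob (E \<inter> unbounded) * path.prob escape"
  have prefix: "?Q E" if E: "E \<in> sets path_space"
    and det: "\<And>X Y. (\<And>j. j \<le> k \<Longrightarrow> X j = Y j) \<Longrightarrow> X \<in> E \<Longrightarrow> Y \<in> E" for E k
  proof -
    let ?U = "\<lambda>i. E \<inter> {X. \<exists>n. real i \<le> h (X n)}"
    have U: "?U i \<in> sets path_law" for i
      using sets_path_ex[of "\<lambda>n X. real i \<le> h (X n)"] E by auto
    have "decseq ?U"
      unfolding decseq_def by (auto, meson of_nat_mono order_trans)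
    then have "(\<lambda>i. path.prob (?U i)) \<longlonglongrightarrow> path.prob (\<Inter>i. ?U i)"
      using U by (intro path.finite_Lim_measure_decseq) auto
    moreover have "(\<Inter>i. ?U i) = E \<inter> unbounded" by (auto simp: unbounded_def)
    ultimately have "(\<lambda>i. path.prob (?U i) * path.prob escape) \<longlonglongrightarrow> path.prob (E \<inter> unbounded) * path.prob escape"
      by (intro tendsto_mult_right) simp
    moreover have "eventually (\<lambda>i. path.prob (?U i) * path.prob escape = path.prob (E \<inter> success i)) sequentially"
      using eventually_ge_at_top[of k]
    proof eventually_elim
      case (elim i)
      show ?case by (rule prob_prefix_success[OF E _ elim, symmetric]) (rule det)
    qed
    ultimately show ?thesis by (rule Lim_transform_eventually)
  qed
  have full: "?Q UNIV"
    using prefix[of UNIV 0] sets.top[of path_space] by simp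
  have succ: "success i \<in> sets path_law" for i using sets_success by simp
  have unb: "unbounded \<in> sets path_law" using sets_unbounded by simp
  have "E \<in> sigma_sets ?\<Omega> (prod_algebra UNIV ?M)"
    using assms by (simp add: sets_PiM)
  then show ?thesis
  proof (induction rule: sigma_sets_induct_disjoint[OF Int_stable_prod_algebra prod_algebra_sets_into_space,
        consumes 1, case_names basic empty compl union])
    case (basic A)
    then obtain J F where A: "A = prod_emb UNIV ?M J (Pi\<^sub>E J F)" and J: "finite J"
      by (auto elim!: prod_algebraE)
    from J obtain k where k: "\<And>j. j \<in> J \<Longrightarrow> j \<le> k" by (meson finite_nat_set_iff_bounded_le)
    have "A \<in> sets path_space" using basic by (simp add: sets_PiM sigma_sets.Basic)
    then show ?case
      by (rule prefix[of A k]) (use k in \<open>auto simp: A prod_emb_def PiE_iff\<close>)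
  next
    case empty
    then show ?case by simp
  next
    case (compl A)
    have A: "A \<in> sets path_law" using compl.hyps by (simp add: sets_PiM)
    have \<Omega>: "?\<Omega> = UNIV" by auto
    have "path.prob ((?\<Omega> - A) \<inter> S) = path.prob (UNIV \<inter> S) - path.prob (A \<inter> S)"
      if "S \<in> sets path_law" for S
    proof -
      have "(?\<Omega> - A) \<inter> S = S - A \<inter> S" by auto
      then show ?thesis using that A by (simp add: path.finite_measure_Diff sets.Int)
    qed
    then show ?case
      using tendsto_diff[OF full compl.IH] succ unb by (simp add: left_diff_distrib)
  next
    case (union A)
    have A: "A n \<in> sets path_law" for n using union.hyps by (auto simp: sets_PiM)
    have sums: "(\<lambda>n. path.prob (A n \<inter> S)) sums path.prob ((\<Union>n. A n) \<inter> S)" if "S \<in> sets path_law" for S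
    proof -
      have "(\<lambda>n. path.prob (A n \<inter> S)) sums path.prob (\<Union>n. A n \<inter> S)"
        using A that union.hyps(1)
        by (intro path.finite_measure_UNION) (auto simp: disjoint_family_on_def)
      then show ?thesis by simp
    qed
    have "(\<lambda>i. \<Sum>n. path.prob (A n \<inter> success i)) \<longlonglongrightarrow> (\<Sum>n. path.prob (A n \<inter> unbounded) * path.prob escape)"
    proof (rule tannerys_theorem[THEN conjunct2, THEN conjunct2])
      show "summable (\<lambda>n. path.prob (A n))"
        using sums[of UNIV] sets.top[of path_law] by (simp add: sums_iff)
      show "\<forall>\<^sub>F (n, i) in at_top \<times>\<^sub>F sequentially. norm (path.prob (A n \<inter> success i)) \<le> path.prob (A n)"
        by (intro always_eventually) (use A in \<open>auto intro!: path.finite_measure_mono\<close>)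
    qed (use union.IH in auto)
    moreover have "(\<Sum>n. path.prob (A n \<inter> success i)) = path.prob ((\<Union>n. A n) \<inter> success i)" for i
      using sums[OF succ] by (simp add: sums_iff)
    moreover have "(\<Sum>n. path.prob (A n \<inter> unbounded) * path.prob escape)
        = path.prob ((\<Union>n. A n) \<inter> unbounded) * path.prob escape"
      using sums_unique[OF sums_mult2[OF sums[OF unb], of "path.prob escape"]] by simp
    ultimately show ?case by simp
  qed
qed

text \<open>Let \<open>E\<close> be the unbounded paths without success from level \<open>k\<close>
  on. It is disjoint from all far successes, yet by mixing it meets them with probability tending to
  \<open>path.prob E * path.prob escape\<close>. So \<open>E\<close> is null.\<close>

lemma AE_infinitely_many_successes:
  assumes "0 < path.prob escape"
  shows "AE X in path_law. X \<in> unbounded \<longrightarrow> (\<forall>k. \<exists>i\<ge>k. X \<in> success i)"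
proof -
  have "AE X in path_law. X \<in> unbounded \<longrightarrow> (\<exists>i\<ge>k. X \<in> success i)" for k
  proof -
    define E where "E = unbounded - (\<Union>i\<in>{k..}. success i)"
    have E: "E \<in> sets path_space"
      unfolding E_def by (intro sets.Diff sets_unbounded sets.countable_UN') (auto simp: sets_success)
    have "eventually (\<lambda>i. path.prob (E \<inter> success i) = 0) sequentially"
      using eventually_ge_at_top[of k]
    proof eventually_elim
      case (elim i)
      then have "E \<inter> success i = {}" by (auto simp: E_def)
      then show ?case by simp
    qed
    then have "(\<lambda>i. path.prob (E \<inter> success i)) \<longlonglongrightarrow> 0" by (rule tendsto_eventually)
    with prob_success_limit[OF E] have "path.prob (E \<inter> unbounded) * path.prob escape = 0"
      by (rule LIMSEQ_unique)
    moreover have "E \<inter> unbounded = E" by (auto simp: E_def)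
    ultimately have "path.prob E = 0" using assms by simp
    then have "AE X in path_law. X \<notin> E"
      using E by (subst AE_iff_measurable[where N=E]) (auto simp: path.emeasure_eq_measure)
    then show ?thesis by (rule AE_mp) (auto simp: E_def)
  qed
  then have "AE X in path_law. \<forall>k. X \<in> unbounded \<longrightarrow> (\<exists>i\<ge>k. X \<in> success i)"
    by (subst AE_all_countable) blast
  then show ?thesis by (rule AE_mp) auto
qed

section \<open>Regeneration times and the blocks between them\<close>

definition regen_time :: "(nat \<Rightarrow> 'd site) \<Rightarrow> nat" where
  "regen_time X = (LEAST n. 0 < n \<and> regen n X)"

definition next_regen :: "(nat \<Rightarrow> 'd site) \<Rightarrow> nat \<Rightarrow> 'd site" where
  "next_regen X = shift_path (regen_time X) X"

definition regen_step :: "(nat \<Rightarrow> 'd site) \<Rightarrow> nat \<times> 'd site" where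
  "regen_step X = (regen_time X, X (regen_time X))"

text \<open>The absolute value makes this nonnegative for all blocks, as
  \<open>AE_sums_lower_bound\<close> requires. On renewing paths it is the height gained in the
  block.\<close>

definition block_height :: "nat \<times> 'd site \<Rightarrow> real" where
  "block_height v = \<bar>h (snd v)\<bar>"

definition escape_law :: "(nat \<Rightarrow> 'd site) measure" where
  "escape_law = uniform_measure path_law escape"

text \<open>The part of "the first regeneration after time 0 is at time \<open>n\<close> and site
  \<open>x\<close>" that is decided by time \<open>n\<close>. An earlier candidate must be undercut
  by time \<open>n\<close>, because after a regeneration at \<open>n\<close> it is too late.\<close>

definition first_block :: "nat \<Rightarrow> 'd site \<Rightarrow> (nat \<Rightarrow> 'd site) set" where
  "first_block n x = {X. X n = x \<and> (\<forall>i\<le>n. 0 \<le> h (X i)) \<and> (\<forall>i<n. h (X i) < h (X n)) \<and>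
    (\<forall>m. 0 < m \<and> m < n \<longrightarrow> \<not> ((\<forall>i<m. h (X i) < h (X m)) \<and> (\<forall>i. m \<le> i \<and> i \<le> n \<longrightarrow> h (X m) \<le> h (X i))))}"

definition renewing :: "(nat \<Rightarrow> 'd site) \<Rightarrow> bool" where
  "renewing X \<longleftrightarrow> X 0 = 0 \<and> X \<in> escape \<and> (\<forall>k. \<exists>n\<ge>k. regen n X)"

lemma shift_path_unbounded: "shift_path n X \<in> unbounded \<longleftrightarrow> X \<in> unbounded"
proof
  assume a: "shift_path n X \<in> unbounded"
  show "X \<in> unbounded" unfolding unbounded_def
  proof safe
    fix k
    obtain i where "real (k + nat \<lceil>\<bar>h (X n)\<bar>\<rceil>) \<le> h (shift_path n X i)"
      using a unfolding unbounded_def by blast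
    then have "real k \<le> h (X (n + i))" by (simp add: shift_path_def h_diff) linarith
    then show "\<exists>n. real k \<le> h (X n)" ..
  qed
next
  assume a: "X \<in> unbounded"
  show "shift_path n X \<in> unbounded" unfolding unbounded_def
  proof safe
    fix k
    \<comment> \<open>\<open>B\<close> bounds all heights up to time \<open>n\<close>, so a height
      above it can only occur later, inside the shifted path.\<close>
    define B where "B = (\<Sum>i\<le>n. \<bar>h (X i)\<bar>)"
    have B: "\<bar>h (X i)\<bar> \<le> B" if "i \<le> n" for i
      unfolding B_def using that by (intro member_le_sum) auto
    obtain j where j: "real (k + nat \<lceil>2 * B\<rceil> + 1) \<le> h (X j)"
      using a unfolding unbounded_def by blast
    have B0: "0 \<le> B" by (simp add: B_def sum_nonneg)
    have "n \<le> j"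
    proof (rule ccontr)
      assume "\<not> n \<le> j"
      then have "h (X j) \<le> B" using B[of j] by simp
      then show False using j B0 by simp linarith
    qed
    then obtain i where "j = n + i" using le_Suc_ex by blast
    then have "real k \<le> h (shift_path n X i)"
      using j B[of n] B0 by (simp add: shift_path_def h_diff) linarith
    then show "\<exists>i. real k \<le> h (shift_path n X i)" ..
  qed
qed

lemma regen_alt:
  "regen n X \<longleftrightarrow> (\<forall>m<n. h (X m) < h (X n)) \<and> (\<forall>m\<ge>n. h (X n) \<le> h (X m)) \<and> X \<in> unbounded"
proof -
  have "shift_path n X \<in> stay \<longleftrightarrow> (\<forall>m\<ge>n. h (X n) \<le> h (X m))"
    by (auto simp: stay_def shift_path_def h_diff) (metis le_Suc_ex)
  then show ?thesis by (simp add: regen_def escape_def shift_path_unbounded)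
qed

lemma regen_shift:
  assumes "regen n X"
  shows "regen k (shift_path n X) \<longleftrightarrow> regen (n + k) X"
proof
  assume k: "regen k (shift_path n X)"
  have "h (X i) < h (X (n + k))" if "i < n + k" for i
  proof (cases "i < n")
    case True
    then have "h (X i) < h (X n)" using assms by (simp add: regen_alt)
    also have "\<dots> \<le> h (X (n + k))" using assms by (simp add: regen_alt)
    finally show ?thesis .
  next
    case False
    then obtain j where "i = n + j" using le_Suc_ex not_less by blast
    then show ?thesis using k that by (auto simp: regen_def shift_path_def h_diff)
  qed
  then show "regen (n + k) X" using k by (auto simp: regen_def shift_path_shift_path)
qed (auto simp: regen_def shift_path_shift_path, simp add: shift_path_def h_diff)

text \<open>After a regeneration at \<open>n\<close> the heights stay at least
  \<open>h (X n)\<close>. A candidate \<open>m < n\<close> that survives up to time \<open>n\<close>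
  therefore survives for ever, so being a regeneration can be tested for \<open>m\<close> on the
  first \<open>n\<close> steps.\<close>

lemma first_block_iff:
  assumes "0 < n"
  shows "X \<in> escape \<and> regen n X \<and> (\<forall>m. 0 < m \<and> m < n \<longrightarrow> \<not> regen m X) \<and> X n = x
    \<longleftrightarrow> X \<in> first_block n x \<and> shift_path n X \<in> escape"
proof
  assume *: "X \<in> escape \<and> regen n X \<and> (\<forall>m. 0 < m \<and> m < n \<longrightarrow> \<not> regen m X) \<and> X n = x"
  have "\<not> ((\<forall>i<m. h (X i) < h (X m)) \<and> (\<forall>i. m \<le> i \<and> i \<le> n \<longrightarrow> h (X m) \<le> h (X i)))"
    if "0 < m \<and> m < n" for m
  proof
    assume a: "(\<forall>i<m. h (X i) < h (X m)) \<and> (\<forall>i. m \<le> i \<and> i \<le> n \<longrightarrow> h (X m) \<le> h (X i))"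
    have "h (X m) \<le> h (X i)" if "m \<le> i" for i
    proof (cases "i \<le> n")
      case False
      have "h (X m) \<le> h (X n)" using a \<open>0 < m \<and> m < n\<close> by simp
      also have "regen n X" using * by blast
      then have "h (X n) \<le> h (X i)" using False by (simp add: regen_alt)
      finally show ?thesis .
    qed (use a that in auto)
    then have "regen m X" using a * by (simp add: regen_alt)
    then show False using * that by simp
  qed
  then show "X \<in> first_block n x \<and> shift_path n X \<in> escape"
    using * by (auto simp: first_block_def regen_def escape_def stay_def)
next
  assume *: "X \<in> first_block n x \<and> shift_path n X \<in> escape"
  then have n: "regen n X" unfolding regen_def first_block_def by blast
  have "0 \<le> h (X i)" for i
  proof (cases "i \<le> n")
    case False
    have "0 \<le> h (X n)" using * unfolding first_block_def by blast
    also have "\<dots> \<le> h (X i)" using n False by (simp add: regen_alt)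
    finally show ?thesis .
  qed (use * in \<open>auto simp: first_block_def\<close>)
  then have "X \<in> escape" using n by (simp add: escape_def stay_def regen_alt)
  moreover have "\<not> regen m X" if "0 < m \<and> m < n" for m
  proof
    assume "regen m X"
    then have "(\<forall>i<m. h (X i) < h (X m)) \<and> (\<forall>i. m \<le> i \<and> i \<le> n \<longrightarrow> h (X m) \<le> h (X i))"
      by (simp add: regen_alt)
    then show False using * that unfolding first_block_def by blast
  qed
  ultimately show "X \<in> escape \<and> regen n X \<and> (\<forall>m. 0 < m \<and> m < n \<longrightarrow> \<not> regen m X) \<and> X n = x"
    using n * by (auto simp: first_block_def)
qed

lemma first_block_cong:
  assumes eq: "\<And>i. i \<le> n \<Longrightarrow> X i = Y i" and X: "X \<in> first_block n x"
  shows "Y \<in> first_block n x"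
proof -
  let ?P = "\<lambda>X k. (\<forall>i<k. h (X i) < h (X k)) \<and> (\<forall>i. k \<le> i \<and> i \<le> n \<longrightarrow> h (X k) \<le> h (X i))"
  have P: "?P X k \<longleftrightarrow> ?P Y k" if "k < n" for k
    using eq that by simp
  have "\<not> ?P Y k" if "0 < k \<and> k < n" for k
  proof -
    have "\<not> ?P X k" using X that unfolding first_block_def by blast
    then show ?thesis using P[of k] that by blast
  qed
  moreover have "Y n = x" "\<forall>i\<le>n. 0 \<le> h (Y i)" "\<forall>i<n. h (Y i) < h (Y n)"
    using X eq by (auto simp: first_block_def)
  ultimately show ?thesis unfolding first_block_def by blast
qed

lemma sets_first_block: "first_block n x \<in> sets path_space"
proof -
  have "{X. X \<in> first_block n x} \<in> sets path_space"
    by (rule sets_path_prefix[of n]) (rule first_block_cong)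
  then show ?thesis by simp
qed

lemma sets_regen: "{X. regen n X} \<in> sets path_space"
proof -
  have "{X. regen n X} = {X. \<forall>m<n. h (X m) < h (X n)} \<inter> shift_path n -` escape"
    by (auto simp: regen_def)
  also have "\<dots> \<in> sets path_space"
    by (intro sets.Int sets_path_prefix[of n] sets_vimage_shift sets_escape) auto
  finally show ?thesis .
qed

lemma measurable_path_law [simp]:
  "measurable path_law M = measurable path_space M" "measurable M path_law = measurable M path_space"
  by (rule measurable_cong_sets; simp)+

lemma measurable_regen_time: "regen_time \<in> path_space \<rightarrow>\<^sub>M count_space UNIV"
  unfolding regen_time_def
proof (rule measurable_Least)
  fix n
  show "Measurable.pred path_space (\<lambda>X. 0 < n \<and> regen n X)"
    using sets_regen[of n] by (cases "n = 0") (simp_all add: Measurable.pred_def)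
qed

lemma measurable_next_regen: "next_regen \<in> path_space \<rightarrow>\<^sub>M path_space"
  unfolding next_regen_def
  by (rule measurable_compose_countable[OF measurable_shift_path measurable_regen_time])

lemma measurable_regen_step: "regen_step \<in> path_space \<rightarrow>\<^sub>M count_space UNIV"
proof -
  have "(\<lambda>X. (n, X n)) \<in> path_space \<rightarrow>\<^sub>M count_space (UNIV :: (nat \<times> 'd site) set)" for n
    by (rule measurable_compose[where f="\<lambda>X. X n" and g="\<lambda>x. (n, x)" and N="count_space UNIV"]) auto
  then show ?thesis
    unfolding regen_step_def
    by (rule measurable_compose_countable[OF _ measurable_regen_time])
qed

lemma regen_timeI:
  assumes "renewing X"
  shows "0 < regen_time X" "regen (regen_time X) X" "0 < k \<Longrightarrow> k < regen_time X \<Longrightarrow> \<not> regen k X"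
proof -
  obtain n where "Suc 0 \<le> n" "regen n X" using assms unfolding renewing_def by blast
  then have "\<exists>n. 0 < n \<and> regen n X" by (intro exI[of _ n]) simp
  then have "0 < regen_time X \<and> regen (regen_time X) X"
    unfolding regen_time_def by (rule LeastI_ex)
  then show "0 < regen_time X" "regen (regen_time X) X" by auto
  show "0 < k \<Longrightarrow> k < regen_time X \<Longrightarrow> \<not> regen k X"
    unfolding regen_time_def by (drule not_less_Least) simp
qed

lemma renewing_regen_0: "renewing X \<Longrightarrow> regen 0 X"
proof -
  assume X: "renewing X"
  then have "shift_path 0 X = X" by (simp add: renewing_def shift_path_def)
  then show "regen 0 X" using X by (simp add: regen_def renewing_def)
qed

lemma renewing_shift:
  assumes "renewing X" "regen n X"
  shows "renewing (shift_path n X)"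
proof -
  have "\<exists>m\<ge>k. regen m (shift_path n X)" for k
  proof -
    obtain m where "n + k \<le> m" "regen m X" using assms(1) unfolding renewing_def by blast
    then have "k \<le> m - n" "regen (m - n) (shift_path n X)"
      using regen_shift[OF assms(2), of "m - n"] by auto
    then show ?thesis by blast
  qed
  then show ?thesis using assms(2) by (simp add: renewing_def regen_def shift_path_def)
qed

text \<open>The time of the \<open>j\<close>-th regeneration after time 0 of a renewing path.
  Written as a sum of block durations, it is directly subject to the limit theorems for
  blocks.\<close>

definition renewal :: "(nat \<Rightarrow> 'd site) \<Rightarrow> nat \<Rightarrow> nat" where
  "renewal X j = (\<Sum>i<j. fst (regen_step ((next_regen ^^ i) X)))"

lemma renewal:
  assumes X: "renewing X"
  shows "regen (renewal X j) X"
    and "(next_regen ^^ j) X = shift_path (renewal X j) X"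
    and "(\<Sum>i<j. block_height (regen_step ((next_regen ^^ i) X))) = h (X (renewal X j))"
proof -
  have "regen (renewal X j) X \<and> (next_regen ^^ j) X = shift_path (renewal X j) X \<and>
    (\<Sum>i<j. block_height (regen_step ((next_regen ^^ i) X))) = h (X (renewal X j))"
  proof (induction j)
    case 0
    show ?case using renewing_regen_0[OF X] X
      by (simp add: renewal_def renewing_def shift_path_def)
  next
    case (Suc j)
    define n where "n = renewal X j"
    define Y where "Y = shift_path n X"
    have n: "regen n X" and it: "(next_regen ^^ j) X = Y"
      and s: "(\<Sum>i<j. block_height (regen_step ((next_regen ^^ i) X))) = h (X n)"
      using Suc by (auto simp: n_def Y_def)
    have Y: "renewing Y" unfolding Y_def by (rule renewing_shift[OF X n])
    have S: "renewal X (Suc j) = n + regen_time Y"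
      using it by (simp add: renewal_def n_def regen_step_def)
    have "regen (n + regen_time Y) X"
      using regen_timeI(2)[OF Y] regen_shift[OF n] by (simp add: Y_def)
    moreover have "(next_regen ^^ Suc j) X = shift_path (n + regen_time Y) X"
      by (simp add: it next_regen_def) (simp add: Y_def shift_path_shift_path)
    moreover have "block_height (regen_step Y) = h (X (n + regen_time Y)) - h (X n)"
    proof -
      have "0 \<le> h (Y (regen_time Y))" using Y by (simp add: renewing_def escape_def stay_def)
      then show ?thesis
        by (simp add: block_height_def regen_step_def) (simp add: Y_def shift_path_def h_diff)
    qed
    ultimately show ?case unfolding S by (simp add: it s)
  qed
  then show "regen (renewal X j) X" "(next_regen ^^ j) X = shift_path (renewal X j) X"
    "(\<Sum>i<j. block_height (regen_step ((next_regen ^^ i) X))) = h (X (renewal X j))" by auto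
qed

lemma renewal_0 [simp]: "renewal X 0 = 0"
  by (simp add: renewal_def)

lemma renewal_Suc:
  assumes "renewing X"
  shows "renewal X (Suc j) = renewal X j + regen_time (shift_path (renewal X j) X)"
  using renewal(2)[OF assms, of j] by (simp add: renewal_def regen_step_def)

lemma strict_mono_renewal:
  assumes "renewing X"
  shows "strict_mono (renewal X)"
  by (rule strict_mono_Suc_iff[THEN iffD2])
    (use renewal_Suc[OF assms] regen_timeI(1)[OF renewing_shift[OF assms renewal(1)[OF assms]]] in auto)

text \<open>No regeneration is skipped: one strictly between two consecutive renewals would
  contradict the minimality of \<open>regen_time\<close> for the path shifted to the first of
  them.\<close>

lemma regen_is_renewal:
  assumes X: "renewing X" and n: "regen n X"
  shows "\<exists>j. n = renewal X j"
proof -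
  obtain j where j: "renewal X j \<le> n" and j': "n < renewal X (Suc j)"
    using strict_mono_straddle[OF strict_mono_renewal[OF X] renewal_0] by blast
  let ?Y = "shift_path (renewal X j) X"
  have "regen (n - renewal X j) ?Y"
    using regen_shift[OF renewal(1)[OF X, of j], of "n - renewal X j"] j n by simp
  moreover have "n - renewal X j < regen_time ?Y" using j' j renewal_Suc[OF X, of j] by simp
  ultimately have "n = renewal X j"
    using regen_timeI(3)[OF renewing_shift[OF X renewal(1)[OF X]], of "n - renewal X j" j] j
    by (cases "n = renewal X j") auto
  then show ?thesis ..
qed

lemma AE_regens:
  assumes "0 < path.prob escape"
  shows "AE X in path_law. X \<in> unbounded \<longrightarrow> (\<forall>k. \<exists>n\<ge>k. real k \<le> h (X n) \<and> regen n X)"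
  using AE_infinitely_many_successes[OF assms] AE_steady
proof eventually_elim
  fix X assume *: "X \<in> unbounded \<longrightarrow> (\<forall>k. \<exists>i\<ge>k. X \<in> success i)" and X: "steady X"
  show "X \<in> unbounded \<longrightarrow> (\<forall>k. \<exists>n\<ge>k. real k \<le> h (X n) \<and> regen n X)"
  proof (intro impI allI)
    fix k assume "X \<in> unbounded"
    then obtain i where i: "k \<le> i" "X \<in> success i" using * by blast
    then obtain n where n: "first_hit i n X" "shift_path n X \<in> escape" by (auto simp: success_def)
    have "i \<le> n" using first_hit_le[OF X n(1)] .
    moreover have "regen n X"
      using n by (auto simp: regen_def first_hit_def intro: less_le_trans)
    moreover have "real k \<le> h (X n)" using n(1) i by (simp add: first_hit_def)
    ultimately show "\<exists>n\<ge>k. real k \<le> h (X n) \<and> regen n X" using i by (intro exI[of _ n]) simp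
  qed
qed

end

section \<open>Laws of large numbers under the law conditioned on escape\<close>

locale escaping_walk = stack_walk +
  assumes escape_pos: "0 < path.prob escape"
begin

lemma emeasure_escape: "emeasure path_law escape \<noteq> 0" "emeasure path_law escape \<noteq> \<infinity>"
  "emeasure path_law escape < \<infinity>"
  using escape_pos by (simp_all add: path.emeasure_eq_measure)

sublocale esc: prob_space escape_law
  unfolding escape_law_def by (rule prob_space_uniform_measure[OF emeasure_escape(1,2)])

lemma sets_escape_law [simp]: "sets escape_law = sets path_space"
  by (simp add: escape_law_def)

lemma space_escape_law [simp]: "space escape_law = UNIV"
  by (simp add: escape_law_def)

lemma measurable_escape_law [simp]:
  "measurable escape_law M = measurable path_space M" "measurable M escape_law = measurable M path_space"
  by (rule measurable_cong_sets; simp)+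

lemma prob_escape_law:
  "A \<in> sets path_space \<Longrightarrow> esc.prob A = path.prob (escape \<inter> A) / path.prob escape"
  unfolding escape_law_def using emeasure_escape by (subst measure_uniform_measure) auto

lemma AE_escape_law: "(AE X in escape_law. P X) \<longleftrightarrow> (AE X in path_law. X \<in> escape \<longrightarrow> P X)"
  unfolding escape_law_def by (rule AE_uniform_measure[OF emeasure_escape(1,3)])

lemma AE_renewing_path: "AE X in path_law. X \<in> escape \<longrightarrow> renewing X"
  using AE_regens[OF escape_pos] AE_steady
  by eventually_elim (auto simp: renewing_def steady_def escape_def)

lemma AE_renewing: "AE X in escape_law. renewing X"
  by (simp add: AE_escape_law AE_renewing_path)

lemma sets_step_next:
  assumes "B \<in> sets path_space"
  shows "{X. regen_step X = v \<and> next_regen X \<in> B} \<in> sets path_space"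
proof -
  have "regen_step -` {v} \<inter> space path_space \<in> sets path_space"
    by (rule measurable_sets[OF measurable_regen_step]) simp
  moreover have "next_regen -` B \<inter> space path_space \<in> sets path_space"
    by (rule measurable_sets[OF measurable_next_regen assms])
  ultimately have "(regen_step -` {v} \<inter> space path_space) \<inter> (next_regen -` B \<inter> space path_space) \<in> sets path_space"
    by (rule sets.Int)
  also have "(regen_step -` {v} \<inter> space path_space) \<inter> (next_regen -` B \<inter> space path_space)
      = {X. regen_step X = v \<and> next_regen X \<in> B}" by (auto simp: space_PiM)
  finally show ?thesis .
qed

text \<open>The unconditioned probability of the first block is the law of the block under
  \<open>escape_law\<close>, see \<open>prob_step\<close>. Duration 0 is excluded by hand, because
  \<open>first_block 0 0\<close> is the almost sure event that the path starts at the
  origin.\<close>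

definition block_weight :: "nat \<times> 'a site \<Rightarrow> real" where
  "block_weight = (\<lambda>(n, x). if n = 0 then 0 else path.prob (first_block n x))"

text \<open>The event consists of a first block, decided by time \<open>n\<close>, followed by a
  path in \<open>escape \<inter> B\<close>. By \<open>emeasure_fresh\<close> its probability
  factors; dividing by the probability of \<open>escape\<close> conditions only the second
  factor.\<close>

lemma prob_step_next:
  assumes B: "B \<in> sets path_space"
  shows "esc.prob {X. regen_step X = v \<and> next_regen X \<in> B} = block_weight v * esc.prob B"
proof -
  obtain n x where v: "v = (n, x)" by (cases v)
  let ?A = "{X. regen_step X = v \<and> next_regen X \<in> B}"
  note sA = sets_step_next[OF B, of v]
  have "path.prob (escape \<inter> ?A) = block_weight v * path.prob (escape \<inter> B)"
  proof (cases "n = 0")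
    case True
    have "path.prob (escape \<inter> ?A) = path.prob {}"
    proof (rule path.finite_measure_eq_AE)
      show "AE X in path_law. X \<in> escape \<inter> ?A \<longleftrightarrow> X \<in> {}"
        using AE_renewing_path
        by eventually_elim (auto simp: v True regen_step_def dest: regen_timeI(1))
    qed (use sA sets_escape in auto)
    then show ?thesis by (simp add: block_weight_def v True)
  next
    case False
    let ?C = "first_block n x \<inter> shift_path n -` (escape \<inter> B)"
    have eB: "escape \<inter> B \<in> sets path_space" using sets_escape B by auto
    have "path.prob (escape \<inter> ?A) = path.prob ?C"
    proof (rule path.finite_measure_eq_AE)
      show "AE X in path_law. X \<in> escape \<inter> ?A \<longleftrightarrow> X \<in> ?C"
        using AE_renewing_path
      proof eventually_elim
        fix X assume X: "X \<in> escape \<longrightarrow> renewing X"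
        show "X \<in> escape \<inter> ?A \<longleftrightarrow> X \<in> ?C"
        proof
          assume a: "X \<in> escape \<inter> ?A"
          then have n: "regen_time X = n" "X n = x" "shift_path n X \<in> B"
            by (auto simp: regen_step_def next_regen_def v)
          have "renewing X" using a X by simp
          from regen_timeI(2,3)[OF this] n a
          have "X \<in> escape \<and> regen n X \<and> (\<forall>m. 0 < m \<and> m < n \<longrightarrow> \<not> regen m X) \<and> X n = x" by auto
          then have "X \<in> first_block n x \<and> shift_path n X \<in> escape"
            using first_block_iff[of n X x] False by simp
          then show "X \<in> ?C" using n by simp
        next
          assume c: "X \<in> ?C"
          then have *: "X \<in> escape \<and> regen n X \<and> (\<forall>m. 0 < m \<and> m < n \<longrightarrow> \<not> regen m X) \<and> X n = x"
            using first_block_iff[of n X x] False by simp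
          have "regen_time X = n"
            unfolding regen_time_def by (rule Least_equality) (use * False not_less in auto)
          then show "X \<in> escape \<inter> ?A" using * c by (simp add: regen_step_def next_regen_def v)
        qed
      qed
      show "?C \<in> sets path_law" using sets_first_block sets_vimage_shift[OF eB] by simp
    qed (use sA sets_escape in auto)
    also have "\<dots> = path.prob (first_block n x) * path.prob (escape \<inter> B)"
    proof -
      have "emeasure path_law ?C = emeasure path_law (first_block n x) * emeasure path_law (escape \<inter> B)"
      proof (rule emeasure_fresh[OF sets_first_block eB])
        show "escape \<inter> B \<subseteq> stay" using escape_subset by blast
        show "Y \<in> first_block n x"
          if "\<And>i. i \<le> n \<Longrightarrow> X i = Y i" "X \<in> first_block n x" for X Y
          using that by (rule first_block_cong)
        show "h (X i) < h (X n)" if "X \<in> first_block n x" "i < n" for X i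
          using that unfolding first_block_def by blast
      qed
      then show ?thesis by (simp add: path.emeasure_eq_measure ennreal_mult'[symmetric])
    qed
    finally show ?thesis using False by (simp add: block_weight_def v)
  qed
  then show ?thesis by (simp add: prob_escape_law B sA)
qed

lemma prob_step: "esc.prob {X. regen_step X = v} = block_weight v"
proof -
  have "esc.prob {X. regen_step X = v \<and> next_regen X \<in> UNIV} = block_weight v * esc.prob UNIV"
    by (rule prob_step_next) (use sets.top[of path_space] in simp)
  then show ?thesis using esc.prob_space by simp
qed

text \<open>Summing \<open>prob_step_next\<close> over all blocks multiplies the probability of
  every \<open>B\<close> by the same constant \<open>?w\<close>. The choice \<open>B = UNIV\<close>
  shows that it is 1.\<close>

lemma distr_next_regen: "distr escape_law escape_law next_regen = escape_law"
proof (rule measure_eqI)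
  fix B assume "B \<in> sets (distr escape_law escape_law next_regen)"
  then have B: "B \<in> sets path_space" by simp
  let ?w = "\<integral>\<^sup>+v. ennreal (block_weight v) \<partial>count_space UNIV"
  have *: "emeasure escape_law {X. next_regen X \<in> B} = ?w * emeasure escape_law B"
    if B: "B \<in> sets path_space" for B
  proof -
    have "{X. next_regen X \<in> B} = (\<Union>v. {X. regen_step X = v \<and> next_regen X \<in> B})" by auto
    also have "emeasure escape_law \<dots> =
        (\<integral>\<^sup>+v. emeasure escape_law {X. regen_step X = v \<and> next_regen X \<in> B} \<partial>count_space UNIV)"
      by (rule emeasure_UN_countable) (use sets_step_next[OF B] in \<open>auto simp: disjoint_family_on_def\<close>)
    also have "\<dots> = (\<integral>\<^sup>+v. ennreal (block_weight v) * emeasure escape_law B \<partial>count_space UNIV)"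
      by (simp add: esc.emeasure_eq_measure prob_step_next[OF B] ennreal_mult'')
    also have "\<dots> = ?w * emeasure escape_law B" by (simp add: nn_integral_multc)
    finally show ?thesis .
  qed
  have "?w = 1"
    using *[of UNIV] sets.top[of path_space] esc.emeasure_space_1 by simp
  then have "emeasure escape_law {X. next_regen X \<in> B} = emeasure escape_law B" using *[OF B] by simp
  then show "emeasure (distr escape_law escape_law next_regen) B = emeasure escape_law B"
    using B by (subst emeasure_distr) (auto simp: measurable_next_regen vimage_def)
qed simp

lemma step_next_indep:
  assumes "J \<in> sets escape_law"
  shows "esc.prob {X \<in> space escape_law. regen_step X = v \<and> next_regen X \<in> J}
    = esc.prob {X \<in> space escape_law. regen_step X = v} * esc.prob J"
  using prob_step_next[of J v] assms by (simp add: prob_step)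

sublocale blocks: independent_blocks escape_law next_regen regen_step
proof
  show "next_regen \<in> escape_law \<rightarrow>\<^sub>M escape_law" "regen_step \<in> escape_law \<rightarrow>\<^sub>M count_space UNIV"
    by (simp_all add: measurable_next_regen measurable_regen_step)
  show "distr escape_law escape_law next_regen = escape_law" by (rule distr_next_regen)
  show "esc.prob {X \<in> space escape_law. regen_step X = v \<and> next_regen X \<in> J}
      = esc.prob {X \<in> space escape_law. regen_step X = v} * esc.prob J"
    if "J \<in> sets escape_law" for v J
    using that by (rule step_next_indep)
qed

text \<open>A successful level \<open>i\<close> is first passed at a renewal whose height lies in
  \<open>[i, i + 1)\<close>. Distinct levels thus use distinct renewals, and the linear lower bound
  on renewal heights limits how many renewals fit below height \<open>i0 + k\<close>.\<close>

lemma card_success_le: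
  assumes X: "renewing X" "steady X" and c: "0 < c"
    and low: "\<And>j. c * real j - K \<le> h (X (renewal X j))"
  shows "real (card {i. i0 \<le> i \<and> i < i0 + k \<and> X \<in> success i}) \<le> (real (i0 + k) + \<bar>K\<bar>) / c + 1"
proof -
  let ?S = "{i. i0 \<le> i \<and> i < i0 + k \<and> X \<in> success i}"
  define f where "f i = (SOME j. first_hit i (renewal X j) X)" for i
  have f: "first_hit i (renewal X (f i)) X" if i: "X \<in> success i" for i
  proof -
    obtain n where n: "first_hit i n X" "shift_path n X \<in> escape" using i by (auto simp: success_def)
    then have "regen n X" by (auto simp: regen_def first_hit_def intro: less_le_trans)
    with n(1) have "\<exists>j. first_hit i (renewal X j) X" using regen_is_renewal[OF X(1)] by blast
    then show ?thesis unfolding f_def by (rule someI_ex)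
  qed
  have lev: "real i \<le> h (X (renewal X (f i)))" "h (X (renewal X (f i))) < real i + 1" if "X \<in> success i" for i
    using f[OF that] first_hit_less[OF X(2) f[OF that]] by (auto simp: first_hit_def)
  have "inj_on f ?S"
  proof (rule inj_onI)
    fix i i' assume "i \<in> ?S" "i' \<in> ?S" "f i = f i'"
    then have "real i < real i' + 1" "real i' < real i + 1" using lev[of i] lev[of i'] by auto
    then show "i = i'" by linarith
  qed
  moreover have "f ` ?S \<subseteq> {..<nat \<lceil>(real (i0 + k) + \<bar>K\<bar>) / c\<rceil>}"
  proof safe
    fix i assume i: "i < i0 + k" "X \<in> success i"
    have "c * real (f i) < real i + 1 + K" using lev(2)[OF i(2)] low[of "f i"] by linarith
    also have "\<dots> \<le> real (i0 + k) + \<bar>K\<bar>" using i(1) by linarith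
    finally have "real (f i) < (real (i0 + k) + \<bar>K\<bar>) / c" using c by (simp add: field_simps)
    then show "f i < nat \<lceil>(real (i0 + k) + \<bar>K\<bar>) / c\<rceil>" by linarith
  qed
  ultimately have "card ?S \<le> nat \<lceil>(real (i0 + k) + \<bar>K\<bar>) / c\<rceil>"
    using card_inj_on_le[of f ?S "{..<nat \<lceil>(real (i0 + k) + \<bar>K\<bar>) / c\<rceil>}"] by simp
  moreover have "0 \<le> (real (i0 + k) + \<bar>K\<bar>) / c" using c by simp
  ultimately show ?thesis by linarith
qed

text \<open>
  If the mean height of a block were infinite, regenerations at integer levels would have density 0.
  But a level is a regeneration level with probability tending to that of escape.
\<close>

lemma integrable_block_height: "integrable escape_law (\<lambda>X. block_height (regen_step X))"
proof (rule ccontr)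
  assume ni: "\<not> integrable escape_law (\<lambda>X. block_height (regen_step X))"
  define \<delta> where "\<delta> = path.prob escape"
  have \<delta>: "0 < \<delta>" using escape_pos by (simp add: \<delta>_def)
  have s: "success i \<in> sets path_space" for i by (rule sets_success)
  have "(\<lambda>i. path.prob (escape \<inter> success i) / \<delta>) \<longlonglongrightarrow> path.prob (escape \<inter> unbounded) * \<delta> / \<delta>"
    unfolding \<delta>_def by (intro tendsto_divide prob_success_limit sets_escape tendsto_const) (use escape_pos in auto)
  moreover have "escape \<inter> unbounded = escape" by (auto simp: escape_def)
  ultimately have "(\<lambda>i. esc.prob (success i)) \<longlonglongrightarrow> \<delta>"
    using \<delta> by (simp add: prob_escape_law s) (simp add: \<delta>_def)
  from order_tendstoD(1)[OF this, of "9 / 10 * \<delta>"] obtain i0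
    where i0: "\<And>i. i0 \<le> i \<Longrightarrow> 9 / 10 * \<delta> < esc.prob (success i)"
    using \<delta> by (auto simp: eventually_sequentially)
  \<comment> \<open>The density of successful levels in a window that starts where the probability
    of success is already close to its limit \<open>\<delta>\<close>.\<close>
  define f where "f k X = (\<Sum>i=i0..<i0 + Suc k. indicator (success i) X) / real (Suc k)" for k X
  have fm [measurable]: "f k \<in> borel_measurable escape_law" for k
    unfolding f_def using s by (auto intro!: borel_measurable_divide borel_measurable_sum)
  have f01: "0 \<le> f k X" "f k X \<le> 1" for k X
  proof -
    have "(\<Sum>i=i0..<i0 + Suc k. indicator (success i) X :: real) \<le> (\<Sum>i=i0..<i0 + Suc k. 1)"
      by (rule sum_mono) (simp add: indicator_def)
    then show "f k X \<le> 1" by (simp add: f_def)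
    show "0 \<le> f k X" by (simp add: f_def sum_nonneg)
  qed
  have fi: "integrable escape_law (f k)" for k
    by (rule esc.integrable_const_bound[where B=1]) (use f01 fm in \<open>auto simp: abs_of_nonneg\<close>)
  have Ef: "9 / 10 * \<delta> \<le> esc.expectation (f k)" for k
  proof -
    have "esc.expectation (f k) = (\<Sum>i=i0..<i0 + Suc k. esc.prob (success i)) / real (Suc k)"
      unfolding f_def using s by (simp add: esc.emeasure_eq_measure del: sum.op_ivl_Suc)
    moreover have "(\<Sum>i=i0..<i0 + Suc k. 9 / 10 * \<delta>) \<le> (\<Sum>i=i0..<i0 + Suc k. esc.prob (success i))"
      by (rule sum_mono) (use i0 less_imp_le in auto)
    then have "9 / 10 * \<delta> * real (Suc k) \<le> (\<Sum>i=i0..<i0 + Suc k. esc.prob (success i))"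
      by (simp only: sum_constant card_atLeastLessThan add_diff_cancel_left' mult.commute)
    then have "9 / 10 * \<delta> \<le> (\<Sum>i=i0..<i0 + Suc k. esc.prob (success i)) / real (Suc k)"
      by (subst pos_le_divide_eq) simp_all
    ultimately show ?thesis by simp
  qed
  \<comment> \<open>With infinite mean height the renewal heights outgrow any rate. The rate
    \<open>2 / \<delta>\<close> limits the density of successful levels to
    \<open>\<delta> / 2\<close>, well below the \<open>9 / 10 * \<delta>\<close> forced on its
    mean.\<close>
  have "AE X in escape_law. \<exists>K. \<forall>n. (2 / \<delta>) * real n - K \<le> (\<Sum>i<n. block_height (regen_step ((next_regen ^^ i) X)))"
    by (rule blocks.AE_sums_lower_bound[where g=block_height]) (use ni in \<open>auto simp: block_height_def\<close>)
  moreover have "AE X in escape_law. steady X"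
    using AE_steady by (auto simp: AE_escape_law)
  ultimately have ev: "AE X in escape_law. eventually (\<lambda>k. f k X \<le> 3 / 4 * \<delta>) sequentially"
    using AE_renewing
  proof eventually_elim
    fix X assume X: "renewing X" "steady X"
      and "\<exists>K. \<forall>n. (2 / \<delta>) * real n - K \<le> (\<Sum>i<n. block_height (regen_step ((next_regen ^^ i) X)))"
    then obtain K where K: "\<And>n. (2 / \<delta>) * real n - K \<le> h (X (renewal X n))"
      by (auto simp: renewal(3)[OF X(1)])
    define D where "D = (real i0 + \<bar>K\<bar>) * \<delta> / 2 + 1"
    have fk: "f k X \<le> \<delta> / 2 + D / real (Suc k)" for k
    proof -
      let ?S = "{i. i0 \<le> i \<and> i < i0 + Suc k \<and> X \<in> success i}"
      have "(\<Sum>i=i0..<i0 + Suc k. indicator (success i) X :: real) = real (card ?S)"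
      proof -
        have "(\<Sum>i=i0..<i0 + Suc k. indicator (success i) X :: real)
            = (\<Sum>i=i0..<i0 + Suc k. of_bool (X \<in> success i))"
          by (rule sum.cong) (simp_all add: indicator_def)
        also have "\<dots> = real (card ({i0..<i0 + Suc k} \<inter> {i. X \<in> success i}))"
          by (rule sum_of_bool_eq; simp)
        also have "{i0..<i0 + Suc k} \<inter> {i. X \<in> success i} = ?S" by auto
        finally show ?thesis .
      qed
      also have "\<dots> \<le> (real (i0 + Suc k) + \<bar>K\<bar>) / (2 / \<delta>) + 1"
        by (rule card_success_le[OF X _ K]) (use \<delta> in simp)
      also have "\<dots> = \<delta> / 2 * real (Suc k) + D"
        using \<delta> by (simp add: D_def field_simps)
      finally have "f k X \<le> (\<delta> / 2 * real (Suc k) + D) / real (Suc k)"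
        unfolding f_def by (rule divide_right_mono) simp
      also have "\<dots> = \<delta> / 2 + D / real (Suc k)"
        by (subst add_divide_distrib) (simp del: of_nat_Suc)
      finally show ?thesis .
    qed
    have "(\<lambda>k. \<delta> / 2 + D / real (Suc k)) \<longlonglongrightarrow> \<delta> / 2 + 0"
      by (intro tendsto_add tendsto_const LIMSEQ_Suc[OF lim_const_over_n])
    then have "eventually (\<lambda>k. \<delta> / 2 + D / real (Suc k) < 3 / 4 * \<delta>) sequentially"
      by (rule order_tendstoD(2)) (use \<delta> in simp)
    then show "eventually (\<lambda>k. f k X \<le> 3 / 4 * \<delta>) sequentially"
      by (rule eventually_mono) (rule order_trans[OF fk less_imp_le])
  qed
  \<comment> \<open>Taking the maximum with \<open>3 / 4 * \<delta>\<close> turns the eventual upper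
    bound into convergence to a constant, so that dominated convergence applies and contradicts
    \<open>Ef\<close>.\<close>
  have "(\<lambda>k. \<integral>X. max (f k X) (3 / 4 * \<delta>) \<partial>escape_law) \<longlonglongrightarrow> (\<integral>X. 3 / 4 * \<delta> \<partial>escape_law)"
  proof (rule integral_dominated_convergence[where w="\<lambda>_. 1 + \<delta>"])
    show "AE X in escape_law. (\<lambda>k. max (f k X) (3 / 4 * \<delta>)) \<longlonglongrightarrow> 3 / 4 * \<delta>"
      using ev
    proof eventually_elim
      fix X assume "eventually (\<lambda>k. f k X \<le> 3 / 4 * \<delta>) sequentially"
      then have "eventually (\<lambda>k. max (f k X) (3 / 4 * \<delta>) = 3 / 4 * \<delta>) sequentially"
        by (rule eventually_mono) (simp add: max_def)
      then show "(\<lambda>k. max (f k X) (3 / 4 * \<delta>)) \<longlonglongrightarrow> 3 / 4 * \<delta>" by (rule tendsto_eventually)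
    qed
    show "AE X in escape_law. norm (max (f k X) (3 / 4 * \<delta>)) \<le> 1 + \<delta>" for k
    proof (rule AE_I2)
      fix X show "norm (max (f k X) (3 / 4 * \<delta>)) \<le> 1 + \<delta>"
        using f01(1)[of k X] f01(2)[of k X] \<delta> by (auto simp: max_def)
    qed
  qed (use fm in \<open>auto intro!: borel_measurable_max\<close>)
  moreover have "9 / 10 * \<delta> \<le> (\<integral>X. max (f k X) (3 / 4 * \<delta>) \<partial>escape_law)" for k
    using Ef[of k] by (rule order_trans) (intro integral_mono integrable_max fi, auto)
  ultimately have "9 / 10 * \<delta> \<le> (\<integral>X. 3 / 4 * \<delta> \<partial>escape_law)"
    by (intro LIMSEQ_le_const) auto
  then show False using \<delta> esc.prob_space by simp
qed

text \<open>\<open>b\<close> is the reciprocal of the mean duration of a block, read as 0 if the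
  mean is infinite; in that case \<open>renewal X n\<close> outgrows every multiple of
  \<open>n\<close>.\<close>

lemma AE_renewal_rate:
  "\<exists>b. AE X in escape_law. (\<lambda>j. real j / real (renewal X j)) \<longlonglongrightarrow> b"
proof (cases "integrable escape_law (\<lambda>X. real (fst (regen_step X)))")
  case True
  let ?a = "esc.expectation (\<lambda>X. real (fst (regen_step X)))"
  have "AE X in escape_law. (\<lambda>n. (\<Sum>i<n. real (fst (regen_step ((next_regen ^^ i) X)))) / real n) \<longlonglongrightarrow> ?a"
    by (rule blocks.AE_sums_average[where g="\<lambda>v. real (fst v)"]) (use True in auto)
  then have "AE X in escape_law. (\<lambda>j. real j / real (renewal X j)) \<longlonglongrightarrow> inverse ?a"
    using AE_renewing
  proof eventually_elim
    fix X assume "(\<lambda>n. (\<Sum>i<n. real (fst (regen_step ((next_regen ^^ i) X)))) / real n) \<longlonglongrightarrow> ?a"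
      and X: "renewing X"
    then have lim: "(\<lambda>n. real (renewal X n) / real n) \<longlonglongrightarrow> ?a" by (simp add: renewal_def)
    \<comment> \<open>Renewal times increase strictly, so the mean duration is at least 1 and its
      inverse is a limit.\<close>
    have "1 \<le> real (renewal X n) / real n" if "1 \<le> n" for n
      using strict_mono_imp_increasing[OF strict_mono_renewal[OF X], of n] that by (simp add: field_simps)
    then have "1 \<le> ?a" using lim by (intro LIMSEQ_le_const[OF lim]) blast
    then have "(\<lambda>n. inverse (real (renewal X n) / real n)) \<longlonglongrightarrow> inverse ?a"
      by (intro tendsto_inverse lim) auto
    then show "(\<lambda>j. real j / real (renewal X j)) \<longlonglongrightarrow> inverse ?a" by simp
  qed
  then show ?thesis ..
next
  case False
  have "AE X in escape_law. \<forall>c::nat. \<exists>K. \<forall>n. real c * real n - K \<le> (\<Sum>i<n. real (fst (regen_step ((next_regen ^^ i) X))))"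
    unfolding AE_all_countable
    by (intro allI blocks.AE_sums_lower_bound[where g="\<lambda>v. real (fst v)"]) (use False in auto)
  then have "AE X in escape_law. (\<lambda>j. real j / real (renewal X j)) \<longlonglongrightarrow> 0"
  proof eventually_elim
    fix X assume *: "\<forall>c::nat. \<exists>K. \<forall>n. real c * real n - K \<le> (\<Sum>i<n. real (fst (regen_step ((next_regen ^^ i) X))))"
    show "(\<lambda>j. real j / real (renewal X j)) \<longlonglongrightarrow> 0"
    proof (rule LIMSEQ_I)
      fix r :: real assume "0 < r"
      define c where "c = nat \<lceil>2 / r\<rceil> + 1"
      have "2 / r < real c" unfolding c_def by linarith
      then have c: "2 < r * real c" using \<open>0 < r\<close> by (simp add: field_simps)
      from * obtain K where K: "\<And>n. real c * real n - K \<le> real (renewal X n)"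
        unfolding renewal_def of_nat_sum by blast
      show "\<exists>N. \<forall>n\<ge>N. norm (real n / real (renewal X n) - 0) < r"
      proof (intro exI allI impI)
        fix n assume n: "nat \<lceil>r * \<bar>K\<bar>\<rceil> + 1 \<le> n"
        then have n': "r * \<bar>K\<bar> < real n" by linarith
        have "2 * real n < r * real c * real n" using c n by simp
        also have "\<dots> = r * (real c * real n - K) + r * K" by (simp add: algebra_simps)
        also have "\<dots> \<le> r * real (renewal X n) + r * \<bar>K\<bar>"
          using K[of n] \<open>0 < r\<close> by (intro add_mono mult_left_mono) auto
        finally have *: "real n < r * real (renewal X n)" using n' by linarith
        then have "0 < r * real (renewal X n)" using n by linarith
        then have "0 < real (renewal X n)" using \<open>0 < r\<close> by (simp add: zero_less_mult_iff)
        with * show "norm (real n / real (renewal X n) - 0) < r" by (simp add: field_simps)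
      qed
    qed
  qed
  then show ?thesis ..
qed

lemma AE_speed_escape_law: "\<exists>v. AE X in escape_law. (\<lambda>n. h (X n) / real n) \<longlonglongrightarrow> v"
proof -
  let ?w = "esc.expectation (\<lambda>X. block_height (regen_step X))"
  obtain b where b: "AE X in escape_law. (\<lambda>j. real j / real (renewal X j)) \<longlonglongrightarrow> b"
    using AE_renewal_rate by blast
  have "AE X in escape_law. (\<lambda>n. (\<Sum>i<n. block_height (regen_step ((next_regen ^^ i) X))) / real n) \<longlonglongrightarrow> ?w"
    by (rule blocks.AE_sums_average[where g=block_height]) (use integrable_block_height in auto)
  then have "AE X in escape_law. (\<lambda>n. h (X n) / real n) \<longlonglongrightarrow> ?w * b"
    using b AE_renewing
  proof eventually_elim
    fix X assume X: "renewing X" and b: "(\<lambda>j. real j / real (renewal X j)) \<longlonglongrightarrow> b"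
      and "(\<lambda>n. (\<Sum>i<n. block_height (regen_step ((next_regen ^^ i) X))) / real n) \<longlonglongrightarrow> ?w"
    then have w: "(\<lambda>n. h (X (renewal X n)) / real n) \<longlonglongrightarrow> ?w" by (simp add: renewal(3)[OF X])
    show "(\<lambda>n. h (X n) / real n) \<longlonglongrightarrow> ?w * b"
    proof (rule renewal_sandwich[OF strict_mono_renewal[OF X] renewal_0 _ _ b w])
      show "0 \<le> h (X n)" for n using X by (simp add: renewing_def escape_def stay_def)
      fix j n assume "renewal X j \<le> n" "n \<le> renewal X (Suc j)"
      then show "h (X (renewal X j)) \<le> h (X n) \<and> h (X n) \<le> h (X (renewal X (Suc j)))"
        using renewal(1)[OF X, of j] renewal(1)[OF X, of "Suc j"]
        by (auto simp: regen_alt le_less)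
    qed
  qed
  then show ?thesis ..
qed

text \<open>The speed found under \<open>escape_law\<close> is carried to all unbounded paths. The
  escaping paths with another behaviour form a null set, and by \<open>emeasure_fresh\<close> it
  stays null when seen from any record time. An unbounded path has a regeneration, after which it is
  an escaping path; the finite part before it does not affect the limit. Regenerations at arbitrary
  heights force \<open>h (X n)\<close> to tend to infinity.\<close>

lemma AE_speed_unbounded:
  "\<exists>v. AE X in path_law. X \<in> unbounded \<longrightarrow>
    (\<lambda>n. h (X n) / real n) \<longlonglongrightarrow> v \<and> filterlim (\<lambda>n. h (X n)) at_top sequentially"
proof -
  obtain v where "AE X in escape_law. (\<lambda>n. h (X n) / real n) \<longlonglongrightarrow> v"
    using AE_speed_escape_law ..
  then have "AE X in path_law. X \<in> escape \<longrightarrow> (\<lambda>n. h (X n) / real n) \<longlonglongrightarrow> v"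
    by (rule AE_escape_law[THEN iffD1])
  then obtain Z where Z0: "{X \<in> space path_law. \<not> (X \<in> escape \<longrightarrow> (\<lambda>n. h (X n) / real n) \<longlonglongrightarrow> v)} \<subseteq> Z"
    and Z: "emeasure path_law Z = 0" "Z \<in> sets path_law" by (rule AE_E)
  have Zv: "(\<lambda>n. h (X n) / real n) \<longlonglongrightarrow> v" if "X \<notin> Z" "X \<in> escape" for X
    using subsetD[OF Z0, of X] that by (simp only: mem_Collect_eq space_path_law UNIV_I) blast
  \<comment> \<open>The null set is cut down to \<open>escape\<close> so that it lies in
    \<open>stay\<close>, as \<open>emeasure_fresh\<close> requires.\<close>
  have Ze: "Z \<inter> escape \<in> sets path_space" using Z(2) sets_escape by (simp add: sets.Int)
  have Ze0: "emeasure path_law (Z \<inter> escape) = 0"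
    by (rule emeasure_eq_0[OF Z(2,1)]) (rule Int_lower1)
  have "AE X in path_law. \<not> ((\<forall>m<n. h (X m) < h (X n)) \<and> shift_path n X \<in> Z \<inter> escape)" for n
  proof -
    let ?F = "{X. \<forall>m<n. h (X m) < h (X n)}"
    let ?E = "?F \<inter> shift_path n -` (Z \<inter> escape)"
    have F: "?F \<in> sets path_space" by (rule sets_path_prefix[of n]) auto
    have "emeasure path_law ?E = emeasure path_law ?F * emeasure path_law (Z \<inter> escape)"
    proof (rule emeasure_fresh[OF F Ze])
      show "Z \<inter> escape \<subseteq> stay" using escape_subset by blast
      show "Y \<in> ?F" if "\<And>i. i \<le> n \<Longrightarrow> X i = Y i" "X \<in> ?F" for X Y
        using that by simp
      show "h (X i) < h (X n)" if "X \<in> ?F" "i < n" for X i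
        using that by simp
    qed
    also have "\<dots> = 0" unfolding Ze0 by (rule mult_zero_right)
    finally have "emeasure path_law ?E = 0" .
    moreover have "?E \<in> sets path_law"
      unfolding sets_path_law by (rule sets.Int[OF F sets_vimage_shift[OF Ze]])
    ultimately have "AE X in path_law. X \<notin> ?E"
      by (rule AE_not_in[OF null_setsI])
    then show ?thesis by (rule AE_mp) (intro AE_I2 impI, simp)
  qed
  then have "AE X in path_law. \<forall>n. \<not> ((\<forall>m<n. h (X m) < h (X n)) \<and> shift_path n X \<in> Z \<inter> escape)"
    unfolding AE_all_countable ..
  then have "AE X in path_law. X \<in> unbounded \<longrightarrow>
    (\<lambda>n. h (X n) / real n) \<longlonglongrightarrow> v \<and> filterlim (\<lambda>n. h (X n)) at_top sequentially"
    using AE_regens[OF escape_pos]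
  proof eventually_elim
    fix X assume *: "\<forall>n. \<not> ((\<forall>m<n. h (X m) < h (X n)) \<and> shift_path n X \<in> Z \<inter> escape)"
      and r: "X \<in> unbounded \<longrightarrow> (\<forall>k. \<exists>n\<ge>k. real k \<le> h (X n) \<and> regen n X)"
    show "X \<in> unbounded \<longrightarrow>
      (\<lambda>n. h (X n) / real n) \<longlonglongrightarrow> v \<and> filterlim (\<lambda>n. h (X n)) at_top sequentially"
    proof (intro impI conjI)
      assume "X \<in> unbounded"
      with r have r: "\<exists>n\<ge>k. real k \<le> h (X n) \<and> regen n X" for k by blast
      obtain n where n: "regen n X" using r[of 0] by blast
      then have "shift_path n X \<in> escape" "shift_path n X \<notin> Z" using * by (auto simp: regen_def)
      then have lim: "(\<lambda>i. h (shift_path n X i) / real i) \<longlonglongrightarrow> v" by (intro Zv)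
      have "(\<lambda>i. (h (shift_path n X i) / real i + h (X n) / real i) * (real i / real (i + n))) \<longlonglongrightarrow> (v + 0) * 1"
      proof (intro tendsto_mult tendsto_add lim lim_const_over_n)
        have "(\<lambda>i. 1 / (1 + real n / real i)) \<longlonglongrightarrow> 1 / (1 + 0)"
          by (intro tendsto_intros lim_const_over_n) simp
        moreover have "eventually (\<lambda>i. 1 / (1 + real n / real i) = real i / real (i + n)) sequentially"
          using eventually_gt_at_top[of 0] by eventually_elim (simp add: divide_simps)
        ultimately have "(\<lambda>i. real i / real (i + n)) \<longlonglongrightarrow> 1 / (1 + 0)" by (rule Lim_transform_eventually)
        then show "(\<lambda>i. real i / real (i + n)) \<longlonglongrightarrow> 1" by simp
      qed
      moreover have "eventually (\<lambda>i. (h (shift_path n X i) / real i + h (X n) / real i) * (real i / real (i + n))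
          = h (X (i + n)) / real (i + n)) sequentially"
        using eventually_gt_at_top[of 0]
      proof eventually_elim
        case (elim i)
        have "h (shift_path n X i) / real i + h (X n) / real i = h (X (i + n)) / real i"
          by (simp add: shift_path_def h_diff add_divide_distrib[symmetric] add.commute)
        then have "(h (shift_path n X i) / real i + h (X n) / real i) * (real i / real (i + n))
            = h (X (i + n)) / real i * (real i / real (i + n))" by (simp only:)
        also have "\<dots> = h (X (i + n)) / real (i + n)" using elim by simp
        finally show ?case .
      qed
      ultimately have "(\<lambda>i. h (X (i + n)) / real (i + n)) \<longlonglongrightarrow> (v + 0) * 1"
        by (rule Lim_transform_eventually)
      then have "(\<lambda>i. h (X (i + n)) / real (i + n)) \<longlonglongrightarrow> v" by simp
      then show "(\<lambda>n. h (X n) / real n) \<longlonglongrightarrow> v" 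
        by (rule LIMSEQ_offset[where f="\<lambda>n. h (X n) / real n" and k=n])
      show "filterlim (\<lambda>n. h (X n)) at_top sequentially"
        unfolding filterlim_at_top
      proof
        fix Z :: real
        obtain n where n: "real (nat \<lceil>Z\<rceil>) \<le> h (X n)" "regen n X" using r by blast
        have "Z \<le> h (X m)" if "n \<le> m" for m
        proof -
          have "Z \<le> h (X n)" using n(1) by linarith
          also have "\<dots> \<le> h (X m)" using n(2) that by (simp add: regen_alt)
          finally show ?thesis .
        qed
        then show "eventually (\<lambda>n. Z \<le> h (X n)) sequentially" unfolding eventually_sequentially by blast
      qed
    qed
  qed
  then show ?thesis ..
qed

end

section \<open>Stacks generated by the environment\<close>

text \<open>Step \<open>i\<close> reads the entry whose index is the number of earlier visits to the
  current site. Along a prescribed path these indices are known, so a cylinder event prescribes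
  fixed entries of the stacks.\<close>

lemma walk_follows_iff:
  "(\<forall>i\<le>n. walk 0 \<xi> i = x i) \<longleftrightarrow> x 0 = 0 \<and>
    (\<forall>i<n. unit_step (\<xi> (x i) (card {j. j < i \<and> x j = x i})) = x (Suc i) - x i)"
proof (induction n)
  case (Suc n)
  have "(\<forall>i\<le>Suc n. walk 0 \<xi> i = x i) \<longleftrightarrow> (\<forall>i\<le>n. walk 0 \<xi> i = x i) \<and> walk 0 \<xi> (Suc n) = x (Suc n)"
    by (auto simp: le_Suc_eq)
  also have "\<dots> \<longleftrightarrow> (\<forall>i\<le>n. walk 0 \<xi> i = x i) \<and>
      unit_step (\<xi> (x n) (card {j. j < n \<and> x j = x n})) = x (Suc n) - x n"
  proof (intro conj_cong refl)
    assume eq: "\<forall>i\<le>n. walk 0 \<xi> i = x i"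
    have "{j. j < n \<and> walk 0 \<xi> j = x n} = {j. j < n \<and> x j = x n}" using eq by auto
    then show "walk 0 \<xi> (Suc n) = x (Suc n) \<longleftrightarrow>
        unit_step (\<xi> (x n) (card {j. j < n \<and> x j = x n})) = x (Suc n) - x n"
      using eq by (auto simp: walk_Suc rest_eq algebra_simps)
  qed
  finally show ?case unfolding Suc.IH by (auto simp: less_Suc_eq)
qed auto

text \<open>An event on finitely many coordinates is a countable disjoint union of cylinders that
  fix a whole prefix.\<close>

lemma measure_eqI_cylinders:
  fixes M N :: "(nat \<Rightarrow> ('d::finite) site) measure"
  assumes "finite_measure M" and M: "sets M = sets path_space" and N: "sets N = sets path_space"
    and eq: "\<And>n x. emeasure M {X. \<forall>i\<le>n. X i = x i} = emeasure N {X. \<forall>i\<le>n. X i = x i}"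
  shows "M = N"
proof (rule measure_eqI_PiM_infinite[OF M N])
  fix J :: "nat set" and F assume J: "finite J"
  define A where "A = prod_emb UNIV (\<lambda>_::nat. count_space (UNIV :: 'd site set)) J (Pi\<^sub>E J F)"
  obtain n where n: "\<And>j. j \<in> J \<Longrightarrow> j \<le> n" using J by (meson finite_nat_set_iff_bounded_le)
  define B where "B = (\<lambda>X. restrict X {..n}) ` A"
  define C where "C \<beta> = {X. \<forall>i\<le>n. X i = (\<beta> i :: 'd site)}" for \<beta>
  have sub: "B \<subseteq> {..n} \<rightarrow>\<^sub>E UNIV"
    unfolding B_def by (rule image_subsetI) (rule restrict_PiE_iff[THEN iffD2], simp)
  have cB: "countable B"
    by (rule countable_subset[OF sub]) (intro countable_PiE, auto)
  have C: "C \<beta> \<in> sets path_space" for \<beta>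
    unfolding C_def by (rule sets_path_prefix[of n]) auto
  have "A = (\<Union>\<beta>\<in>B. C \<beta>)"
  proof
    show "A \<subseteq> (\<Union>\<beta>\<in>B. C \<beta>)" by (auto simp: B_def C_def)
    show "(\<Union>\<beta>\<in>B. C \<beta>) \<subseteq> A" using n by (auto simp: B_def C_def A_def prod_emb_def PiE_iff)
  qed
  moreover have "disjoint_family_on C B"
    unfolding disjoint_family_on_def
  proof (intro ballI impI)
    fix \<beta> \<beta>' assume *: "\<beta> \<in> B" "\<beta>' \<in> B" "\<beta> \<noteq> \<beta>'"
    have "\<beta> = \<beta>'" if "X \<in> C \<beta>" "X \<in> C \<beta>'" for X
    proof (rule PiE_ext)
      show "\<beta> \<in> {..n} \<rightarrow>\<^sub>E UNIV" "\<beta>' \<in> {..n} \<rightarrow>\<^sub>E UNIV" using * sub by auto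
      show "\<beta> i = \<beta>' i" if "i \<in> {..n}" for i
        using that \<open>X \<in> C \<beta>\<close> \<open>X \<in> C \<beta>'\<close> by (auto simp: C_def)
    qed
    then show "C \<beta> \<inter> C \<beta>' = {}" using *(3) by blast
  qed
  ultimately have "emeasure L A = (\<integral>\<^sup>+\<beta>. emeasure L (C \<beta>) \<partial>count_space B)" if "sets L = sets path_space" for L
    using cB C that by (simp add: emeasure_UN_countable)
  then show "emeasure M (prod_emb UNIV (\<lambda>_. count_space UNIV) J (Pi\<^sub>E J F))
      = emeasure N (prod_emb UNIV (\<lambda>_. count_space UNIV) J (Pi\<^sub>E J F))"
    using M N eq by (simp add: A_def[symmetric] C_def)
qed (rule assms(1))

text \<open>Moves a step law from the unit steps to the space of all sites, so that the stacks live
  in a product over \<open>UNIV\<close>.\<close>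

definition step_dist :: "('d::finite) site measure \<Rightarrow> 'd site measure" where
  "step_dist p = distr p (count_space UNIV) (\<lambda>e. e)"

definition stack_dist :: "('d::finite) site measure \<Rightarrow> (nat \<Rightarrow> 'd site) measure" where
  "stack_dist p = PiM UNIV (\<lambda>_. step_dist p)"

definition stack_law :: "('d::finite) site measure measure \<Rightarrow> (nat \<Rightarrow> 'd site) measure" where
  "stack_law \<mu> = \<mu> \<bind> stack_dist"

lemma
  fixes p :: "('d::finite) site measure"
  assumes p: "p \<in> space step_laws"
  shows prob_space_step_dist: "prob_space (step_dist p)"
    and emeasure_step_dist: "emeasure (step_dist p) A = emeasure p (A \<inter> unit_steps)"
proof -
  have s: "sets p = sets (count_space unit_steps)" and "prob_space p"
    using p by (auto simp: step_laws_def space_prob_algebra)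
  have sp: "space p = unit_steps" using sets_eq_imp_space_eq[OF s] by simp
  have m: "(\<lambda>e. e) \<in> p \<rightarrow>\<^sub>M count_space UNIV"
    by (simp add: measurable_cong_sets[OF s refl])
  show "prob_space (step_dist p)"
    unfolding step_dist_def by (rule prob_space.prob_space_distr) fact+
  show "emeasure (step_dist p) A = emeasure p (A \<inter> unit_steps)"
    unfolding step_dist_def by (subst emeasure_distr[OF m]) (simp_all add: sp)
qed

lemma sets_step_dist [simp]: "sets (step_dist p) = UNIV" "space (step_dist p) = UNIV"
  by (simp_all add: step_dist_def)

lemma sets_stack_dist: "sets (stack_dist p) = sets stack_space"
  unfolding stack_dist_def by (intro sets_PiM_cong) auto

lemma prob_space_stack_dist: "p \<in> space step_laws \<Longrightarrow> prob_space (stack_dist p)"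
  unfolding stack_dist_def by (intro prob_space_PiM prob_space_step_dist)

lemma emeasure_stack_dist:
  assumes "p \<in> space step_laws" "finite J"
  shows "emeasure (stack_dist p) {s. \<forall>j\<in>J. s j \<in> F j} = (\<Prod>j\<in>J. emeasure p (F j \<inter> unit_steps))"
proof -
  have "{s. \<forall>j\<in>J. s j \<in> F j} = prod_emb UNIV (\<lambda>_. step_dist p) J (Pi\<^sub>E J F)"
    by (auto simp: prod_emb_def PiE_iff)
  then show ?thesis
    unfolding stack_dist_def using assms
    by (simp add: emeasure_PiM_emb prob_space_step_dist emeasure_step_dist)
qed

lemma measurable_emeasure_step_laws:
  assumes "A \<subseteq> unit_steps"
  shows "(\<lambda>p. emeasure p A) \<in> borel_measurable (step_laws :: ('d::finite) site measure measure)"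
proof -
  have "(\<lambda>p. emeasure p A) \<in> borel_measurable (subprob_algebra (count_space unit_steps))"
    using assms by (intro measurable_emeasure_subprob_algebra) auto
  then show ?thesis
    unfolding step_laws_def prob_algebra_def by (rule measurable_restrict_space1)
qed

lemma measurable_stack_dist:
  "stack_dist \<in> step_laws \<rightarrow>\<^sub>M prob_algebra (stack_space :: (nat \<Rightarrow> ('d::finite) site) measure)"
proof (rule measurable_prob_algebra_generated[OF sets_PiM Int_stable_prod_algebra prod_algebra_sets_into_space])
  let ?M = "\<lambda>_::nat. count_space (UNIV :: 'd site set)"
  fix A assume "A \<in> prod_algebra UNIV ?M"
  then obtain J F where A: "A = prod_emb UNIV ?M J (Pi\<^sub>E J F)" and J: "finite J"
    by (auto elim!: prod_algebraE)
  have "A = {s. \<forall>j\<in>J. s j \<in> F j}" by (auto simp: A prod_emb_def PiE_iff)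
  then have "emeasure (stack_dist p) A = (\<Prod>j\<in>J. emeasure p (F j \<inter> unit_steps))" if "p \<in> space step_laws" for p
    using emeasure_stack_dist[OF that J] by simp
  moreover have "(\<lambda>p. \<Prod>j\<in>J. emeasure p (F j \<inter> unit_steps)) \<in> borel_measurable step_laws"
    by (intro borel_measurable_prod_ennreal measurable_emeasure_step_laws) auto
  ultimately show "(\<lambda>p. emeasure (stack_dist p) A) \<in> borel_measurable step_laws"
    by (simp cong: measurable_cong)
qed (auto simp: prob_space_stack_dist sets_stack_dist)

lemma prod_emeasure_unit_step:
  assumes "p \<in> space step_laws"
  shows "emeasure p ({s. unit_step s = e} \<inter> unit_steps) = emeasure p {e}"
proof (cases "e \<in> unit_steps")
  case True
  then have "{s. unit_step s = e} \<inter> unit_steps = {e}" by (auto simp: unit_step_id)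
  then show ?thesis by simp
next
  case False
  then have "{s. unit_step s = e} \<inter> unit_steps = {}" using unit_step_in by auto
  \<comment> \<open>Outside the unit steps \<open>{e}\<close> is not measurable for
    \<open>p\<close>, and \<open>emeasure\<close> is 0 there by default.\<close>
  moreover have "{e} \<notin> sets p" using assms False by (simp add: step_laws_def space_prob_algebra)
  ultimately show ?thesis by (simp add: emeasure_notin_sets)
qed

context
  fixes \<mu> :: "('d::finite) site measure measure"
  assumes prob_space_mu: "prob_space \<mu>" and sets_mu: "sets \<mu> = sets step_laws"
begin

lemma mu_prob_algebra: "\<mu> \<in> space (prob_algebra step_laws)"
  using prob_space_mu sets_mu by (simp add: space_prob_algebra)

lemma space_mu: "space \<mu> = space step_laws"
  by (rule sets_eq_imp_space_eq[OF sets_mu])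

lemma sets_stack_law: "sets (stack_law \<mu>) = sets stack_space"
  unfolding stack_law_def by (rule sets_bind'[OF mu_prob_algebra measurable_stack_dist])

lemma emeasure_stack_law:
  "A \<in> sets stack_space \<Longrightarrow> emeasure (stack_law \<mu>) A = (\<integral>\<^sup>+p. emeasure (stack_dist p) A \<partial>\<mu>)"
  unfolding stack_law_def by (rule emeasure_bind_prob_algebra[OF mu_prob_algebra measurable_stack_dist])

lemma stationary_stack_law: "stationary_stacks (stack_law \<mu>)"
proof (rule stationary_stacks.intro)
  show "prob_space (stack_law \<mu>)"
    unfolding stack_law_def by (rule prob_space_bind'[OF mu_prob_algebra measurable_stack_dist])
  show "sets (stack_law \<mu>) = sets stack_space" by (rule sets_stack_law)
  fix c :: nat
  let ?s = "\<lambda>s k. s (k + c) :: 'd site"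
  have s: "?s \<in> stack_space \<rightarrow>\<^sub>M stack_space"
    by (rule measurable_PiM_single') (auto simp: space_PiM)
  have sp: "space (stack_law \<mu>) = UNIV" using sets_eq_imp_space_eq[OF sets_stack_law] by (simp add: space_PiM)
  show "distr (stack_law \<mu>) (stack_law \<mu>) ?s = stack_law \<mu>"
  proof (rule measure_eqI)
    fix A assume "A \<in> sets (distr (stack_law \<mu>) (stack_law \<mu>) ?s)"
    then have A: "A \<in> sets stack_space" by (simp add: sets_stack_law)
    have A': "?s -` A \<in> sets stack_space" using measurable_sets[OF s A] by (simp add: space_PiM)
    have "emeasure (distr (stack_law \<mu>) (stack_law \<mu>) ?s) A = emeasure (stack_law \<mu>) (?s -` A)"
      using A s by (subst emeasure_distr)
        (simp_all add: sp sets_stack_law measurable_cong_sets[OF sets_stack_law sets_stack_law])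
    also have "\<dots> = (\<integral>\<^sup>+p. emeasure (stack_dist p) (?s -` A) \<partial>\<mu>)" by (rule emeasure_stack_law[OF A'])
    also have "\<dots> = (\<integral>\<^sup>+p. emeasure (stack_dist p) A \<partial>\<mu>)"
    proof (rule nn_integral_cong)
      fix p assume "p \<in> space \<mu>"
      then have p: "p \<in> space step_laws" by (simp add: space_mu)
      have "distr (stack_dist p) (stack_dist p) ?s = stack_dist p"
        using distr_PiM_reindex[of UNIV "\<lambda>_. step_dist p" "\<lambda>k. k + c" UNIV] prob_space_step_dist[OF p]
        by (simp add: stack_dist_def restrict_UNIV)
      then have "emeasure (stack_dist p) A = emeasure (distr (stack_dist p) (stack_dist p) ?s) A" by simp
      also have "\<dots> = emeasure (stack_dist p) (?s -` A)"
        using A s by (subst emeasure_distr)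
          (simp_all add: sets_stack_dist measurable_cong_sets[OF sets_stack_dist sets_stack_dist]
            sets_eq_imp_space_eq[OF sets_stack_dist] space_PiM)
      finally show "emeasure (stack_dist p) (?s -` A) = emeasure (stack_dist p) A" ..
    qed
    also have "\<dots> = emeasure (stack_law \<mu>) A" by (rule emeasure_stack_law[OF A, symmetric])
    finally show "emeasure (distr (stack_law \<mu>) (stack_law \<mu>) ?s) A = emeasure (stack_law \<mu>) A" .
  qed simp
qed

text \<open>Given \<open>p\<close>, the entries of the stack are independent. Injectivity of
  \<open>k\<close> ensures that different requirements concern different entries, so the conditional
  probability is a product.\<close>

lemma emeasure_stack_law_prescribed:
  assumes I: "finite I" and inj: "inj_on k I"
  shows "emeasure (stack_law \<mu>) {s. \<forall>i\<in>I. unit_step (s (k i)) = e i} = (\<integral>\<^sup>+p. (\<Prod>i\<in>I. emeasure p {e i}) \<partial>\<mu>)"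
proof -
  let ?F = "\<lambda>j. {s. unit_step s = e (the_inv_into I k j)}"
  have eq: "{s. \<forall>i\<in>I. unit_step (s (k i)) = e i} = {s. \<forall>j\<in>k ` I. s j \<in> ?F j}"
    by (auto simp: the_inv_into_f_f[OF inj])
  have "{s. \<forall>j\<in>k ` I. s j \<in> ?F j} = prod_emb UNIV (\<lambda>_. count_space UNIV) (k ` I) (Pi\<^sub>E (k ` I) ?F)"
    by (auto simp: prod_emb_def PiE_iff)
  also have "\<dots> \<in> sets stack_space" using I by (intro sets_PiM_I) auto
  finally have "emeasure (stack_law \<mu>) {s. \<forall>j\<in>k ` I. s j \<in> ?F j}
      = (\<integral>\<^sup>+p. emeasure (stack_dist p) {s. \<forall>j\<in>k ` I. s j \<in> ?F j} \<partial>\<mu>)" by (rule emeasure_stack_law)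
  also have "\<dots> = (\<integral>\<^sup>+p. (\<Prod>i\<in>I. emeasure p {e i}) \<partial>\<mu>)"
  proof (rule nn_integral_cong)
    fix p assume "p \<in> space \<mu>"
    then have p: "p \<in> space step_laws" by (simp add: space_mu)
    have "emeasure (stack_dist p) {s. \<forall>j\<in>k ` I. s j \<in> ?F j} = (\<Prod>j\<in>k ` I. emeasure p (?F j \<inter> unit_steps))"
      using I by (intro emeasure_stack_dist[OF p]) auto
    also have "\<dots> = (\<Prod>i\<in>I. emeasure p (?F (k i) \<inter> unit_steps))"
      by (subst prod.reindex[OF inj]) (simp add: comp_def)
    also have "\<dots> = (\<Prod>i\<in>I. emeasure p {e i})"
    proof (rule prod.cong[OF refl])
      fix i assume "i \<in> I"
      then have k: "the_inv_into I k (k i) = i" by (rule the_inv_into_f_f[OF inj])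
      show "emeasure p (?F (k i) \<inter> unit_steps) = emeasure p {e i}"
        unfolding k by (rule prod_emeasure_unit_step[OF p])
    qed
    finally show "emeasure (stack_dist p) {s. \<forall>j\<in>k ` I. s j \<in> ?F j} = (\<Prod>i\<in>I. emeasure p {e i})" .
  qed
  finally show ?thesis by (simp only: eq)
qed

text \<open>The quenched probability of a path is grouped by the site from which each step is made.
  Distinct sites have independent environments, so the integral becomes a product of mixed moments
  of \<open>\<mu>\<close>.\<close>

lemma emeasure_annealed_cylinder:
  "emeasure (annealed_law \<mu>) {X. \<forall>i\<le>n. X i = x i} = indicator {0} (x 0) *
    (\<Prod>y\<in>x ` {..<n}. \<integral>\<^sup>+p. (\<Prod>i\<in>{i\<in>{..<n}. x i = y}. emeasure p {x (Suc i) - x i}) \<partial>\<mu>)"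
proof -
  let ?V = "x ` {..<n}"
  let ?f = "\<lambda>y p. \<Prod>i\<in>{i\<in>{..<n}. x i = y}. emeasure p {x (Suc i) - x i}"
  interpret P: product_prob_space "\<lambda>_. \<mu>" "UNIV :: 'd site set"
    by (intro product_prob_spaceI prob_space_mu)
  have \<omega>: "\<omega> y \<in> space step_laws" if "\<omega> \<in> space (environment_law \<mu>)" for \<omega> y
    using that by (auto simp: environment_law_def space_PiM space_mu)
  have f: "?f y \<in> borel_measurable \<mu>" for y
  proof -
    have "(\<lambda>p. emeasure p {e}) \<in> borel_measurable \<mu>" for e
    proof (cases "e \<in> unit_steps")
      case True
      then show ?thesis using measurable_emeasure_step_laws[of "{e}"]
        by (simp add: measurable_cong_sets[OF sets_mu refl])
    next
      case False
      then have "emeasure p {e} = 0" if "p \<in> space \<mu>" for p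
        using that by (intro emeasure_notin_sets) (auto simp: space_mu step_laws_def space_prob_algebra)
      then show ?thesis by (simp cong: measurable_cong)
    qed
    then show ?thesis by (intro borel_measurable_prod_ennreal) auto
  qed
  have cyl: "{X. \<forall>i\<le>n. X i = x i} \<in> sets path_space" by (rule sets_path_prefix[of n]) auto
  have "emeasure (annealed_law \<mu>) {X. \<forall>i\<le>n. X i = x i}
      = (\<integral>\<^sup>+\<omega>. emeasure (quenched_law \<omega>) {X. \<forall>i\<le>n. X i = x i} \<partial>environment_law \<mu>)"
    by (rule annealed_law(3)[OF prob_space_mu sets_mu cyl])
  also have "\<dots> = (\<integral>\<^sup>+\<omega>. indicator {0} (x 0) * (\<Prod>y\<in>?V. ?f y (restrict \<omega> ?V y)) \<partial>environment_law \<mu>)"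
  proof (rule nn_integral_cong)
    fix \<omega> assume "\<omega> \<in> space (environment_law \<mu>)"
    have "(\<Prod>i<n. emeasure (\<omega> (x i)) {x (Suc i) - x i})
        = (\<Prod>y\<in>?V. \<Prod>i\<in>{i\<in>{..<n}. x i = y}. emeasure (\<omega> (x i)) {x (Suc i) - x i})"
      by (rule prod.image_gen) simp
    also have "\<dots> = (\<Prod>y\<in>?V. ?f y (restrict \<omega> ?V y))"
      by (intro prod.cong refl) auto
    finally show "emeasure (quenched_law \<omega>) {X. \<forall>i\<le>n. X i = x i}
        = indicator {0} (x 0) * (\<Prod>y\<in>?V. ?f y (restrict \<omega> ?V y))"
      using emeasure_quenched_law_cylinder[OF \<omega>[OF \<open>\<omega> \<in> space (environment_law \<mu>)\<close>], where n=n and x=x] by simp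
  qed
  also have "\<dots> = indicator {0} (x 0) * (\<integral>\<^sup>+\<omega>. (\<Prod>y\<in>?V. ?f y (restrict \<omega> ?V y)) \<partial>environment_law \<mu>)"
    by (cases "x 0 = 0") auto
  also have "(\<integral>\<^sup>+\<omega>. (\<Prod>y\<in>?V. ?f y (restrict \<omega> ?V y)) \<partial>environment_law \<mu>)
      = (\<integral>\<^sup>+\<omega>. (\<Prod>y\<in>?V. ?f y (\<omega> y)) \<partial>distr (environment_law \<mu>) (PiM ?V (\<lambda>_. \<mu>)) (\<lambda>\<omega>. restrict \<omega> ?V))"
  proof (rule nn_integral_distr[symmetric, where f="\<lambda>\<omega>. \<Prod>y\<in>?V. ?f y (\<omega> y)" and T="\<lambda>\<omega>. restrict \<omega> ?V"])
    show "(\<lambda>\<omega>. restrict \<omega> ?V) \<in> environment_law \<mu> \<rightarrow>\<^sub>M PiM ?V (\<lambda>_. \<mu>)"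
      unfolding environment_law_def by (rule measurable_restrict_subset) simp
    show "(\<lambda>\<omega>. \<Prod>y\<in>?V. ?f y (\<omega> y))
        \<in> borel_measurable (distr (environment_law \<mu>) (PiM ?V (\<lambda>_. \<mu>)) (\<lambda>\<omega>. restrict \<omega> ?V))"
      unfolding measurable_distr_eq1
    proof (rule borel_measurable_prod_ennreal)
      fix y assume "y \<in> ?V"
      then have "(\<lambda>\<omega>. \<omega> y) \<in> PiM ?V (\<lambda>_. \<mu>) \<rightarrow>\<^sub>M \<mu>" by (rule measurable_component_singleton)
      from measurable_compose[OF this f[of y]]
      show "(\<lambda>\<omega>. ?f y (\<omega> y)) \<in> borel_measurable (PiM ?V (\<lambda>_. \<mu>))" .
    qed
  qed
  also have "distr (environment_law \<mu>) (PiM ?V (\<lambda>_. \<mu>)) (\<lambda>\<omega>. restrict \<omega> ?V) = PiM ?V (\<lambda>_. \<mu>)"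
    unfolding environment_law_def by (rule P.distr_PiM_restrict_finite) auto
  also have "(\<integral>\<^sup>+\<omega>. (\<Prod>y\<in>?V. ?f y (\<omega> y)) \<partial>PiM ?V (\<lambda>_. \<mu>)) = (\<Prod>y\<in>?V. \<integral>\<^sup>+p. ?f y p \<partial>\<mu>)"
    by (rule P.product_nn_integral_prod[OF _ f]) simp
  finally show ?thesis .
qed

lemma inj_on_visit_number: "inj_on (\<lambda>i. card {j. j < i \<and> x j = x i}) {i\<in>{..<n::nat}. x i = y}"
proof (rule linorder_inj_onI)
  fix i i' assume *: "i < i'" "i \<in> {i\<in>{..<n}. x i = y}" "i' \<in> {i\<in>{..<n}. x i = y}"
  have "{j. j < i \<and> x j = x i} \<subset> {j. j < i' \<and> x j = x i'}" using * by auto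
  then have "card {j. j < i \<and> x j = x i} < card {j. j < i' \<and> x j = x i'}"
    by (intro psubset_card_mono) auto
  then show "card {j. j < i \<and> x j = x i} \<noteq> card {j. j < i' \<and> x j = x i'}" by simp
qed auto

text \<open>On cylinders both laws are products over the visited sites. Reading a new entry at each
  visit gives, at one site, the mixture over \<open>p\<close> of products of step probabilities,
  which is the moment in \<open>emeasure_annealed_cylinder\<close>.\<close>

lemma annealed_law_eq_path_law: "annealed_law \<mu> = stationary_stacks.path_law (stack_law \<mu>)"
proof -
  interpret stationary_stacks "stack_law \<mu>" by (rule stationary_stack_law)
  show ?thesis
  proof (rule measure_eqI_cylinders)
    show "finite_measure (annealed_law \<mu>)"
      using annealed_law(1)[OF prob_space_mu sets_mu] by (simp add: prob_space_def)
    show "sets (annealed_law \<mu>) = sets path_space" by (rule annealed_law(2)[OF prob_space_mu sets_mu])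
    show "sets path_law = sets path_space" by simp
    fix n and x :: "nat \<Rightarrow> 'd site"
    define k where "k i = card {j. j < i \<and> x j = x i}" for i
    define S where "S y = {s. \<forall>i\<in>{i\<in>{..<n}. x i = y}. unit_step (s (k i)) = x (Suc i) - x i}" for y
    have cyl: "{X. \<forall>i\<le>n. X i = x i} \<in> sets path_space" by (rule sets_path_prefix[of n]) auto
    have "emeasure path_law {X. \<forall>i\<le>n. X i = x i} = emeasure law {\<xi>. \<forall>i\<le>n. walk 0 \<xi> i = x i}"
      unfolding path_law_def using cyl by (subst emeasure_distr) (auto simp: measurable_walk vimage_def)
    also have "\<dots> = indicator {0} (x 0) * emeasure law (prod_emb UNIV (\<lambda>_. stack_law \<mu>) (x ` {..<n}) (Pi\<^sub>E (x ` {..<n}) S))"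
    proof -
      have "(\<forall>i<n. unit_step (\<xi> (x i) (k i)) = x (Suc i) - x i) \<longleftrightarrow> (\<forall>y\<in>x ` {..<n}. \<xi> y \<in> S y)" for \<xi>
      proof
        assume a: "\<forall>i<n. unit_step (\<xi> (x i) (k i)) = x (Suc i) - x i"
        show "\<forall>y\<in>x ` {..<n}. \<xi> y \<in> S y"
          unfolding S_def
        proof (intro ballI CollectI)
          fix y i assume "i \<in> {i\<in>{..<n}. x i = y}"
          then show "unit_step (\<xi> y (k i)) = x (Suc i) - x i" using a by auto
        qed
      qed (auto simp: S_def)
      then have "{\<xi>. \<forall>i\<le>n. walk 0 \<xi> i = x i}
          = (if x 0 = 0 then prod_emb UNIV (\<lambda>_. stack_law \<mu>) (x ` {..<n}) (Pi\<^sub>E (x ` {..<n}) S) else {})"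
        unfolding walk_follows_iff k_def[symmetric] by (auto simp: prod_emb_def PiE_iff)
      then show ?thesis by simp
    qed
    also have "emeasure law (prod_emb UNIV (\<lambda>_. stack_law \<mu>) (x ` {..<n}) (Pi\<^sub>E (x ` {..<n}) S))
        = (\<Prod>y\<in>x ` {..<n}. emeasure (stack_law \<mu>) (S y))"
      unfolding law_def
    proof (rule comp.emeasure_PiM_emb)
      fix y
      have "S y \<in> sets stack_space" unfolding S_def
      proof (rule sets_path_prefix[of "\<Sum>i<n. k i"], intro ballI)
        fix s t :: "nat \<Rightarrow> 'd site" and i
        assume st: "\<And>j. j \<le> (\<Sum>i<n. k i) \<Longrightarrow> s j = t j"
          and s: "\<forall>i\<in>{i\<in>{..<n}. x i = y}. unit_step (s (k i)) = x (Suc i) - x i"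
          and i: "i \<in> {i\<in>{..<n}. x i = y}"
        have "k i \<le> (\<Sum>i<n. k i)" using i by (intro member_le_sum) auto
        then have "s (k i) = t (k i)" by (rule st)
        moreover have "unit_step (s (k i)) = x (Suc i) - x i" using s i by blast
        ultimately show "unit_step (t (k i)) = x (Suc i) - x i" by simp
      qed
      then show "S y \<in> sets (stack_law \<mu>)" by (simp add: sets_stack_law)
    qed auto
    also have "\<dots> = (\<Prod>y\<in>x ` {..<n}. \<integral>\<^sup>+p. (\<Prod>i\<in>{i\<in>{..<n}. x i = y}. emeasure p {x (Suc i) - x i}) \<partial>\<mu>)"
      unfolding S_def k_def
      by (intro prod.cong refl emeasure_stack_law_prescribed inj_on_visit_number) auto
    finally show "emeasure (annealed_law \<mu>) {X. \<forall>i\<le>n. X i = x i} = emeasure path_law {X. \<forall>i\<le>n. X i = x i}"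
      by (simp only: emeasure_annealed_cylinder)
  qed
qed

end

section \<open>The speed in one direction and the theorem\<close>

lemma proj_add: "proj l (x + y) = proj l x + proj l y"
proof -
  have "(\<chi> i. real_of_int ((x + y) $ i)) = (\<chi> i. real_of_int (x $ i)) + (\<chi> i. real_of_int (y $ i))"
    by (simp add: vec_eq_iff)
  then show ?thesis by (simp add: proj_def inner_add_left)
qed

lemma proj_uminus_left: "proj (- l) x = - proj l x"
  by (simp add: proj_def)

lemma abs_proj_unit_step:
  assumes "e \<in> unit_steps"
  shows "\<bar>proj l e\<bar> \<le> norm l"
proof -
  obtain j where "e = axis j 1 \<or> e = - axis j 1" using assms by (auto simp: unit_steps_def)
  then have "(\<chi> i. real_of_int (e $ i)) = axis j 1 \<or> (\<chi> i. real_of_int (e $ i)) = - axis j 1"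
    by (auto simp: vec_eq_iff axis_def)
  then have "\<bar>proj l e\<bar> = \<bar>l $ j\<bar>" by (auto simp: proj_def inner_axis')
  then show ?thesis using component_le_norm_cart[of l j] by simp
qed

text \<open>Off \<open>A_plus l\<close> only an upper bound is asked for. The matching lower bound
  comes from the same property for \<open>-l\<close>.\<close>

definition one_sided_speed :: "real ^ ('d::finite) \<Rightarrow> real \<Rightarrow> (nat \<Rightarrow> 'd site) \<Rightarrow> bool" where
  "one_sided_speed l v X \<longleftrightarrow> (if X \<in> A_plus l then (\<lambda>n. proj l (X n) / real n) \<longlonglongrightarrow> v
    else \<forall>c>0. eventually (\<lambda>n. proj l (X n) \<le> c * real n) sequentially)"

text \<open>If escape is null, the upper speed is at most 0 throughout, and on
  \<open>A_plus l\<close> the heights are eventually nonnegative, so the speed is 0. Otherwise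
  unbounded paths almost surely tend to infinity with the regeneration speed, so almost every path
  off \<open>A_plus l\<close> is bounded above.\<close>

lemma AE_one_sided_speed:
  fixes \<mu> :: "('d::finite) site measure measure" and l :: "real ^ 'd"
  assumes "prob_space \<mu>" and "sets \<mu> = sets step_laws"
  shows "\<exists>v. AE X in annealed_law \<mu>. one_sided_speed l v X"
proof -
  \<comment> \<open>Division by \<open>C\<close> brings the heights of unit steps to at most 1; the
    summand 1 keeps \<open>C\<close> positive.\<close>
  define C where "C = 1 + norm l"
  have C: "0 < C" by (simp add: C_def add_pos_nonneg)
  define h where "h x = proj l x / C" for x
  have proj_h: "proj l x = C * h x" for x using C by (simp add: h_def)
  interpret stack_walk "stack_law \<mu>" h
  proof (intro stack_walk.intro stationary_stack_law assms stack_walk_axioms.intro)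
    show "h (x + y) = h x + h y" for x y by (simp add: h_def proj_add add_divide_distrib)
    show "\<bar>h e\<bar> \<le> 1" if "e \<in> unit_steps" for e
      using abs_proj_unit_step[OF that, of l] C by (simp add: h_def C_def)
  qed
  have top: "X \<in> A_plus l \<longleftrightarrow> filterlim (\<lambda>n. h (X n)) at_top sequentially" for X
    unfolding A_plus_def mem_Collect_eq proj_h
    using filterlim_tendsto_pos_mult_at_top_iff[OF tendsto_const C, of "\<lambda>n. h (X n)" sequentially] .
  have upper: "\<forall>c>0. eventually (\<lambda>n. proj l (X n) \<le> c * real n) sequentially"
    if "\<forall>c>0. eventually (\<lambda>n. h (X n) \<le> c * real n) sequentially" for X
  proof (intro allI impI)
    fix c :: real assume "0 < c"
    then have "0 < c / C" using C by simp
    then have "eventually (\<lambda>n. h (X n) \<le> c / C * real n) sequentially" using that by blast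
    then show "eventually (\<lambda>n. proj l (X n) \<le> c * real n) sequentially"
      by (rule eventually_mono) (use C in \<open>simp add: proj_h field_simps\<close>)
  qed
  show ?thesis
  proof (cases "path.prob escape = 0")
    case True
    have "AE X in path_law. one_sided_speed l 0 X"
      using AE_speed_le_0[OF True]
    proof eventually_elim
      fix X assume le: "\<forall>c>0. eventually (\<lambda>n. h (X n) \<le> c * real n) sequentially"
      have "(\<lambda>n. proj l (X n) / real n) \<longlonglongrightarrow> 0" if "X \<in> A_plus l"
      proof (rule tendstoI)
        fix r :: real assume "0 < r"
        have "eventually (\<lambda>n. 0 \<le> proj l (X n)) sequentially"
          using that unfolding A_plus_def mem_Collect_eq filterlim_at_top by blast
        moreover have "eventually (\<lambda>n. proj l (X n) \<le> r / 2 * real n) sequentially"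
          using upper[OF le] \<open>0 < r\<close> half_gt_zero by blast
        ultimately show "eventually (\<lambda>n. dist (proj l (X n) / real n) 0 < r) sequentially"
          using eventually_gt_at_top[of 0]
        proof eventually_elim
          case (elim n)
          then have "proj l (X n) / real n \<le> r / 2" "0 \<le> proj l (X n) / real n" by (simp_all add: field_simps)
          then have "\<bar>proj l (X n) / real n\<bar> \<le> r / 2" by (simp only: abs_of_nonneg)
          then show ?case using \<open>0 < r\<close> by (simp add: dist_real_def del: abs_divide)
        qed
      qed
      then show "one_sided_speed l 0 X"
        using upper[OF le] by (simp add: one_sided_speed_def)
    qed
    then show ?thesis unfolding annealed_law_eq_path_law[OF assms] by blast
  next
    case False
    interpret escaping_walk "stack_law \<mu>" h
      by unfold_locales (use False in \<open>simp add: less_le\<close>)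
    obtain v where "AE X in path_law. X \<in> unbounded \<longrightarrow>
      (\<lambda>n. h (X n) / real n) \<longlonglongrightarrow> v \<and> filterlim (\<lambda>n. h (X n)) at_top sequentially"
      using AE_speed_unbounded ..
    then have "AE X in path_law. one_sided_speed l (C * v) X"
    proof eventually_elim
      fix X assume X: "X \<in> unbounded \<longrightarrow>
        (\<lambda>n. h (X n) / real n) \<longlonglongrightarrow> v \<and> filterlim (\<lambda>n. h (X n)) at_top sequentially"
      show "one_sided_speed l (C * v) X"
      proof (cases "X \<in> unbounded")
        case True
        then have lim: "(\<lambda>n. h (X n) / real n) \<longlonglongrightarrow> v" and "X \<in> A_plus l"
          using X by (simp_all add: top)
        then show ?thesis using tendsto_mult_left[OF lim, of C] by (simp add: one_sided_speed_def proj_h)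
      next
        case False
        then obtain k where k: "\<And>n. h (X n) < real k" unfolding unbounded_def by (auto simp: not_le)
        have "X \<notin> A_plus l"
        proof
          assume "X \<in> A_plus l"
          then have "eventually (\<lambda>n. real k \<le> h (X n)) sequentially"
            unfolding top filterlim_at_top by blast
          then obtain n where "real k \<le> h (X n)" by (auto simp: eventually_sequentially)
          with k[of n] show False by simp
        qed
        moreover have "\<forall>c>0. eventually (\<lambda>n. h (X n) \<le> c * real n) sequentially"
        proof (intro allI impI)
          fix c :: real assume "0 < c"
          show "eventually (\<lambda>n. h (X n) \<le> c * real n) sequentially"
            unfolding eventually_sequentially
          proof (intro exI allI impI)
            fix n assume "nat \<lceil>real k / c\<rceil> \<le> n"
            then have "real k / c \<le> real n" by linarith
            then have "real k \<le> c * real n" using \<open>0 < c\<close> by (simp add: field_simps)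
            then show "h (X n) \<le> c * real n" using k[of n] by simp
          qed
        qed
        ultimately show ?thesis using upper by (simp add: one_sided_speed_def)
      qed
    qed
    then show ?thesis unfolding annealed_law_eq_path_law[OF assms] by blast
  qed
qed

theorem theorem1p4:
  fixes \<mu> :: "(int ^ 'd) measure measure" and l :: "real ^ 'd"
  assumes "CARD('d::finite) \<ge> 2"
    and "prob_space \<mu>" and "sets \<mu> = sets step_laws"
    and "l \<noteq> 0"
  shows "\<exists>v_plus v_minus :: real. AE X in annealed_law \<mu>.
    (\<lambda>n. proj l (X n) / real n) \<longlonglongrightarrow>
      v_plus * indicator (A_plus l) X + v_minus * indicator (A_minus l) X"
proof -
  have minus: "A_minus l = A_plus (- l)"
    unfolding A_minus_def A_plus_def proj_uminus_left
    by (simp add: filterlim_uminus_at_bot)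
  obtain v where "AE X in annealed_law \<mu>. one_sided_speed l v X"
    using AE_one_sided_speed[OF assms(2,3), of l] ..
  moreover obtain w where "AE X in annealed_law \<mu>. one_sided_speed (- l) w X"
    using AE_one_sided_speed[OF assms(2,3), of "- l"] ..
  ultimately have "AE X in annealed_law \<mu>. (\<lambda>n. proj l (X n) / real n) \<longlonglongrightarrow>
      v * indicator (A_plus l) X + (- w) * indicator (A_minus l) X"
  proof eventually_elim
    fix X
    assume p: "one_sided_speed l v X"
      and m: "one_sided_speed (- l) w X"
    have disj: "\<not> (X \<in> A_plus l \<and> X \<in> A_minus l)"
    proof
      assume "X \<in> A_plus l \<and> X \<in> A_minus l"
      then have "eventually (\<lambda>n. 1 \<le> proj l (X n)) sequentially" "eventually (\<lambda>n. proj l (X n) \<le> 0) sequentially"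
        unfolding A_plus_def A_minus_def mem_Collect_eq filterlim_at_top filterlim_at_bot by blast+
      then have "eventually (\<lambda>n. False) sequentially" by eventually_elim simp
      then show False by simp
    qed
    consider "X \<in> A_plus l" "X \<notin> A_minus l" | "X \<notin> A_plus l" "X \<in> A_minus l" | "X \<notin> A_plus l" "X \<notin> A_minus l"
      using disj by blast
    then show "(\<lambda>n. proj l (X n) / real n) \<longlonglongrightarrow> v * indicator (A_plus l) X + (- w) * indicator (A_minus l) X"
    proof cases
      case 1
      then show ?thesis using p by (simp add: one_sided_speed_def)
    next
      case 2
      then have "(\<lambda>n. proj (- l) (X n) / real n) \<longlonglongrightarrow> w" using m by (simp add: minus one_sided_speed_def)
      from tendsto_minus[OF this] show ?thesis using 2 by (simp add: proj_uminus_left)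
    next
      \<comment> \<open>Neither event occurs, so the upper bounds in the directions \<open>l\<close>
        and \<open>-l\<close> squeeze the speed to 0.\<close>
      case 3
      then have le: "\<forall>c>0. eventually (\<lambda>n. proj l (X n) \<le> c * real n) sequentially"
        "\<forall>c>0. eventually (\<lambda>n. proj (- l) (X n) \<le> c * real n) sequentially"
        using p m by (simp_all add: minus one_sided_speed_def)
      have "(\<lambda>n. proj l (X n) / real n) \<longlonglongrightarrow> 0"
      proof (rule tendstoI)
        fix r :: real assume "0 < r"
        then have "0 < r / 2" by simp
        have "eventually (\<lambda>n. proj l (X n) \<le> r / 2 * real n) sequentially"
          using le(1) \<open>0 < r / 2\<close> by blast
        moreover have "eventually (\<lambda>n. proj (- l) (X n) \<le> r / 2 * real n) sequentially"
          using le(2) \<open>0 < r / 2\<close> by blast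
        ultimately show "eventually (\<lambda>n. dist (proj l (X n) / real n) 0 < r) sequentially"
          using eventually_gt_at_top[of 0]
        proof eventually_elim
          case (elim n)
          then have "proj l (X n) / real n \<le> r / 2" "- (r / 2) \<le> proj l (X n) / real n"
            by (simp_all add: proj_uminus_left field_simps)
          then have "\<bar>proj l (X n) / real n\<bar> \<le> r / 2" by (intro abs_leI) linarith+
          then show ?case using \<open>0 < r\<close> by (simp add: dist_real_def del: abs_divide)
        qed
      qed
      then show ?thesis using 3 by simp
    qed
  qed
  then show ?thesis by blast
qed

end
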